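(* Let $S^O$ be a complete hyperbolic Riemann surface of finite area, and let $S^C$ be its conformal compactification. Then the metric of $S^O$ can be adjusted in disjoint horocyclic neighbourhoods of the cusps to give a smooth metric of negative curvature on $S^C$ if and only if the cusps of $S^O$ have lengths $\ge 2\pi$. Explicitly, the following are equivalent: (a) there are pairwise disjoint horocyclic neighbourhoods, one for each cusp of $S^O$, and a smooth Riemannian metric on $S^C$, conformal with respect to the complex structure of $S^C$, with everywhere negative Gaussian curvature, which coincides with the hyperbolic metric of $S^O$ outside these neighbourhoods (and their cusp points); (b) there exist pairwise disjoint closed horocycles, one around each cusp of $S^O$, each of length $\ge 2\pi$.
   Context: $S^C$ is the compact Riemann surface obtained from $S^O$ by filling in the cusps (each cusp is a puncture, filled by one point) and taking the unique conformal structure on the filled-in surface extending that of $S^O$. The model cusp is $\mathbb{D}^*=\{z\in\mathbb{C}: 0<|z|<1\}$ with the complete hyperbolic metric $ds^*=-\frac{1}{|z|\log|z|}\,|dz|$. For $0<r<1$, $B_r=\{0<|z|<r\}$ and $C_r=\{|z|=r\}$; $C_r$ is a closed horocycle of length $-2\pi/\log r$. A horocyclic neighbourhood of a cusp $P$ of $S^O$ is a neighbourhood of $P$ in $S^O$ isometric to $B_r\subset(\mathbb{D}^*,ds^* )$ for some $0<r<1$, with $P$ corresponding to $0$. A closed horocycle around $P$ is the image of some $C_r$ under an isometric embedding into $S^O$ of a domain $V\subset\mathbb{D}^*$ containing $B_r\cup C_r$, with $P$ corresponding to $0$; its length is that of $C_r$. The lengths of the cusps of $S^O$ are said to be $\ge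 l$ if there exist disjoint closed horocycles around each cusp, each of length $\ge l$. *)

theory Defs
  imports "HOL-Analysis.Analysis"
begin

section \<open>Smooth functions on open subsets of the plane\<close>

definition dir_deriv :: "complex \<Rightarrow> (complex \<Rightarrow> 'b::real_normed_vector) \<Rightarrow> complex \<Rightarrow> 'b" where
  "dir_deriv v f z = frechet_derivative f (at z) v"

text \<open>Real differentiability throughout; only meant for open sets \<open>S\<close>.\<close>

primrec C_k_on :: "nat \<Rightarrow> complex set \<Rightarrow> (complex \<Rightarrow> 'b::real_normed_vector) \<Rightarrow> bool" where
  "C_k_on 0 S f \<longleftrightarrow> continuous_on S f"
| "C_k_on (Suc k) S f \<longleftrightarrow>
     (\<forall>z\<in>S. f differentiable (at z)) \<and>
     C_k_on k S (dir_deriv 1 f) \<and> C_k_on k S (dir_deriv \<i> f)"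

definition C_infinity_on :: "complex set \<Rightarrow> (complex \<Rightarrow> 'b::real_normed_vector) \<Rightarrow> bool" where
  "C_infinity_on S f \<longleftrightarrow> (\<forall>k. C_k_on k S f)"

definition laplacian :: "(complex \<Rightarrow> real) \<Rightarrow> complex \<Rightarrow> real" where
  "laplacian f z = dir_deriv 1 (dir_deriv 1 f) z + dir_deriv \<i> (dir_deriv \<i> f) z"


section \<open>Riemann surfaces\<close>

text \<open>A chart is a pair of its domain and its coordinate function; the values of the
  coordinate function off the domain are irrelevant.\<close>

type_synonym 'a chart = "'a set \<times> ('a \<Rightarrow> complex)"

definition is_chart :: "'a topology \<Rightarrow> 'a chart \<Rightarrow> bool" where
  "is_chart X c \<longleftrightarrow>
     openin X (fst c) \<and> open (snd c ` fst c) \<and>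
     homeomorphic_map (subtopology X (fst c)) (top_of_set (snd c ` fst c)) (snd c)"

text \<open>The map \<open>f\<close> in the coordinates \<open>c\<close> (source) and \<open>d\<close> (target).
  For \<open>f = id\<close> this is the transition function from \<open>c\<close> to \<open>d\<close>.\<close>

definition in_coords :: "('a \<Rightarrow> 'b) \<Rightarrow> 'a chart \<Rightarrow> 'b chart \<Rightarrow> complex \<Rightarrow> complex" where
  "in_coords f c d = snd d \<circ> f \<circ> inv_into (fst c) (snd c)"

definition holomorphic_map :: "'a chart set \<Rightarrow> 'b chart set \<Rightarrow> ('a \<Rightarrow> 'b) \<Rightarrow> bool" where
  "holomorphic_map A B f \<longleftrightarrow>
     (\<forall>c\<in>A. \<forall>d\<in>B. in_coords f c d holomorphic_on snd c ` (fst c \<inter> f -` fst d))"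

definition riemann_surface :: "'a topology \<Rightarrow> 'a chart set \<Rightarrow> bool" where
  "riemann_surface X A \<longleftrightarrow>
     topspace X \<noteq> {} \<and> connected_space X \<and> Hausdorff_space X \<and> second_countable X \<and>
     (\<forall>c\<in>A. is_chart X c) \<and> (\<Union>c\<in>A. fst c) = topspace X \<and>
     holomorphic_map A A id"


section \<open>Conformal metrics\<close>

text \<open>A conformal metric \<open>\<rho>\<close> assigns to each chart \<open>c\<close>, with coordinate \<open>z\<close>, a density
  \<open>\<rho> c\<close> on the image of \<open>c\<close>, such that the line element is \<open>\<rho> c z |dz|\<close>; that is, the
  Riemannian metric is \<open>(\<rho> c z)\<^sup>2 |dz|\<^sup>2\<close>.\<close>

type_synonym 'a density = "'a chart \<Rightarrow> complex \<Rightarrow> real"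

text \<open>The pullback under \<open>f\<close> of the conformal metric \<open>\<sigma>\<close> equals \<open>\<rho>\<close> at the point \<open>p\<close>.\<close>

definition pullback_eq_at ::
  "'a chart set \<Rightarrow> 'a density \<Rightarrow> 'b chart set \<Rightarrow> 'b density \<Rightarrow> ('a \<Rightarrow> 'b) \<Rightarrow> 'a \<Rightarrow> bool" where
  "pullback_eq_at A \<rho> B \<sigma> f p \<longleftrightarrow>
     (\<forall>c\<in>A. \<forall>d\<in>B. p \<in> fst c \<and> f p \<in> fst d \<longrightarrow>
        \<rho> c (snd c p) = \<sigma> d (snd d (f p)) * cmod (deriv (in_coords f c d) (snd c p)))"

definition conformal_metric :: "'a topology \<Rightarrow> 'a chart set \<Rightarrow> 'a density \<Rightarrow> bool" where
  "conformal_metric X A \<rho> \<longleftrightarrow>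
     (\<forall>c\<in>A. C_infinity_on (snd c ` fst c) (\<rho> c) \<and> (\<forall>z \<in> snd c ` fst c. \<rho> c z > 0)) \<and>
     (\<forall>p \<in> topspace X. pullback_eq_at A \<rho> A \<rho> id p)"

text \<open>The Gaussian curvature of \<open>\<rho> |dz|\<close>, at the point with coordinate \<open>z\<close> in the chart \<open>c\<close>.\<close>

definition gauss_curvature :: "'a density \<Rightarrow> 'a chart \<Rightarrow> complex \<Rightarrow> real" where
  "gauss_curvature \<rho> c z = - laplacian (\<lambda>w. ln (\<rho> c w)) z / (\<rho> c z)\<^sup>2"

definition negatively_curved :: "'a chart set \<Rightarrow> 'a density \<Rightarrow> bool" where
  "negatively_curved A \<rho> \<longleftrightarrow> (\<forall>c\<in>A. \<forall>z \<in> snd c ` fst c. gauss_curvature \<rho> c z < 0)"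

definition hyperbolic_metric :: "'a topology \<Rightarrow> 'a chart set \<Rightarrow> 'a density \<Rightarrow> bool" where
  "hyperbolic_metric X A \<rho> \<longleftrightarrow>
     conformal_metric X A \<rho> \<and> (\<forall>c\<in>A. \<forall>z \<in> snd c ` fst c. gauss_curvature \<rho> c z = -1)"

text \<open>\<open>joined_by A \<rho> p q L\<close>: there is a piecewise \<open>C\<^sup>1\<close> path of length \<open>L\<close> from \<open>p\<close> to \<open>q\<close>.
  Such a path is a finite concatenation of \<open>C\<^sup>1\<close> arcs, each inside one chart.\<close>

inductive joined_by :: "'a chart set \<Rightarrow> 'a density \<Rightarrow> 'a \<Rightarrow> 'a \<Rightarrow> real \<Rightarrow> bool"
  for A \<rho> where
  arc: "\<lbrakk>c \<in> A; p \<in> fst c; q \<in> fst c; g C1_differentiable_on {0..1};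
         g ` {0..1} \<subseteq> snd c ` fst c; g 0 = snd c p; g 1 = snd c q\<rbrakk> \<Longrightarrow>
       joined_by A \<rho> p q
         (integral {0..1} (\<lambda>t. \<rho> c (g t) * cmod (vector_derivative g (at t))))"
| join: "\<lbrakk>joined_by A \<rho> p q L; joined_by A \<rho> q r M\<rbrakk> \<Longrightarrow> joined_by A \<rho> p r (L + M)"

text \<open>The value \<open>0\<close> off the surface is there because the library's metric space locale asks
  for nonnegativity and symmetry on the whole type.\<close>

definition surface_dist :: "'a topology \<Rightarrow> 'a chart set \<Rightarrow> 'a density \<Rightarrow> 'a \<Rightarrow> 'a \<Rightarrow> real" where
  "surface_dist X A \<rho> p q =
     (if p \<in> topspace X \<and> q \<in> topspace X then Inf {L. joined_by A \<rho> p q L} else 0)"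

definition complete_metric :: "'a topology \<Rightarrow> 'a chart set \<Rightarrow> 'a density \<Rightarrow> bool" where
  "complete_metric X A \<rho> \<longleftrightarrow> Metric_space.mcomplete (topspace X) (surface_dist X A \<rho>)"

text \<open>The total area is the supremum over finite families of disjoint Borel pieces, each
  contained in one chart and described by its image there.\<close>

definition surface_area :: "'a chart set \<Rightarrow> 'a density \<Rightarrow> ennreal" where
  "surface_area A \<rho> =
     (SUP F \<in> {F. finite F \<and> F \<subseteq> {(c, E). c \<in> A \<and> E \<in> sets borel \<and> E \<subseteq> snd c ` fst c} \<and>
                  disjoint_family_on (\<lambda>(c, E). fst c \<inter> snd c -` E) F}.
        \<Sum>(c, E)\<in>F. \<integral>\<^sup>+ z\<in>E. ennreal ((\<rho> c z)\<^sup>2) \<partial>lborel)"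


section \<open>Cusps and horocycles\<close>

definition cusp_disc :: "real \<Rightarrow> complex set" where
  "cusp_disc r = {z. 0 < cmod z \<and> cmod z < r}"

definition cusp_density :: "complex \<Rightarrow> real" where
  "cusp_density z = - 1 / (cmod z * ln (cmod z))"

text \<open>A Riemannian isometry from the open subset \<open>V\<close> of the model cusp onto an open subset of
  the surface. It may reverse the orientation, hence the use of the real derivative.\<close>

definition isometric_embedding ::
  "'a topology \<Rightarrow> 'a chart set \<Rightarrow> 'a density \<Rightarrow> complex set \<Rightarrow> (complex \<Rightarrow> 'a) \<Rightarrow> bool" where
  "isometric_embedding X A \<rho> V \<phi> \<longleftrightarrow>
     continuous_map (top_of_set V) X \<phi> \<and> inj_on \<phi> V \<and>
     (\<forall>c\<in>A. C_infinity_on (V \<inter> \<phi> -` fst c) (snd c \<circ> \<phi>) \<and>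
        (\<forall>z \<in> V \<inter> \<phi> -` fst c. \<forall>v.
           \<rho> c (snd c (\<phi> z)) * cmod (frechet_derivative (snd c \<circ> \<phi>) (at z) v)
             = cusp_density z * cmod v))"

text \<open>Throughout, \<open>(X, A)\<close> with the metric \<open>\<rho>\<close> is the surface with cusps, \<open>(Y, B)\<close> is its
  compactification, and \<open>\<iota>\<close> is the inclusion of the former into the latter. The points of
  \<open>Y\<close> outside the range of \<open>\<iota>\<close> are the cusps.\<close>

definition cusps :: "'a topology \<Rightarrow> 'b topology \<Rightarrow> ('a \<Rightarrow> 'b) \<Rightarrow> 'b set" where
  "cusps X Y \<iota> = topspace Y - \<iota> ` topspace X"

definition horocyclic_nhd ::
  "'a topology \<Rightarrow> 'a chart set \<Rightarrow> 'a density \<Rightarrow> 'b topology \<Rightarrow> ('a \<Rightarrow> 'b) \<Rightarrow> 'b \<Rightarrow> 'a set \<Rightarrow> bool" where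
  "horocyclic_nhd X A \<rho> Y \<iota> P N \<longleftrightarrow>
     (\<exists>r \<phi>. 0 < r \<and> r < 1 \<and> isometric_embedding X A \<rho> (cusp_disc r) \<phi> \<and>
        limitin Y (\<iota> \<circ> \<phi>) P (at 0) \<and> N = \<phi> ` cusp_disc r \<and> openin Y (insert P (\<iota> ` N)))"

definition closed_horocycle ::
  "'a topology \<Rightarrow> 'a chart set \<Rightarrow> 'a density \<Rightarrow> 'b topology \<Rightarrow> ('a \<Rightarrow> 'b) \<Rightarrow> 'b \<Rightarrow> 'a set \<Rightarrow> real
    \<Rightarrow> bool" where
  "closed_horocycle X A \<rho> Y \<iota> P H l \<longleftrightarrow>
     (\<exists>r V \<phi>. 0 < r \<and> r < 1 \<and> open V \<and> connected V \<and> V \<subseteq> cusp_disc 1 \<and>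
        cusp_disc r \<union> sphere 0 r \<subseteq> V \<and> isometric_embedding X A \<rho> V \<phi> \<and>
        limitin Y (\<iota> \<circ> \<phi>) P (at 0) \<and> H = \<phi> ` sphere 0 r \<and> l = - 2 * pi / ln r)"

definition cusp_lengths_ge ::
  "'a topology \<Rightarrow> 'a chart set \<Rightarrow> 'a density \<Rightarrow> 'b topology \<Rightarrow> ('a \<Rightarrow> 'b) \<Rightarrow> real \<Rightarrow> bool" where
  "cusp_lengths_ge X A \<rho> Y \<iota> l \<longleftrightarrow>
     (\<exists>H. (\<forall>P \<in> cusps X Y \<iota>. \<exists>l' \<ge> l. closed_horocycle X A \<rho> Y \<iota> P (H P) l') \<and>
          disjoint_family_on H (cusps X Y \<iota>))"

text \<open>The compactification is determined up to isomorphism by these conditions: it is compact,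
  extends the conformal structure, and every added point fills in a cusp. By compactness
  there are finitely many added points, and no cusp is left unfilled.\<close>

definition conformal_compactification ::
  "'a topology \<Rightarrow> 'a chart set \<Rightarrow> 'a density \<Rightarrow> 'b topology \<Rightarrow> 'b chart set \<Rightarrow> ('a \<Rightarrow> 'b) \<Rightarrow> bool" where
  "conformal_compactification X A \<rho> Y B \<iota> \<longleftrightarrow>
     riemann_surface Y B \<and> compact_space Y \<and>
     embedding_map X Y \<iota> \<and> openin Y (\<iota> ` topspace X) \<and> holomorphic_map A B \<iota> \<and>
     (\<forall>P \<in> cusps X Y \<iota>. \<exists>N. horocyclic_nhd X A \<rho> Y \<iota> P N)"

end

theory Submission
  imports Defs "HOL-Complex_Analysis.Complex_Analysis"
begin

text \<open>
  In the model cusp put \<open>t = ln |z|\<close>. The horocycle \<open>|z| = r\<close> has length at least \<open>2 \<pi>\<close> iff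
  \<open>r \<ge> 1/e\<close>, and \<open>1/e\<close> is the radius where the density \<open>- 1 / (|z| ln |z|)\<close> of the cusp metric
  turns from decreasing to increasing. A radial metric \<open>e\<^sup>v |dz/z|\<close> is negatively curved iff \<open>v\<close> is a
  strictly convex function of \<open>t\<close>. It extends over the puncture only if \<open>v'\<close> tends to \<open>1\<close> at
  \<open>- \<infinity>\<close>, so negative curvature demands \<open>v' > 1\<close>; for the cusp \<open>v' = - 1/t\<close>, which exceeds \<open>1\<close> precisely
  when \<open>t > - 1\<close>.

  Suppose there are disjoint horocycles of length at least \<open>2 \<pi>\<close>. They bound disjoint closed
  discs around the cusps: if two of the discs overlapped, each horocycle would lie inside the other
  disc, but an isometry of an annulus around one cusp into the other cusp preserves the absolute
  value (\<open>annulus_isometry_preserves_norm\<close>), and then each radius would be less than the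
  other. By compactness the discs stay disjoint when they are slightly enlarged, to radii above
  \<open>1/e\<close>. There the cusp metric can be replaced by a smooth radial one (\<open>cusp_cap\<close>), and
  the pieces are glued together (\<open>glue_caps\<close>).

  Conversely, suppose a negatively curved metric \<open>\<sigma>\<close> of the compactification agrees with the
  hyperbolic one outside disjoint horocyclic neighbourhoods, of radii \<open>R P\<close> say. It suffices that
  \<open>R P > 1/e\<close> for every cusp \<open>P\<close> (\<open>radius_greater\<close>), because then the horocycles of radius
  \<open>1/e\<close> have length \<open>2 \<pi>\<close> and are disjoint. If the metrics agree on the outer side of an embedded
  horocycle, then by the theorem of Gauss and Bonnet its total geodesic curvature, which equals its
  length, exceeds \<open>2 \<pi>\<close>. But the neighbourhoods are open sets whose closures may touch each other or
  themselves, so that the metrics need not agree on the outer side.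

  Let \<open>w\<close> be the logarithm of the ratio of \<open>\<sigma>\<close> to the hyperbolic metric. It is a smooth
  function on the surface, which vanishes outside the neighbourhoods. If \<open>R P \<le> 1/e\<close>, then Hopf's
  boundary point lemma shows that \<open>w\<close> decreases at a definite rate into the neighbourhood of \<open>P\<close>
  (\<open>ratio_decay\<close>), so that at a boundary point \<open>p\<close> the outer normal derivative of \<open>w\<close> is positive. Hence \<open>w > 0\<close> just outside,
  where there must therefore be a horocyclic neighbourhood as well, with \<open>p\<close> in its boundary.
  Both boundaries are level curves of \<open>w\<close>, hence tangent at \<open>p\<close>, with opposite outer normals. Along
  each of them \<open>w\<close> is constant, so the Hessian of \<open>w\<close> in the tangential direction is the outer normal
  derivative times the curvature of a horocycle (\<open>horocycle_contact\<close>). Comparing the two expressions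
  shows that the normal derivative vanishes, which is a contradiction.
\<close>

section \<open>Calculus of smooth functions on the plane\<close>

lemma dir_deriv_eq:
  assumes "(f has_derivative D) (at z)"
  shows "dir_deriv v f z = D v"
  using frechet_derivative_at[OF assms] by (simp add: dir_deriv_def)

lemma dir_deriv_has_derivative:
  assumes "f differentiable (at z)"
  shows "(f has_derivative (\<lambda>v. dir_deriv v f z)) (at z)"
  using assms unfolding dir_deriv_def by (simp add: frechet_derivative_works)

lemma dir_deriv_linear:
  assumes "f differentiable (at z)"
  shows "dir_deriv v f z = Re v *\<^sub>R dir_deriv 1 f z + Im v *\<^sub>R dir_deriv \<i> f z"
proof -
  interpret bounded_linear "\<lambda>v. dir_deriv v f z"
    using dir_deriv_has_derivative[OF assms] by (rule has_derivative_bounded_linear)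
  have "v = Re v *\<^sub>R 1 + Im v *\<^sub>R \<i>" by (simp add: complex_eq_iff)
  then have "dir_deriv v f z = dir_deriv (Re v *\<^sub>R 1 + Im v *\<^sub>R \<i>) f z" by simp
  also have "\<dots> = Re v *\<^sub>R dir_deriv 1 f z + Im v *\<^sub>R dir_deriv \<i> f z"
    by (simp only: add scaleR)
  finally show ?thesis .
qed

lemma has_derivative_cong_open:
  assumes "open S" "z \<in> S" "\<And>w. w \<in> S \<Longrightarrow> f w = g w"
  shows "(f has_derivative D) (at z) \<longleftrightarrow> (g has_derivative D) (at z)"
  using assms has_derivative_transform_within_open[of f D z UNIV S g]
    has_derivative_transform_within_open[of g D z UNIV S f] by auto

lemma dir_deriv_cong_open:
  assumes "open S" "z \<in> S" "\<And>w. w \<in> S \<Longrightarrow> f w = g w"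
  shows "dir_deriv v f z = dir_deriv v g z"
  using has_derivative_cong_open[OF assms] unfolding dir_deriv_def frechet_derivative_def by simp

lemma differentiable_cong_open:
  assumes "open S" "z \<in> S" "\<And>w. w \<in> S \<Longrightarrow> f w = g w"
  shows "f differentiable (at z) \<longleftrightarrow> g differentiable (at z)"
  using has_derivative_cong_open[OF assms] unfolding differentiable_def by simp

lemma C_k_on_cong:
  assumes "open S" "\<And>w. w \<in> S \<Longrightarrow> f w = g w"
  shows "C_k_on k S f \<longleftrightarrow> C_k_on k S g"
  using assms(2)
proof (induction k arbitrary: f g)
  case 0
  then show ?case using continuous_on_cong by auto
next
  case (Suc k)
  have "C_k_on k S (dir_deriv v f) = C_k_on k S (dir_deriv v g)" for v
    using dir_deriv_cong_open[OF assms(1) _ Suc.prems] by (intro Suc.IH) auto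
  then show ?case using differentiable_cong_open[OF assms(1) _ Suc.prems] by auto
qed

lemma C_k_on_subset: "C_k_on k S f \<Longrightarrow> T \<subseteq> S \<Longrightarrow> C_k_on k T f"
  by (induction k arbitrary: f) (auto intro: continuous_on_subset)

lemma C_k_on_local:
  assumes "\<And>z. z \<in> S \<Longrightarrow> \<exists>U. open U \<and> z \<in> U \<and> C_k_on k U f"
  shows "C_k_on k S f"
  using assms
proof (induction k arbitrary: f)
  case 0
  have "continuous (at z) f" if "z \<in> S" for z
    using 0[OF that] continuous_on_eq_continuous_at by auto
  then show ?case by (simp add: continuous_at_imp_continuous_on)
next
  case (Suc k)
  have "C_k_on k S (dir_deriv v f)" if "v = 1 \<or> v = \<i>" for v
  proof (rule Suc.IH)
    fix z assume "z \<in> S"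
    then obtain U where "open U" "z \<in> U" "C_k_on (Suc k) U f" using Suc.prems by blast
    then show "\<exists>U. open U \<and> z \<in> U \<and> C_k_on k U (dir_deriv v f)" using that by auto
  qed
  moreover have "f differentiable (at z)" if "z \<in> S" for z
  proof -
    obtain U where "open U" "z \<in> U" "C_k_on (Suc k) U f" using Suc.prems[OF \<open>z \<in> S\<close>] by blast
    then show ?thesis by simp
  qed
  ultimately show ?case by simp
qed

lemma C_k_on_Suc_imp: "C_k_on (Suc k) S f \<Longrightarrow> C_k_on k S f"
proof (induction k arbitrary: f)
  case 0
  then show ?case
    by (auto intro!: continuous_at_imp_continuous_on differentiable_imp_continuous_within)
next
  case (Suc k)
  from Suc.prems have "\<forall>z\<in>S. f differentiable (at z)"
    "C_k_on (Suc k) S (dir_deriv 1 f)" "C_k_on (Suc k) S (dir_deriv \<i> f)"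
    unfolding C_k_on.simps(2)[of "Suc k"] by blast+
  with Suc.IH have "\<forall>z\<in>S. f differentiable (at z)"
    "C_k_on k S (dir_deriv 1 f)" "C_k_on k S (dir_deriv \<i> f)" by blast+
  then show ?case by simp
qed

lemma C_k_on_const: "C_k_on k S (\<lambda>z. c)"
proof (induction k arbitrary: c)
  case (Suc k)
  have "dir_deriv v (\<lambda>z. c) = (\<lambda>z. 0)" for v
    by (rule ext, rule dir_deriv_eq) auto
  then show ?case using Suc by simp
qed simp

lemma C_k_on_add:
  assumes "open S" "C_k_on k S f" "C_k_on k S g"
  shows "C_k_on k S (\<lambda>z. f z + g z)"
  using assms(2,3)
proof (induction k arbitrary: f g)
  case 0
  then show ?case by (auto intro: continuous_intros)
next
  case (Suc k)
  have "dir_deriv v (\<lambda>z. f z + g z) z = dir_deriv v f z + dir_deriv v g z" if "z \<in> S" for v z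
    using Suc.prems that by (intro dir_deriv_eq derivative_intros dir_deriv_has_derivative) auto
  then have "C_k_on k S (dir_deriv v (\<lambda>z. f z + g z))
      = C_k_on k S (\<lambda>z. dir_deriv v f z + dir_deriv v g z)" for v
    by (intro C_k_on_cong[OF assms(1)])
  then show ?case using Suc by (auto intro: differentiable_add)
qed

lemma C_k_on_linear:
  assumes "open S" "bounded_linear L" "C_k_on k S f"
  shows "C_k_on k S (\<lambda>z. L (f z))"
  using assms(3)
proof (induction k arbitrary: f)
  case 0
  then show ?case by (auto intro: bounded_linear.continuous_on[OF assms(2)])
next
  case (Suc k)
  have *: "((\<lambda>z. L (f z)) has_derivative (\<lambda>v. L (dir_deriv v f z))) (at z)" if "z \<in> S" for z
    using Suc.prems that
    by (intro bounded_linear.has_derivative[OF assms(2)] dir_deriv_has_derivative) auto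
  then have "C_k_on k S (dir_deriv v (\<lambda>z. L (f z))) = C_k_on k S (\<lambda>z. L (dir_deriv v f z))" for v
    by (intro C_k_on_cong[OF assms(1)] dir_deriv_eq)
  then show ?case using Suc * by (auto simp: differentiable_def)
qed

lemma C_k_on_bilinear:
  assumes "open S" "bounded_bilinear pr" "C_k_on k S f" "C_k_on k S g"
  shows "C_k_on k S (\<lambda>z. pr (f z) (g z))"
  using assms(3,4)
proof (induction k arbitrary: f g)
  case 0
  then show ?case by (auto intro: bounded_bilinear.continuous_on[OF assms(2)])
next
  case (Suc k)
  have *: "((\<lambda>z. pr (f z) (g z)) has_derivative
      (\<lambda>v. pr (f z) (dir_deriv v g z) + pr (dir_deriv v f z) (g z))) (at z)" if "z \<in> S" for z
    using Suc.prems that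
    by (intro bounded_bilinear.FDERIV[OF assms(2)] dir_deriv_has_derivative) auto
  have f: "C_k_on k S f" and g: "C_k_on k S g"
    using Suc.prems C_k_on_Suc_imp by blast+
  have "C_k_on k S (dir_deriv v (\<lambda>z. pr (f z) (g z))) =
     C_k_on k S (\<lambda>z. pr (f z) (dir_deriv v g z) + pr (dir_deriv v f z) (g z))" for v
    by (intro C_k_on_cong[OF assms(1)] dir_deriv_eq *)
  moreover have "C_k_on k S (\<lambda>z. pr (f z) (dir_deriv v g z) + pr (dir_deriv v f z) (g z))"
    if "v = 1 \<or> v = \<i>" for v
    using Suc.prems f g that by (intro C_k_on_add[OF assms(1)] Suc.IH) auto
  ultimately show ?case using * by (auto simp: differentiable_def)
qed

lemma has_derivative_compose_plane:
  fixes g :: "complex \<Rightarrow> complex"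
  assumes "f differentiable (at (g z))" "(g has_derivative D) (at z)"
  shows "((\<lambda>z. f (g z)) has_derivative
     (\<lambda>v. Re (D v) *\<^sub>R dir_deriv 1 f (g z) + Im (D v) *\<^sub>R dir_deriv \<i> f (g z))) (at z)"
proof -
  have "((\<lambda>z. f (g z)) has_derivative (\<lambda>v. dir_deriv (D v) f (g z))) (at z)"
    using has_derivative_compose[OF assms(2) dir_deriv_has_derivative[OF assms(1)]] by simp
  moreover have "(\<lambda>v. dir_deriv (D v) f (g z))
     = (\<lambda>v. Re (D v) *\<^sub>R dir_deriv 1 f (g z) + Im (D v) *\<^sub>R dir_deriv \<i> f (g z))"
    by (rule ext) (rule dir_deriv_linear[OF assms(1)])
  ultimately show ?thesis by simp
qed

lemma C_k_on_compose:
  fixes g :: "complex \<Rightarrow> complex"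
  assumes "open S" "C_k_on k T f" "C_k_on k S g" "g ` S \<subseteq> T"
  shows "C_k_on k S (\<lambda>z. f (g z))"
  using assms(2,3)
proof (induction k arbitrary: f)
  case 0
  then show ?case using assms(4) by (auto intro: continuous_on_compose2)
next
  case (Suc k)
  have *: "((\<lambda>z. f (g z)) has_derivative (\<lambda>v. Re (dir_deriv v g z) *\<^sub>R dir_deriv 1 f (g z)
       + Im (dir_deriv v g z) *\<^sub>R dir_deriv \<i> f (g z))) (at z)" if "z \<in> S" for z
    using Suc.prems that assms(4)
    by (intro has_derivative_compose_plane dir_deriv_has_derivative) auto
  have g: "C_k_on k S g" using Suc.prems C_k_on_Suc_imp by blast
  have "C_k_on k S (dir_deriv v (\<lambda>z. f (g z))) =
     C_k_on k S (\<lambda>z. Re (dir_deriv v g z) *\<^sub>R dir_deriv 1 f (g z)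
       + Im (dir_deriv v g z) *\<^sub>R dir_deriv \<i> f (g z))" for v
    by (intro C_k_on_cong[OF assms(1)] dir_deriv_eq *)
  moreover have "C_k_on k S (\<lambda>z. Re (dir_deriv v g z) *\<^sub>R dir_deriv 1 f (g z)
       + Im (dir_deriv v g z) *\<^sub>R dir_deriv \<i> f (g z))" if "v = 1 \<or> v = \<i>" for v
    using Suc.prems g that
    by (intro C_k_on_add[OF assms(1)] C_k_on_bilinear[OF assms(1) bounded_bilinear_scaleR] Suc.IH
        C_k_on_linear[OF assms(1) bounded_linear_Re] C_k_on_linear[OF assms(1) bounded_linear_Im]) auto
  ultimately show ?case using * by (auto simp: differentiable_def)
qed

text \<open>The hypothesis on \<open>F\<close> is a coinductive form of smoothness: membership in a class closed
  under differentiation. It spares computing higher derivatives.\<close>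

lemma C_k_on_compose_real:
  fixes g :: "complex \<Rightarrow> real"
  assumes "open S" "C_k_on k S g" "g ` S \<subseteq> J" "F \<in> \<Phi>"
    and \<Phi>: "\<And>F. F \<in> \<Phi> \<Longrightarrow> \<exists>F'\<in>\<Phi>. \<forall>x\<in>J. (F has_real_derivative F' x) (at x)"
  shows "C_k_on k S (\<lambda>z. F (g z))"
  using assms(2,4)
proof (induction k arbitrary: F)
  case 0
  then have "continuous_on J F"
    using \<Phi> by (meson DERIV_isCont continuous_at_imp_continuous_on)
  then show ?case using 0 assms(3) by (auto intro: continuous_on_compose2)
next
  case (Suc k)
  obtain F' where F': "F' \<in> \<Phi>" "\<And>x. x \<in> J \<Longrightarrow> (F has_real_derivative F' x) (at x)"
    using \<Phi>[OF Suc.prems(2)] by blast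
  have *: "((\<lambda>z. F (g z)) has_derivative (\<lambda>v. F' (g z) * dir_deriv v g z)) (at z)" if "z \<in> S" for z
    using Suc.prems that assms(3) F'(2)
    by (intro has_derivative_compose[OF dir_deriv_has_derivative, of g z F, simplified])
       (auto simp: has_field_derivative_def)
  have g: "C_k_on k S g" using Suc.prems C_k_on_Suc_imp by blast
  have "C_k_on k S (dir_deriv v (\<lambda>z. F (g z))) = C_k_on k S (\<lambda>z. F' (g z) * dir_deriv v g z)" for v
    by (intro C_k_on_cong[OF assms(1)] dir_deriv_eq *)
  moreover have "C_k_on k S (\<lambda>z. F' (g z) * dir_deriv v g z)" if "v = 1 \<or> v = \<i>" for v
    using Suc g that F'(1) by (intro C_k_on_bilinear[OF assms(1) bounded_bilinear_mult]) auto
  ultimately show ?case using * by (auto simp: differentiable_def)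
qed

lemma C_k_on_holomorphic:
  assumes "open S" "f holomorphic_on S"
  shows "C_k_on k S f"
  using assms(2)
proof (induction k arbitrary: f)
  case 0
  then show ?case by (simp add: holomorphic_on_imp_continuous_on)
next
  case (Suc k)
  have *: "(f has_derivative (\<lambda>v. deriv f z * v)) (at z)" if "z \<in> S" for z
    using holomorphic_derivI[OF Suc.prems assms(1) that]
    by (simp add: has_field_derivative_def)
  have "C_k_on k S (dir_deriv v f) = C_k_on k S (\<lambda>z. deriv f z * v)" for v
    by (intro C_k_on_cong[OF assms(1)] dir_deriv_eq *)
  moreover have "C_k_on k S (\<lambda>z. deriv f z * v)" for v
    by (intro Suc.IH holomorphic_intros Suc.prems assms)
  ultimately show ?case using * by (auto simp: differentiable_def)
qed

lemma C_infinity_on_cong: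
  assumes "open S" "\<And>w. w \<in> S \<Longrightarrow> f w = g w"
  shows "C_infinity_on S f \<longleftrightarrow> C_infinity_on S g"
  using C_k_on_cong[OF assms] by (simp add: C_infinity_on_def)

lemma C_infinity_on_subset: "C_infinity_on S f \<Longrightarrow> T \<subseteq> S \<Longrightarrow> C_infinity_on T f"
  unfolding C_infinity_on_def using C_k_on_subset by blast

lemma C_infinity_on_local:
  assumes "\<And>z. z \<in> S \<Longrightarrow> \<exists>U. open U \<and> z \<in> U \<and> C_infinity_on U f"
  shows "C_infinity_on S f"
  unfolding C_infinity_on_def
proof
  fix k show "C_k_on k S f"
    by (rule C_k_on_local) (use assms in \<open>unfold C_infinity_on_def, blast\<close>)
qed

lemma C_infinity_on_const: "C_infinity_on S (\<lambda>z. c)"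
  by (simp add: C_infinity_on_def C_k_on_const)

lemma C_infinity_on_add:
  "open S \<Longrightarrow> C_infinity_on S f \<Longrightarrow> C_infinity_on S g \<Longrightarrow> C_infinity_on S (\<lambda>z. f z + g z)"
  by (simp add: C_infinity_on_def C_k_on_add)

lemma C_infinity_on_mult:
  fixes f g :: "complex \<Rightarrow> 'b::real_normed_algebra"
  shows "open S \<Longrightarrow> C_infinity_on S f \<Longrightarrow> C_infinity_on S g \<Longrightarrow> C_infinity_on S (\<lambda>z. f z * g z)"
  by (simp add: C_infinity_on_def C_k_on_bilinear[OF _ bounded_bilinear_mult])

lemma C_infinity_on_linear:
  "open S \<Longrightarrow> bounded_linear L \<Longrightarrow> C_infinity_on S f \<Longrightarrow> C_infinity_on S (\<lambda>z. L (f z))"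
  by (simp add: C_infinity_on_def C_k_on_linear)

lemma C_infinity_on_diff:
  "open S \<Longrightarrow> C_infinity_on S f \<Longrightarrow> C_infinity_on S g \<Longrightarrow> C_infinity_on S (\<lambda>z. f z - g z)"
  using C_infinity_on_add[of S f "\<lambda>z. - g z"] C_infinity_on_linear[of S uminus g]
  by (simp add: bounded_linear_minus[OF bounded_linear_ident])

lemma C_infinity_on_compose:
  fixes g :: "complex \<Rightarrow> complex"
  shows "open S \<Longrightarrow> C_infinity_on T f \<Longrightarrow> C_infinity_on S g \<Longrightarrow> g ` S \<subseteq> T
    \<Longrightarrow> C_infinity_on S (\<lambda>z. f (g z))"
  by (auto simp: C_infinity_on_def intro: C_k_on_compose)

lemma C_infinity_on_holomorphic: "open S \<Longrightarrow> f holomorphic_on S \<Longrightarrow> C_infinity_on S f"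
  by (simp add: C_infinity_on_def C_k_on_holomorphic)

lemma C_infinity_on_compose_real:
  fixes g :: "complex \<Rightarrow> real"
  assumes "open S" "C_infinity_on S g" "g ` S \<subseteq> J" "F \<in> \<Phi>"
    and "\<And>F. F \<in> \<Phi> \<Longrightarrow> \<exists>F'\<in>\<Phi>. \<forall>x\<in>J. (F has_real_derivative F' x) (at x)"
  shows "C_infinity_on S (\<lambda>z. F (g z))"
  unfolding C_infinity_on_def
proof
  fix k show "C_k_on k S (\<lambda>z. F (g z))"
    by (rule C_k_on_compose_real[of S k g J F \<Phi>]) (use assms in \<open>auto simp: C_infinity_on_def\<close>)
qed

lemma C_infinity_on_exp:
  fixes g :: "complex \<Rightarrow> real"
  assumes "open S" "C_infinity_on S g"
  shows "C_infinity_on S (\<lambda>z. exp (g z))"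
  by (rule C_infinity_on_compose_real[of S g UNIV exp "{exp}"])
     (use assms in \<open>auto intro: DERIV_exp\<close>)

lemma DERIV_inverse_power:
  assumes "x \<noteq> (0::real)"
  shows "((\<lambda>x. c * inverse x ^ n) has_real_derivative (- c * n) * inverse x ^ Suc n) (at x)"
proof (cases n)
  case (Suc m)
  show ?thesis
    using DERIV_cmult[OF DERIV_power[OF DERIV_inverse[OF assms]], of c n]
    by (simp add: Suc algebra_simps)
qed simp

lemma C_infinity_on_inverse:
  fixes g :: "complex \<Rightarrow> real"
  assumes "open S" "C_infinity_on S g" "\<And>z. z \<in> S \<Longrightarrow> g z \<noteq> 0"
  shows "C_infinity_on S (\<lambda>z. inverse (g z))"
proof (rule C_infinity_on_compose_real[of S g "-{0}" inverse "range (\<lambda>(c,n) x. c * inverse x ^ n)"])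
  show "inverse \<in> range (\<lambda>(c,n) (x::real). c * inverse x ^ n)"
    by (rule image_eqI[where x = "(1, 1)"]) auto
  fix F :: "real \<Rightarrow> real" assume "F \<in> range (\<lambda>(c,n) x. c * inverse x ^ n)"
  then obtain c n where F: "F = (\<lambda>x. c * inverse x ^ n)" by auto
  show "\<exists>F'\<in>range (\<lambda>(c,n) x. c * inverse x ^ n). \<forall>x\<in>-{0}. (F has_real_derivative F' x) (at x)"
    unfolding F
  proof (rule bexI)
    show "\<forall>x\<in>-{0}. ((\<lambda>x. c * inverse x ^ n) has_real_derivative (- c * n) * inverse x ^ Suc n) (at x)"
      using DERIV_inverse_power by blast
    show "(\<lambda>x. (- c * n) * inverse x ^ Suc n) \<in> range (\<lambda>(c,n) x. c * inverse x ^ n)"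
      by (rule image_eqI[where x = "(- c * n, Suc n)"]) auto
  qed
qed (use assms in auto)

lemma C_infinity_on_ln:
  fixes g :: "complex \<Rightarrow> real"
  assumes "open S" "C_infinity_on S g" "\<And>z. z \<in> S \<Longrightarrow> g z > 0"
  shows "C_infinity_on S (\<lambda>z. ln (g z))"
proof (rule C_infinity_on_compose_real[of S g "{0<..}" ln
      "insert ln (range (\<lambda>(c,n) x. c * inverse x ^ n))"])
  fix F :: "real \<Rightarrow> real" assume "F \<in> insert ln (range (\<lambda>(c,n) x. c * inverse x ^ n))"
  then consider "F = ln" | c n where "F = (\<lambda>x. c * inverse x ^ n)" by auto
  then show "\<exists>F'\<in>insert ln (range (\<lambda>(c,n) x. c * inverse x ^ n)).
      \<forall>x\<in>{0<..}. (F has_real_derivative F' x) (at x)"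
  proof cases
    case 1
    have "(\<lambda>x::real. 1 * inverse x ^ 1) \<in> range (\<lambda>(c,n) x. c * inverse x ^ n)"
      by (rule image_eqI[where x = "(1, 1)"]) auto
    moreover have "\<forall>x\<in>{0<..}. (ln has_real_derivative 1 * inverse x ^ 1) (at x)"
      by (auto intro!: derivative_eq_intros simp: divide_inverse)
    ultimately show ?thesis unfolding 1 by (intro bexI[rotated, OF insertI2])
  next
    case (2 c n)
    show ?thesis
      unfolding 2
    proof (rule bexI)
      show "\<forall>x\<in>{0<..}. ((\<lambda>x. c * inverse x ^ n) has_real_derivative (- c * n) * inverse x ^ Suc n) (at x)"
        by (intro ballI DERIV_inverse_power) auto
      have "(\<lambda>x. (- c * n) * inverse x ^ Suc n) \<in> range (\<lambda>(c,n) x. c * inverse x ^ n)"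
        by (rule image_eqI[where x = "(- c * n, Suc n)"]) auto
      then show "(\<lambda>x. (- c * n) * inverse x ^ Suc n) \<in> insert ln (range (\<lambda>(c,n) x. c * inverse x ^ n))"
        by blast
    qed
  qed
qed (use assms in auto)

lemma has_derivative_ln_cmod:
  assumes "(f has_field_derivative f') (at z)" "f z \<noteq> 0"
  shows "((\<lambda>z. ln (cmod (f z))) has_derivative (\<lambda>v. Re (f' / f z * v))) (at z)"
proof -
  have f: "(f has_derivative (\<lambda>v. f' * v)) (at z)"
    using assms(1) by (simp add: has_field_derivative_def)
  have "((\<lambda>z. cmod (f z)) has_derivative (\<lambda>v. inner (f' * v) (sgn (f z)))) (at z)"
    using has_derivative_compose[OF f has_derivative_norm[OF assms(2)]] .
  then have "((\<lambda>z. ln (cmod (f z))) has_derivative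
     (\<lambda>v. inner (f' * v) (sgn (f z)) * inverse (cmod (f z)))) (at z)"
    using assms(2) by (auto intro!: derivative_eq_intros simp: fun_eq_iff divide_inverse)
  moreover have "inner u (sgn w) * inverse (cmod w) = Re (u / w)" if "w \<noteq> 0" for u w :: complex
  proof -
    have "u / w = u * cnj w / (cmod w)\<^sup>2"
      using that by (simp add: complex_norm_square divide_simps del: of_real_power)
    also have "Re (u * cnj w / (cmod w)\<^sup>2) = Re (u * cnj w) / (cmod w)\<^sup>2"
      by (metis Re_divide_of_real of_real_power)
    finally have "Re (u / w) = Re (u * cnj w) / (cmod w)\<^sup>2" .
    then show ?thesis using that
      by (simp add: sgn_div_norm inner_complex_def power2_eq_square divide_simps algebra_simps)
  qed
  ultimately show ?thesis using assms(2) by simp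
qed

lemma dir_deriv_ln_cmod:
  assumes "open S" "f holomorphic_on S" "z \<in> S" "f z \<noteq> 0"
  shows "dir_deriv v (\<lambda>z. ln (cmod (f z))) z = Re (deriv f z / f z * v)"
  using has_derivative_ln_cmod[OF holomorphic_derivI[OF assms(2,1,3)] assms(4)] by (rule dir_deriv_eq)

lemma C_infinity_on_ln_cmod:
  assumes "open S" "f holomorphic_on S" "\<And>z. z \<in> S \<Longrightarrow> f z \<noteq> 0"
  shows "C_infinity_on S (\<lambda>z. ln (cmod (f z)))"
  unfolding C_infinity_on_def
proof
  have *: "((\<lambda>z. ln (cmod (f z))) has_derivative (\<lambda>v. Re (deriv f z / f z * v))) (at z)"
    if "z \<in> S" for z
    using has_derivative_ln_cmod[OF holomorphic_derivI[OF assms(2,1)]] that assms(3) by auto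
  fix k
  show "C_k_on k S (\<lambda>z. ln (cmod (f z)))"
  proof (cases k)
    case 0
    have "continuous_on S (\<lambda>z. ln (cmod (f z)))"
      using * by (intro continuous_at_imp_continuous_on) (blast intro: has_derivative_continuous)
    then show ?thesis using 0 by simp
  next
    case (Suc m)
    have "C_k_on m S (dir_deriv v (\<lambda>z. ln (cmod (f z)))) = C_k_on m S (\<lambda>z. Re (deriv f z / f z * v))" for v
      by (intro C_k_on_cong[OF assms(1)] dir_deriv_eq *)
    moreover have "C_k_on m S (\<lambda>z. Re (deriv f z / f z * v))" for v
      by (intro C_k_on_linear[OF _ bounded_linear_Re] C_k_on_holomorphic holomorphic_intros assms)
    ultimately show ?thesis using * by (auto simp: differentiable_def Suc)
  qed
qed

lemma C_infinity_on_cmod: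
  assumes "open S" "f holomorphic_on S" "\<And>z. z \<in> S \<Longrightarrow> f z \<noteq> 0"
  shows "C_infinity_on S (\<lambda>z. cmod (f z))"
proof -
  have "C_infinity_on S (\<lambda>z. exp (ln (cmod (f z))))"
    by (intro C_infinity_on_exp C_infinity_on_ln_cmod assms)
  moreover have "C_infinity_on S (\<lambda>z. exp (ln (cmod (f z)))) = C_infinity_on S (\<lambda>z. cmod (f z))"
    using assms(3) by (intro C_infinity_on_cong[OF assms(1)]) simp
  ultimately show ?thesis by simp
qed

section \<open>The Laplacian\<close>

lemma C_2_differentiable:
  assumes "C_k_on 2 S u" "z \<in> S"
  shows "u differentiable (at z)" "v = 1 \<or> v = \<i> \<Longrightarrow> dir_deriv v u differentiable (at z)"
  using assms by (auto simp: numeral_2_eq_2)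

lemma C_infinity_on_C_2: "C_infinity_on S u \<Longrightarrow> C_k_on 2 S u"
  by (simp add: C_infinity_on_def)

lemma dir_deriv_dir_deriv:
  assumes "open S" "C_k_on 2 S u" "z \<in> S" 
  shows "(dir_deriv v u) differentiable (at z)"
    and "dir_deriv t (dir_deriv v u) z
     = Re v * Re t * dir_deriv 1 (dir_deriv 1 u) z + Re v * Im t * dir_deriv \<i> (dir_deriv 1 u) z
     + Im v * Re t * dir_deriv 1 (dir_deriv \<i> u) z + Im v * Im t * dir_deriv \<i> (dir_deriv \<i> (u::_\<Rightarrow>real)) z"
proof -
  have d: "dir_deriv 1 u differentiable (at z)" "dir_deriv \<i> u differentiable (at z)"
    using C_2_differentiable[OF assms(2,3)] by auto
  have "((\<lambda>z. Re v * dir_deriv 1 u z + Im v * dir_deriv \<i> u z) has_derivative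
     (\<lambda>t. Re v * dir_deriv t (dir_deriv 1 u) z + Im v * dir_deriv t (dir_deriv \<i> u) z)) (at z)"
    using d by (auto intro!: derivative_eq_intros dir_deriv_has_derivative)
  then have D: "(dir_deriv v u has_derivative
     (\<lambda>t. Re v * dir_deriv t (dir_deriv 1 u) z + Im v * dir_deriv t (dir_deriv \<i> u) z)) (at z)"
    by (rule has_derivative_transform_within_open[OF _ assms(1,3)])
       (simp add: dir_deriv_linear[OF C_2_differentiable(1)[OF assms(2)], of _ v])
  then show "(dir_deriv v u) differentiable (at z)" by (auto simp: differentiable_def)
  show "dir_deriv t (dir_deriv v u) z
     = Re v * Re t * dir_deriv 1 (dir_deriv 1 u) z + Re v * Im t * dir_deriv \<i> (dir_deriv 1 u) z
     + Im v * Re t * dir_deriv 1 (dir_deriv \<i> u) z + Im v * Im t * dir_deriv \<i> (dir_deriv \<i> u) z"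
    unfolding dir_deriv_eq[OF D] dir_deriv_linear[OF d(1), of t] dir_deriv_linear[OF d(2), of t]
    by (simp add: algebra_simps)
qed

lemma dir_deriv_compose_holomorphic:
  assumes "open S" "h holomorphic_on S" "C_k_on 2 T u" "h ` S \<subseteq> T" "open T" "z \<in> S"
  shows "dir_deriv v (\<lambda>z. u (h z)) z = dir_deriv (deriv h z * v) u (h z)"
  using has_derivative_compose[OF _ dir_deriv_has_derivative, of h "\<lambda>v. deriv h z * v" z UNIV u]
    holomorphic_derivI[OF assms(2,1,6)] C_2_differentiable(1)[OF assms(3), of "h z"] assms(4,6)
  by (intro dir_deriv_eq) (auto simp: has_field_derivative_def)

lemma dir_deriv2_compose_holomorphic:
  assumes "open S" "h holomorphic_on S" "C_k_on 2 T u" "h ` S \<subseteq> T" "open T" "z \<in> S"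
  shows "dir_deriv v (dir_deriv v (\<lambda>z. u (h z))) z
    = dir_deriv (deriv (deriv h) z * v\<^sup>2) u (h z)
    + dir_deriv (deriv h z * v) (dir_deriv (deriv h z * v) (u::_\<Rightarrow>real)) (h z)"
proof -
  have hz: "h z \<in> T" using assms by auto
  have u: "u differentiable (at (h z))" using C_2_differentiable(1)[OF assms(3) hz] .
  have d: "dir_deriv 1 u differentiable (at (h z))" "dir_deriv \<i> u differentiable (at (h z))"
    using C_2_differentiable[OF assms(3) hz] by auto
  have h: "(h has_derivative (\<lambda>v. deriv h z * v)) (at z)"
    using holomorphic_derivI[OF assms(2,1,6)] by (simp add: has_field_derivative_def)
  have h': "(deriv h has_derivative (\<lambda>v. deriv (deriv h) z * v)) (at z)"
    using holomorphic_derivI[OF holomorphic_deriv[OF assms(2,1)] assms(1,6)]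
    by (simp add: has_field_derivative_def)
  have c: "((\<lambda>z. f (h z)) has_derivative (\<lambda>t. dir_deriv (deriv h z * t) f (h z))) (at z)"
    if "f differentiable (at (h z))" for f :: "complex \<Rightarrow> real"
    using has_derivative_compose[OF h dir_deriv_has_derivative[OF that]] .
  have "((\<lambda>z. Re (deriv h z * v) * dir_deriv 1 u (h z) + Im (deriv h z * v) * dir_deriv \<i> u (h z))
     has_derivative (\<lambda>t. Re (deriv h z * v) * dir_deriv (deriv h z * t) (dir_deriv 1 u) (h z)
       + Re (deriv (deriv h) z * t * v) * dir_deriv 1 u (h z)
       + (Im (deriv h z * v) * dir_deriv (deriv h z * t) (dir_deriv \<i> u) (h z)
       + Im (deriv (deriv h) z * t * v) * dir_deriv \<i> u (h z)))) (at z)"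
    by (intro has_derivative_add has_derivative_mult has_derivative_Re has_derivative_Im
        has_derivative_mult_left h' c d)
  then have "(dir_deriv v (\<lambda>z. u (h z))
     has_derivative (\<lambda>t. Re (deriv h z * v) * dir_deriv (deriv h z * t) (dir_deriv 1 u) (h z)
       + Re (deriv (deriv h) z * t * v) * dir_deriv 1 u (h z)
       + (Im (deriv h z * v) * dir_deriv (deriv h z * t) (dir_deriv \<i> u) (h z)
       + Im (deriv (deriv h) z * t * v) * dir_deriv \<i> u (h z)))) (at z)"
  proof (rule has_derivative_transform_within_open[OF _ assms(1,6)])
    fix x assume x: "x \<in> S"
    then have "u differentiable (at (h x))" using C_2_differentiable(1)[OF assms(3)] assms(4) by auto
    then show "Re (deriv h x * v) * dir_deriv 1 u (h x) + Im (deriv h x * v) * dir_deriv \<i> u (h x)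
        = dir_deriv v (\<lambda>z. u (h z)) x"
      using dir_deriv_compose_holomorphic[OF assms(1-5) x] dir_deriv_linear[of u "h x" "deriv h x * v"]
      by simp
  qed
  then have "dir_deriv v (dir_deriv v (\<lambda>z. u (h z))) z
     = Re (deriv h z * v) * dir_deriv (deriv h z * v) (dir_deriv 1 u) (h z)
       + Re (deriv (deriv h) z * v * v) * dir_deriv 1 u (h z)
       + (Im (deriv h z * v) * dir_deriv (deriv h z * v) (dir_deriv \<i> u) (h z)
       + Im (deriv (deriv h) z * v * v) * dir_deriv \<i> u (h z))"
    by (rule dir_deriv_eq)
  then show ?thesis
    unfolding dir_deriv_dir_deriv(2)[OF assms(5,3) hz, of "deriv h z * v" "deriv h z * v"]
      dir_deriv_linear[OF u, of "deriv (deriv h) z * v\<^sup>2"]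
      dir_deriv_linear[OF d(1), of "deriv h z * v"] dir_deriv_linear[OF d(2), of "deriv h z * v"]
    by (simp add: power2_eq_square algebra_simps)
qed

text \<open>The terms with the second derivative of \<open>h\<close> in the directions \<open>1\<close> and \<open>\<i>\<close> cancel. This is why
  curvature is independent of the chart.\<close>

lemma laplacian_compose_holomorphic:
  assumes "open S" "h holomorphic_on S" "C_k_on 2 T u" "h ` S \<subseteq> T" "open T" "z \<in> S"
  shows "laplacian (\<lambda>z. u (h z)) z = (cmod (deriv h z))\<^sup>2 * laplacian u (h z)"
proof -
  have hz: "h z \<in> T" using assms by auto
  have u: "u differentiable (at (h z))" using C_2_differentiable(1)[OF assms(3) hz] .
  show ?thesis
    unfolding laplacian_def dir_deriv2_compose_holomorphic[OF assms]
      dir_deriv_dir_deriv(2)[OF assms(5,3) hz, of "deriv h z * _"]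
      dir_deriv_linear[OF u, of "deriv (deriv h) z * _"] cmod_power2
    by (simp add: power2_eq_square algebra_simps)
qed

lemma laplacian_cong_open:
  assumes "open S" "z \<in> S" "\<And>w. w \<in> S \<Longrightarrow> f w = g w"
  shows "laplacian f z = laplacian g z"
proof -
  have "dir_deriv v (dir_deriv v f) z = dir_deriv v (dir_deriv v g) z" for v
    by (intro dir_deriv_cong_open[OF assms(1,2)] dir_deriv_cong_open[OF assms(1) _ assms(3)])
  then show ?thesis by (simp add: laplacian_def)
qed

lemma laplacian_add:
  assumes "open S" "C_k_on 2 S f" "C_k_on 2 S g" "z \<in> S"
  shows "laplacian (\<lambda>z. f z + g z) z = laplacian f z + laplacian g z"
proof -
  have "dir_deriv v (dir_deriv v (\<lambda>z. f z + g z)) z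
      = dir_deriv v (dir_deriv v f) z + dir_deriv v (dir_deriv v g) z" if "v = 1 \<or> v = \<i>" for v
  proof -
    have 1: "dir_deriv v (\<lambda>z. f z + g z) z = dir_deriv v f z + dir_deriv v g z" if "z \<in> S" for z
      using that C_2_differentiable(1)[OF assms(2)] C_2_differentiable(1)[OF assms(3)]
      by (intro dir_deriv_eq derivative_intros dir_deriv_has_derivative) auto
    have "dir_deriv v (dir_deriv v (\<lambda>z. f z + g z)) z
        = dir_deriv v (\<lambda>z. dir_deriv v f z + dir_deriv v g z) z"
      by (intro dir_deriv_cong_open[OF assms(1,4)] 1)
    also have "\<dots> = dir_deriv v (dir_deriv v f) z + dir_deriv v (dir_deriv v g) z"
      using C_2_differentiable(2)[OF assms(2,4) that] C_2_differentiable(2)[OF assms(3,4) that]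
      by (intro dir_deriv_eq derivative_intros dir_deriv_has_derivative) auto
    finally show ?thesis .
  qed
  then show ?thesis by (simp add: laplacian_def)
qed

lemma laplacian_cmult:
  assumes "open S" "C_k_on 2 S f" "z \<in> S"
  shows "laplacian (\<lambda>z. c * f z) z = c * laplacian f z"
proof -
  have "dir_deriv v (dir_deriv v (\<lambda>z. c * f z)) z = c * dir_deriv v (dir_deriv v f) z"
    if "v = 1 \<or> v = \<i>" for v
  proof -
    have 1: "dir_deriv v (\<lambda>z. c * f z) z = c * dir_deriv v f z" if "z \<in> S" for z
      using that C_2_differentiable(1)[OF assms(2)]
      by (intro dir_deriv_eq has_derivative_mult_right dir_deriv_has_derivative) auto
    have "dir_deriv v (dir_deriv v (\<lambda>z. c * f z)) z = dir_deriv v (\<lambda>z. c * dir_deriv v f z) z"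
      by (intro dir_deriv_cong_open[OF assms(1,3)] 1)
    also have "\<dots> = c * dir_deriv v (dir_deriv v f) z"
      using C_2_differentiable(2)[OF assms(2,3) that]
      by (intro dir_deriv_eq has_derivative_mult_right dir_deriv_has_derivative) auto
    finally show ?thesis .
  qed
  then show ?thesis by (simp add: laplacian_def algebra_simps)
qed

text \<open>The factor by which a holomorphic change of coordinates rescales a metric is harmonic after taking
  logarithms, so that it does not contribute to the curvature.\<close>

lemma laplacian_ln_cmod:
  assumes "open S" "f holomorphic_on S" "\<And>z. z \<in> S \<Longrightarrow> f z \<noteq> 0" "z \<in> S"
  shows "laplacian (\<lambda>z. ln (cmod (f z))) z = 0"
proof -
  define F where "F = (\<lambda>z. deriv f z / f z)"
  have F: "F holomorphic_on S" unfolding F_def by (intro holomorphic_intros assms)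
  have "dir_deriv v (dir_deriv v (\<lambda>z. ln (cmod (f z)))) z = Re (deriv F z * v * v)" for v
  proof -
    have "dir_deriv v (dir_deriv v (\<lambda>z. ln (cmod (f z)))) z = dir_deriv v (\<lambda>z. Re (F z * v)) z"
      unfolding F_def
      by (intro dir_deriv_cong_open[OF assms(1,4)] dir_deriv_ln_cmod[OF assms(1,2)] assms)
    also have "\<dots> = Re (deriv F z * v * v)"
      using holomorphic_derivI[OF F assms(1,4)]
      by (intro dir_deriv_eq has_derivative_Re has_derivative_mult_left)
         (simp add: has_field_derivative_def)
    finally show ?thesis .
  qed
  then show ?thesis by (simp add: laplacian_def)
qed

lemma DERIV_along_line:
  fixes u :: "complex \<Rightarrow> real"
  assumes "u differentiable (at (z + of_real s * v))"
  shows "((\<lambda>s. u (z + of_real s * v)) has_real_derivative dir_deriv v u (z + of_real s * v)) (at s)"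
proof -
  have 1: "((\<lambda>s. z + of_real s * v) has_derivative (\<lambda>t. of_real t * v)) (at s)"
    by (auto intro!: derivative_eq_intros)
  have "((\<lambda>s. u (z + of_real s * v)) has_derivative (\<lambda>t. dir_deriv (of_real t * v) u (z + of_real s * v))) (at s)"
    using has_derivative_compose[OF 1 dir_deriv_has_derivative[OF assms]] .
  moreover have "dir_deriv (of_real t * v) u (z + of_real s * v) = dir_deriv v u (z + of_real s * v) * t" for t
    unfolding dir_deriv_linear[OF assms, of "of_real t * v"] dir_deriv_linear[OF assms, of v]
    by (simp add: algebra_simps)
  ultimately show ?thesis by (simp add: has_field_derivative_def)
qed

lemma local_max_dir_deriv2_nonpos:
  fixes u :: "complex \<Rightarrow> real"
  assumes "open S" "C_k_on 2 S u" "z \<in> S" "\<And>w. w \<in> S \<Longrightarrow> u w \<le> u z" "v = 1 \<or> v = \<i>"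
  shows "dir_deriv v (dir_deriv v u) z \<le> 0"
proof (rule ccontr)
  assume neg: "\<not> ?thesis"
  obtain e where e: "e > 0" "ball z e \<subseteq> S" using assms openE by blast
  have inS: "z + of_real s * v \<in> S" if "\<bar>s\<bar> < e" for s
    using that e(2) assms(5) by (auto simp: subset_iff dist_norm norm_mult)
  define f f' where "f = (\<lambda>s. u (z + of_real s * v))" and "f' = (\<lambda>s. dir_deriv v u (z + of_real s * v))"
  have f: "(f has_real_derivative f' s) (at s)" if "\<bar>s\<bar> < e" for s
    unfolding f_def f'_def
    by (intro DERIV_along_line C_2_differentiable(1)[OF assms(2)] inS that)
  have f'': "(f' has_real_derivative dir_deriv v (dir_deriv v u) z) (at 0)"
    using DERIV_along_line[of "dir_deriv v u" z 0 v] C_2_differentiable(2)[OF assms(2,3,5)]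
    by (simp add: f'_def)
  have "f' 0 = 0"
  proof (rule DERIV_local_max[OF f e(1)])
    show "\<forall>y. \<bar>0 - y\<bar> < e \<longrightarrow> f y \<le> f 0" using inS assms(4) by (auto simp: f_def)
  qed (use e in auto)
  moreover obtain d where d: "d > 0" "\<And>h. h > 0 \<Longrightarrow> h < d \<Longrightarrow> f' 0 < f' (0 + h)"
    using DERIV_pos_inc_right[OF f''] neg by (auto simp: not_le)
  moreover define s where "s = min d e / 2"
  ultimately have s: "0 < s" "s < e" "\<And>h. 0 < h \<Longrightarrow> h \<le> s \<Longrightarrow> f' h > 0"
    using e(1) by auto
  obtain h where h: "0 < h" "h < s" "f s - f 0 = (s - 0) * f' h"
    using MVT2[of 0 s f f'] f s by (auto simp: abs_if)
  moreover have "s * f' h > 0" using s h by (intro mult_pos_pos) auto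
  ultimately have "f s > f 0" by simp
  moreover have "f s \<le> f 0" using inS[of s] s assms(4) by (auto simp: f_def)
  ultimately show False by simp
qed

lemma local_max_laplacian_nonpos:
  assumes "open S" "C_k_on 2 S u" "z \<in> S" "\<And>w. w \<in> S \<Longrightarrow> u w \<le> u z"
  shows "laplacian u z \<le> 0"
  using local_max_dir_deriv2_nonpos[OF assms, of 1] local_max_dir_deriv2_nonpos[OF assms, of \<i>]
  by (simp add: laplacian_def)

section \<open>Charts and maps in coordinates\<close>

lemma is_chartD:
  assumes "is_chart X c"
  shows "openin X (fst c)" "open (snd c ` fst c)" "inj_on (snd c) (fst c)" "fst c \<subseteq> topspace X"
    and "continuous_map (subtopology X (fst c)) euclidean (snd c)"
    and "\<And>U. openin X U \<Longrightarrow> U \<subseteq> fst c \<Longrightarrow> open (snd c ` U)"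
    and "\<And>W. open W \<Longrightarrow> openin X (fst c \<inter> snd c -` W)"
    and "\<And>x. x \<in> fst c \<Longrightarrow> inv_into (fst c) (snd c) (snd c x) = x"
proof -
  have o: "openin X (fst c)" and oi: "open (snd c ` fst c)"
    and h: "homeomorphic_map (subtopology X (fst c)) (top_of_set (snd c ` fst c)) (snd c)"
    using assms by (auto simp: is_chart_def)
  show "openin X (fst c)" "open (snd c ` fst c)" by fact+
  show sub: "fst c \<subseteq> topspace X" using o by (rule openin_subset)
  then have ts: "topspace (subtopology X (fst c)) = fst c" by auto
  show inj: "inj_on (snd c) (fst c)" using homeomorphic_imp_injective_map[OF h] ts by simp
  show c: "continuous_map (subtopology X (fst c)) euclidean (snd c)"
    using homeomorphic_imp_continuous_map[OF h] by (simp add: continuous_map_in_subtopology)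
  show "open (snd c ` U)" if "openin X U" "U \<subseteq> fst c" for U
  proof -
    have "openin (subtopology X (fst c)) U" using that by (auto simp: openin_subtopology)
    then have "openin (top_of_set (snd c ` fst c)) (snd c ` U)"
      using homeomorphic_imp_open_map[OF h] by (simp add: open_map_def)
    then show ?thesis using oi openin_open_trans by blast
  qed
  show "openin X (fst c \<inter> snd c -` W)" if "open W" for W
  proof -
    have "openin (subtopology X (fst c)) {x \<in> topspace (subtopology X (fst c)). snd c x \<in> W}"
      using openin_continuous_map_preimage[OF c, of W] that by simp
    then have "openin (subtopology X (fst c)) {x \<in> fst c. snd c x \<in> W}" unfolding ts .
    then have "openin X {x \<in> fst c. snd c x \<in> W}" using o by (rule openin_trans_full)
    then show ?thesis by (simp add: vimage_def Int_def)
  qed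
  show "inv_into (fst c) (snd c) (snd c x) = x" if "x \<in> fst c" for x
    using inj that by simp
qed

lemma in_coords_apply:
  assumes "is_chart X c" "x \<in> fst c"
  shows "in_coords f c d (snd c x) = snd d (f x)"
  using is_chartD(8)[OF assms] by (simp add: in_coords_def)

lemma open_in_coords_domain:
  assumes "is_chart X c" "continuous_map X Y f" "openin Y V"
  shows "open (snd c ` (fst c \<inter> f -` V))"
proof -
  have "openin X {x \<in> topspace X. f x \<in> V}"
    using openin_continuous_map_preimage[OF assms(2,3)] .
  then have "openin X (fst c \<inter> {x \<in> topspace X. f x \<in> V})"
    using is_chartD(1)[OF assms(1)] by (rule openin_Int[rotated])
  moreover have "fst c \<inter> {x \<in> topspace X. f x \<in> V} = fst c \<inter> f -` V"
    using is_chartD(4)[OF assms(1)] by auto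
  ultimately show ?thesis using is_chartD(6)[OF assms(1)] by (metis Int_lower1)
qed

lemma in_coords_chain:
  assumes c: "is_chart X c" and d: "is_chart Y d" and f: "continuous_map X Y f"
    and x: "x \<in> fst c" "f x \<in> fst d"
    and F: "in_coords f c d field_differentiable (at (snd c x))"
    and G: "in_coords g d e field_differentiable (at (snd d (f x)))"
  shows "in_coords (g \<circ> f) c e field_differentiable (at (snd c x))" (is ?A)
    and "deriv (in_coords (g \<circ> f) c e) (snd c x)
      = deriv (in_coords g d e) (snd d (f x)) * deriv (in_coords f c d) (snd c x)" (is ?B)
proof -
  let ?S = "snd c ` (fst c \<inter> f -` fst d)"
  have S: "open ?S" "snd c x \<in> ?S"
    using open_in_coords_domain[OF c f is_chartD(1)[OF d]] x by auto
  have Fx: "in_coords f c d (snd c x) = snd d (f x)" using in_coords_apply[OF c x(1)] .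
  have "((in_coords g d e \<circ> in_coords f c d) has_field_derivative
      deriv (in_coords g d e) (snd d (f x)) * deriv (in_coords f c d) (snd c x)) (at (snd c x))"
    using F G by (intro DERIV_chain) (auto simp: Fx field_differentiable_derivI)
  then have "(in_coords (g \<circ> f) c e has_field_derivative
      deriv (in_coords g d e) (snd d (f x)) * deriv (in_coords f c d) (snd c x)) (at (snd c x))"
  proof (rule has_field_derivative_transform_within_open[OF _ S])
    fix w assume "w \<in> ?S"
    then obtain y where "y \<in> fst c" "f y \<in> fst d" "w = snd c y" by auto
    then show "(in_coords g d e \<circ> in_coords f c d) w = in_coords (g \<circ> f) c e w"
      using is_chartD(8)[OF c, of y] is_chartD(8)[OF d, of "f y"] by (simp add: in_coords_def)
  qed
  then show ?A ?B by (auto simp: field_differentiable_def DERIV_imp_deriv)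
qed

lemma holomorphic_map_in_coords_differentiable:
  assumes "holomorphic_map A B f" "c \<in> A" "d \<in> B" "is_chart X c" "continuous_map X Y f"
    "is_chart Y d" "x \<in> fst c" "f x \<in> fst d"
  shows "in_coords f c d field_differentiable (at (snd c x))"
proof -
  have "in_coords f c d holomorphic_on snd c ` (fst c \<inter> f -` fst d)"
    using assms(1-3) by (auto simp: holomorphic_map_def)
  then show ?thesis
    using open_in_coords_domain[OF assms(4,5) is_chartD(1)[OF assms(6)]] assms(7,8)
      holomorphic_on_imp_differentiable_at by blast
qed

definition atlas :: "'a topology \<Rightarrow> 'a chart set \<Rightarrow> bool" where
  "atlas X A \<longleftrightarrow> (\<forall>c\<in>A. is_chart X c) \<and> (\<Union>c\<in>A. fst c) = topspace X \<and> holomorphic_map A A id"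

lemma riemann_surface_atlas: "riemann_surface X A \<Longrightarrow> atlas X A"
  by (simp add: riemann_surface_def atlas_def)

lemma atlasD: "atlas X A \<Longrightarrow> c \<in> A \<Longrightarrow> is_chart X c"
  by (simp add: atlas_def)

lemma atlas_chart_at:
  assumes "atlas X A" "x \<in> topspace X"
  obtains c where "c \<in> A" "x \<in> fst c" "is_chart X c"
  using assms unfolding atlas_def by blast

lemma holomorphic_map_compose:
  assumes X: "atlas X A" and Y: "atlas Y B" and Z: "atlas Z C"
    and f: "continuous_map X Y f" "holomorphic_map A B f"
    and g: "continuous_map Y Z g" "holomorphic_map B C g"
  shows "holomorphic_map A C (g \<circ> f)"
  unfolding holomorphic_map_def
proof (intro ballI)
  fix c e assume c: "c \<in> A" and e: "e \<in> C"
  show "in_coords (g \<circ> f) c e holomorphic_on snd c ` (fst c \<inter> (g \<circ> f) -` fst e)"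
    unfolding holomorphic_on_def
  proof
    fix w assume "w \<in> snd c ` (fst c \<inter> (g \<circ> f) -` fst e)"
    then obtain x where x: "x \<in> fst c" "g (f x) \<in> fst e" and w: "w = snd c x" by auto
    have "f x \<in> topspace Y"
      using x is_chartD(4)[OF atlasD[OF X c]] f(1) by (auto simp: continuous_map_def)
    then obtain d where d: "d \<in> B" "f x \<in> fst d" "is_chart Y d" using atlas_chart_at[OF Y] by blast
    have "in_coords (g \<circ> f) c e field_differentiable (at (snd c x))"
      using in_coords_chain(1)[OF atlasD[OF X c] d(3) f(1) x(1) d(2)
        holomorphic_map_in_coords_differentiable[OF f(2) c d(1) atlasD[OF X c] f(1) d(3) x(1) d(2)]
        holomorphic_map_in_coords_differentiable[OF g(2) d(1) e d(3) g(1) atlasD[OF Z e] d(2) x(2)]] .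
    then show "in_coords (g \<circ> f) c e field_differentiable at w within snd c ` (fst c \<inter> (g \<circ> f) -` fst e)"
      unfolding w by (rule field_differentiable_at_within)
  qed
qed

section \<open>Pulling back conformal metrics\<close>

text \<open>The target metric is given by indexed local data \<open>s i\<close> in charts \<open>D i\<close>, required to agree
  only after pulling back. This covers both the pullback of a conformal metric and the gluing
  of a metric from pieces (where \<open>f\<close> is the identity).\<close>

locale local_metrics =
  fixes X :: "'a topology" and A :: "'a chart set" and Y :: "'b topology" and f :: "'a \<Rightarrow> 'b"
    and I :: "'i set" and D :: "'i \<Rightarrow> 'b chart" and s :: "'i \<Rightarrow> complex \<Rightarrow> real"
  assumes atlas: "atlas X A"
    and cont: "continuous_map X Y f" and inj: "inj_on f (topspace X)"
    and charts: "\<And>i. i \<in> I \<Longrightarrow> is_chart Y (D i)"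
    and cover: "f ` topspace X \<subseteq> (\<Union>i\<in>I. fst (D i))"
    and hol: "\<And>c i. c \<in> A \<Longrightarrow> i \<in> I
      \<Longrightarrow> in_coords f c (D i) holomorphic_on snd c ` (fst c \<inter> f -` fst (D i))"
    and smooth: "\<And>i. i \<in> I \<Longrightarrow> C_infinity_on (snd (D i) ` fst (D i)) (s i)"
    and pos: "\<And>i z. i \<in> I \<Longrightarrow> z \<in> snd (D i) ` fst (D i) \<Longrightarrow> s i z > 0"
    and compat: "\<And>c i j x. c \<in> A \<Longrightarrow> i \<in> I \<Longrightarrow> j \<in> I \<Longrightarrow> x \<in> fst c \<Longrightarrow> f x \<in> fst (D i)
      \<Longrightarrow> f x \<in> fst (D j) \<Longrightarrow> s i (snd (D i) (f x)) * cmod (deriv (in_coords f c (D i)) (snd c x))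
        = s j (snd (D j) (f x)) * cmod (deriv (in_coords f c (D j)) (snd c x))"
begin

definition pullback :: "'a density" where
  "pullback c z = (let i = SOME i. i \<in> I \<and> f (inv_into (fst c) (snd c) z) \<in> fst (D i)
     in s i (in_coords f c (D i) z) * cmod (deriv (in_coords f c (D i)) z))"

lemma pullback_eq:
  assumes "c \<in> A" "i \<in> I" "x \<in> fst c" "f x \<in> fst (D i)"
  shows "pullback c (snd c x)
    = s i (snd (D i) (f x)) * cmod (deriv (in_coords f c (D i)) (snd c x))"
proof -
  have c: "is_chart X c" using atlas assms(1) by (rule atlasD)
  define j where "j = (SOME i. i \<in> I \<and> f x \<in> fst (D i))"
  have j: "j \<in> I \<and> f x \<in> fst (D j)" unfolding j_def by (rule someI) (use assms in blast)
  have "pullback c (snd c x) = s j (snd (D j) (f x)) * cmod (deriv (in_coords f c (D j)) (snd c x))"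
    unfolding pullback_def is_chartD(8)[OF c assms(3)] j_def[symmetric] Let_def
      in_coords_apply[OF c assms(3)] ..
  also have "\<dots> = s i (snd (D i) (f x)) * cmod (deriv (in_coords f c (D i)) (snd c x))"
    using assms j by (intro compat) auto
  finally show ?thesis .
qed

lemma index_at:
  assumes "c \<in> A" "x \<in> fst c"
  obtains i where "i \<in> I" "f x \<in> fst (D i)"
  using cover is_chartD(4)[OF atlasD[OF atlas assms(1)]] assms(2) by blast

abbreviation (input) dom where "dom c i \<equiv> snd c ` (fst c \<inter> f -` fst (D i))"

lemma open_dom: "c \<in> A \<Longrightarrow> i \<in> I \<Longrightarrow> open (dom c i)"
  by (rule open_in_coords_domain[OF atlasD[OF atlas] cont is_chartD(1)[OF charts]])

lemma in_coords_dom: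
  assumes "c \<in> A" "z \<in> dom c i"
  shows "in_coords f c (D i) z \<in> snd (D i) ` fst (D i)"
proof -
  obtain x where "x \<in> fst c" "f x \<in> fst (D i)" "z = snd c x" using assms(2) by auto
  then show ?thesis using in_coords_apply[OF atlasD[OF atlas assms(1)], of x f "D i"] by simp
qed

text \<open>An injective holomorphic function has no critical points, so the pullback is again a metric.\<close>

lemma deriv_nonzero:
  assumes "c \<in> A" "i \<in> I" "z \<in> dom c i"
  shows "deriv (in_coords f c (D i)) z \<noteq> 0"
proof -
  have c: "is_chart X c" using atlas assms(1) by (rule atlasD)
  have "inj_on (in_coords f c (D i)) (dom c i)"
  proof (rule inj_onI)
    fix u v assume "u \<in> dom c i" "v \<in> dom c i" and eq: "in_coords f c (D i) u = in_coords f c (D i) v"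
    then obtain x y where x: "x \<in> fst c" "f x \<in> fst (D i)" "u = snd c x"
      and y: "y \<in> fst c" "f y \<in> fst (D i)" "v = snd c y" by auto
    then have "snd (D i) (f x) = snd (D i) (f y)"
      using eq in_coords_apply[OF c] by metis
    then have "f x = f y" using x y is_chartD(3)[OF charts[OF assms(2)]] by (auto dest: inj_onD)
    then have "x = y" using inj x y is_chartD(4)[OF c] by (auto dest: inj_onD)
    then show "u = v" using x y by simp
  qed
  with holomorphic_injective_imp_regular[OF hol[OF assms(1,2)] open_dom[OF assms(1,2)]] assms(3)
  show ?thesis by blast
qed

lemma pullback_on_dom:
  assumes "c \<in> A" "i \<in> I" "z \<in> dom c i"
  shows "pullback c z = s i (in_coords f c (D i) z) * cmod (deriv (in_coords f c (D i)) z)"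
proof -
  obtain x where "x \<in> fst c" "f x \<in> fst (D i)" "z = snd c x" using assms(3) by auto
  then show ?thesis
    using pullback_eq[OF assms(1,2)] in_coords_apply[OF atlasD[OF atlas assms(1)], of x f "D i"] by simp
qed

lemma conformal: "conformal_metric X A pullback"
  unfolding conformal_metric_def
proof (intro conjI ballI)
  fix c assume c: "c \<in> A"
  note ch = atlasD[OF atlas c]
  show "C_infinity_on (snd c ` fst c) (pullback c)"
  proof (rule C_infinity_on_local)
    fix z assume "z \<in> snd c ` fst c"
    then obtain x where x: "x \<in> fst c" "z = snd c x" by auto
    then obtain i where i: "i \<in> I" "f x \<in> fst (D i)" using index_at c by blast
    let ?h = "in_coords f c (D i)"
    note o = open_dom[OF c i(1)] and h = hol[OF c i(1)]
    have "C_infinity_on (dom c i) (\<lambda>z. s i (?h z))"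
      using in_coords_dom[OF c]
      by (intro C_infinity_on_compose[OF o smooth[OF i(1)] C_infinity_on_holomorphic[OF o h]] image_subsetI)
    moreover have "C_infinity_on (dom c i) (\<lambda>z. cmod (deriv ?h z))"
      by (rule C_infinity_on_cmod[OF o holomorphic_deriv[OF h o] deriv_nonzero[OF c i(1)]])
    ultimately have "C_infinity_on (dom c i) (\<lambda>z. s i (?h z) * cmod (deriv ?h z))"
      by (rule C_infinity_on_mult[OF o])
    moreover have "C_infinity_on (dom c i) (pullback c)
        = C_infinity_on (dom c i) (\<lambda>z. s i (?h z) * cmod (deriv ?h z))"
      by (rule C_infinity_on_cong[OF o]) (rule pullback_on_dom[OF c i(1)])
    ultimately have "C_infinity_on (dom c i) (pullback c)" by (rule iffD2[rotated])
    then show "\<exists>U. open U \<and> z \<in> U \<and> C_infinity_on U (pullback c)"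
      using o x i by blast
  qed
  fix z assume "z \<in> snd c ` fst c"
  then obtain x where x: "x \<in> fst c" "z = snd c x" by auto
  then obtain i where i: "i \<in> I" "f x \<in> fst (D i)" using index_at c by blast
  have z: "z \<in> dom c i" using x i by blast
  show "pullback c z > 0"
    unfolding pullback_on_dom[OF c i(1) z]
    using pos[OF i(1) in_coords_dom[OF c z]] deriv_nonzero[OF c i(1) z] by simp
next
  fix p assume p: "p \<in> topspace X"
  show "pullback_eq_at A pullback A pullback id p"
    unfolding pullback_eq_at_def
  proof (intro ballI impI, elim conjE)
    fix c d assume c: "c \<in> A" and d: "d \<in> A" and pc: "p \<in> fst c" and "id p \<in> fst d"
    then have pd: "p \<in> fst d" by simp
    note cc = atlasD[OF atlas c] and cd = atlasD[OF atlas d]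
    obtain i where i: "i \<in> I" "f p \<in> fst (D i)" using index_at[OF c pc] by blast
    have id: "continuous_map X X id" by (simp add: id_def)
    have tr: "in_coords id c d field_differentiable (at (snd c p))"
      using holomorphic_map_in_coords_differentiable[of A A id c d X X p] atlas c d cc cd id pc pd
      by (simp add: atlas_def)
    have "in_coords f d (D i) field_differentiable (at (snd d p))"
      using hol[OF d i(1)] open_dom[OF d i(1)] pd i(2) holomorphic_on_imp_differentiable_at by blast
    then have "deriv (in_coords f c (D i)) (snd c p)
        = deriv (in_coords f d (D i)) (snd d p) * deriv (in_coords id c d) (snd c p)"
      using in_coords_chain(2)[OF cc cd id pc _ tr, of f "D i"] pd by simp
    then show "pullback c (snd c p) = pullback d (snd d (id p)) * cmod (deriv (in_coords id c d) (snd c p))"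
      using pullback_eq[OF c i(1) pc i(2)] pullback_eq[OF d i(1) pd i(2)] by (simp add: norm_mult)
  qed
qed

text \<open>Pulling back adds the logarithm of the modulus of a holomorphic function, which is harmonic, and
  rescales the Laplacian and the square of the density by the same factor.\<close>

lemma curvature:
  assumes c: "c \<in> A" and i: "i \<in> I" and x: "x \<in> fst c" "f x \<in> fst (D i)"
  shows "gauss_curvature pullback c (snd c x)
    = - laplacian (\<lambda>w. ln (s i w)) (snd (D i) (f x)) / (s i (snd (D i) (f x)))\<^sup>2"
proof -
  let ?h = "in_coords f c (D i)" and ?z = "snd c x"
  note o = open_dom[OF c i] and h = hol[OF c i]
  have z: "?z \<in> dom c i" using x by blast
  have hz: "?h ?z = snd (D i) (f x)" using in_coords_apply[OF atlasD[OF atlas c] x(1)] .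
  have sub: "?h ` dom c i \<subseteq> snd (D i) ` fst (D i)" using in_coords_dom[OF c] by blast
  have h': "deriv ?h holomorphic_on dom c i" using h o by (rule holomorphic_deriv)
  have oD: "open (snd (D i) ` fst (D i))" using is_chartD(2)[OF charts[OF i]] .
  have C1: "C_infinity_on (snd (D i) ` fst (D i)) (\<lambda>w. ln (s i w))"
    by (rule C_infinity_on_ln[OF oD smooth[OF i] pos[OF i]])
  have "laplacian (\<lambda>w. ln (pullback c w)) ?z
     = laplacian (\<lambda>w. ln (s i (?h w)) + ln (cmod (deriv ?h w))) ?z"
  proof (rule laplacian_cong_open[OF o z])
    fix w assume w: "w \<in> dom c i"
    show "ln (pullback c w) = ln (s i (?h w)) + ln (cmod (deriv ?h w))"
      unfolding pullback_on_dom[OF c i w]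
      using pos[OF i in_coords_dom[OF c w]] deriv_nonzero[OF c i w] by (simp add: ln_mult)
  qed
  also have "\<dots> = laplacian (\<lambda>w. ln (s i (?h w))) ?z + laplacian (\<lambda>w. ln (cmod (deriv ?h w))) ?z"
    by (rule laplacian_add[OF o C_infinity_on_C_2[OF C_infinity_on_compose[OF o C1
          C_infinity_on_holomorphic[OF o h] sub]]
          C_infinity_on_C_2[OF C_infinity_on_ln_cmod[OF o h' deriv_nonzero[OF c i]]] z])
  also have "\<dots> = (cmod (deriv ?h ?z))\<^sup>2 * laplacian (\<lambda>w. ln (s i w)) (snd (D i) (f x))"
    using laplacian_compose_holomorphic[OF o h C_infinity_on_C_2[OF C1] sub oD z]
      laplacian_ln_cmod[OF o h' deriv_nonzero[OF c i] z] hz by simp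
  finally show ?thesis
    using deriv_nonzero[OF c i z] pos[OF i in_coords_dom[OF c z]]
    unfolding gauss_curvature_def pullback_on_dom[OF c i z] hz
    by (simp add: power_mult_distrib)
qed

end

lemma local_metrics_conformal:
  assumes X: "atlas X A" and Y: "atlas Y B" and f: "continuous_map X Y f" "inj_on f (topspace X)"
    and hol: "holomorphic_map A B f" and \<sigma>: "conformal_metric Y B \<sigma>"
  shows "local_metrics X A Y f B (\<lambda>d. d) \<sigma>"
proof
  show "f ` topspace X \<subseteq> (\<Union>d\<in>B. fst d)"
    using Y f(1) by (auto simp: atlas_def continuous_map_def)
  show "in_coords f c d holomorphic_on snd c ` (fst c \<inter> f -` fst d)" if "c \<in> A" "d \<in> B" for c d
    using hol that by (auto simp: holomorphic_map_def)
  fix c d e x assume *: "c \<in> A" "d \<in> B" "e \<in> B" "x \<in> fst c" "f x \<in> fst d" "f x \<in> fst e"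
  note cc = atlasD[OF X *(1)] and cd = atlasD[OF Y *(2)] and ce = atlasD[OF Y *(3)]
  have id: "continuous_map Y Y id" by (simp add: id_def)
  have 1: "in_coords f c d field_differentiable (at (snd c x))"
    using holomorphic_map_in_coords_differentiable[OF hol *(1,2) cc f(1) cd *(4,5)] .
  have 2: "in_coords id d e field_differentiable (at (snd d (f x)))"
    using holomorphic_map_in_coords_differentiable[OF _ *(2,3) cd id ce *(5)] Y *(6)
    by (simp add: atlas_def)
  have "deriv (in_coords f c e) (snd c x)
      = deriv (in_coords id d e) (snd d (f x)) * deriv (in_coords f c d) (snd c x)"
    using in_coords_chain(2)[OF cc cd f(1) *(4,5) 1 2] unfolding id_comp .
  moreover have "\<sigma> d (snd d (f x)) = \<sigma> e (snd e (f x)) * cmod (deriv (in_coords id d e) (snd d (f x)))"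
  proof -
    have "f x \<in> topspace Y" using is_chartD(4)[OF cd] *(5) by blast
    then have "pullback_eq_at B \<sigma> B \<sigma> id (f x)" using \<sigma> by (simp only: conformal_metric_def)
    then show ?thesis unfolding pullback_eq_at_def using *(2,3,5,6) by (metis id_apply)
  qed
  ultimately show "\<sigma> d (snd d (f x)) * cmod (deriv (in_coords f c d) (snd c x))
      = \<sigma> e (snd e (f x)) * cmod (deriv (in_coords f c e) (snd c x))"
    by (simp add: norm_mult)
qed (use assms in \<open>auto simp: atlas_def conformal_metric_def\<close>)

section \<open>Open subsets of the plane as surfaces\<close>

text \<open>With this chart a map from an open subset of the plane is a map between surfaces, so that metrics can be
  pulled back by parametrizations.\<close>

definition plane_chart :: "complex set \<Rightarrow> complex chart" where
  "plane_chart V = (V, \<lambda>z. z)"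

lemma plane_chart_simps [simp]: "fst (plane_chart V) = V" "snd (plane_chart V) = (\<lambda>z. z)"
  by (simp_all add: plane_chart_def)

lemma in_coords_plane_chart: "z \<in> V \<Longrightarrow> in_coords f (plane_chart V) c z = snd c (f z)"
  using inv_into_f_f[of "\<lambda>z. z" V z] by (simp add: in_coords_def)

lemma atlas_plane_chart:
  assumes "open V"
  shows "atlas (top_of_set V) {plane_chart V}"
proof -
  have "is_chart (top_of_set V) (plane_chart V)"
    using assms homeomorphic_map_id[of "top_of_set V" "top_of_set V"]
    by (simp add: is_chart_def id_def subtopology_subtopology)
  moreover have "(\<lambda>z. z) holomorphic_on V" by (rule holomorphic_on_ident)
  then have "in_coords id (plane_chart V) (plane_chart V) holomorphic_on V"
    by (rule holomorphic_transform) (simp add: in_coords_plane_chart)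
  ultimately show ?thesis by (simp add: atlas_def holomorphic_map_def)
qed

lemma deriv_in_coords_plane_chart:
  assumes "open V" "z \<in> V"
  shows "deriv (in_coords f (plane_chart V) c) z = deriv (snd c \<circ> f) z"
  using assms in_coords_plane_chart[of _ V f c]
  by (intro deriv_cong_ev) (auto simp: eventually_nhds)

lemma holomorphic_map_plane_chart:
  "holomorphic_map {plane_chart V} B f \<longleftrightarrow> (\<forall>d\<in>B. (snd d \<circ> f) holomorphic_on V \<inter> f -` fst d)"
proof -
  have "in_coords f (plane_chart V) d holomorphic_on V \<inter> f -` fst d
     \<longleftrightarrow> (snd d \<circ> f) holomorphic_on V \<inter> f -` fst d" for d :: "'a chart"
    by (rule holomorphic_cong) (auto simp: in_coords_plane_chart)
  then show ?thesis by (simp add: holomorphic_map_def)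
qed

text \<open>By invariance of domain, continuity and injectivity suffice for openness.\<close>

lemma open_map_into_surface:
  fixes V :: "complex set"
  assumes Y: "atlas Y B" and V: "open V" and f: "continuous_map (top_of_set V) Y f" "inj_on f V"
    and U: "open U" "U \<subseteq> V"
  shows "openin Y (f ` U)"
proof (subst openin_subopen, intro ballI)
  fix y assume "y \<in> f ` U"
  then obtain z where z: "z \<in> U" "y = f z" by auto
  have "y \<in> topspace Y" using f(1) z U by (auto simp: continuous_map_def)
  then obtain d where d: "d \<in> B" "y \<in> fst d" "is_chart Y d" using atlas_chart_at[OF Y] by blast
  define W where "W = U \<inter> f -` fst d"
  have fV: "f ` V \<subseteq> topspace Y" using f(1) by (auto simp: continuous_map_def)
  have "openin (top_of_set V) {z \<in> V. f z \<in> fst d}"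
    using openin_continuous_map_preimage[OF f(1) is_chartD(1)[OF d(3)]] by simp
  then have "open {z \<in> V. f z \<in> fst d}" using V openin_open_trans by blast
  then have "open (U \<inter> {z \<in> V. f z \<in> fst d})" using U(1) by auto
  moreover have "U \<inter> {z \<in> V. f z \<in> fst d} = W" using U(2) by (auto simp: W_def)
  ultimately have W: "open W" by simp
  have "continuous_map (top_of_set W) (subtopology Y (fst d)) f"
    using continuous_map_from_subtopology_mono[OF f(1), of W] U(2)
    by (auto simp: continuous_map_in_subtopology W_def)
  then have "continuous_map (top_of_set W) euclidean (snd d \<circ> f)"
    using is_chartD(5)[OF d(3)] by (rule continuous_map_compose)
  then have cont: "continuous_on W (snd d \<circ> f)" by simp
  have "inj_on (snd d \<circ> f) W"
    using inj_on_subset[OF f(2), of W] inj_on_subset[OF is_chartD(3)[OF d(3)], of "f ` W"] U(2)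
    by (intro comp_inj_on) (auto simp: W_def)
  with cont W have "open ((snd d \<circ> f) ` W)" by (rule invariance_of_domain)
  then have "openin Y (fst d \<inter> snd d -` ((snd d \<circ> f) ` W))" by (rule is_chartD(7)[OF d(3)])
  moreover have "fst d \<inter> snd d -` ((snd d \<circ> f) ` W) = f ` W"
  proof (intro equalityI subsetI)
    fix q assume "q \<in> fst d \<inter> snd d -` ((snd d \<circ> f) ` W)"
    then obtain w where "w \<in> W" "q \<in> fst d" "snd d q = snd d (f w)" by auto
    then have "q = f w" using is_chartD(3)[OF d(3)] by (auto simp: W_def dest: inj_onD)
    then show "q \<in> f ` W" using \<open>w \<in> W\<close> by auto
  qed (auto simp: W_def)
  ultimately have "openin Y (f ` W)" by simp
  moreover have "y \<in> f ` W" "f ` W \<subseteq> f ` U" using z d(2) by (auto simp: W_def)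
  ultimately show "\<exists>T. openin Y T \<and> y \<in> T \<and> T \<subseteq> f ` U" by blast
qed

section \<open>Isometric embeddings are holomorphic up to conjugation\<close>

definition holomorphic_isometry ::
  "'a chart set \<Rightarrow> 'a density \<Rightarrow> 'a topology \<Rightarrow> complex set \<Rightarrow> (complex \<Rightarrow> 'a) \<Rightarrow> bool" where
  "holomorphic_isometry A \<rho> X V \<phi> \<longleftrightarrow>
     continuous_map (top_of_set V) X \<phi> \<and> inj_on \<phi> V \<and>
     (\<forall>c\<in>A. \<forall>z\<in>V. \<phi> z \<in> fst c \<longrightarrow> (snd c \<circ> \<phi>) field_differentiable (at z) \<and>
        \<rho> c (snd c (\<phi> z)) * cmod (deriv (snd c \<circ> \<phi>) z) = cusp_density z)"

lemma holomorphic_isometry_subset: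
  "holomorphic_isometry A \<rho> X V \<phi> \<Longrightarrow> W \<subseteq> V \<Longrightarrow> holomorphic_isometry A \<rho> X W \<phi>"
  unfolding holomorphic_isometry_def
  by (meson continuous_map_from_subtopology_mono inj_on_subset subsetD)

lemma open_plane_preimage:
  assumes "open V" "continuous_map (top_of_set V) X \<phi>" "openin X U"
  shows "open (V \<inter> \<phi> -` U)"
proof -
  have "openin (top_of_set V) {z \<in> topspace (top_of_set V). \<phi> z \<in> U}"
    by (rule openin_continuous_map_preimage[OF assms(2,3)])
  then have "open {z \<in> V. \<phi> z \<in> U}" using assms(1) openin_open_trans by auto
  then show ?thesis by (simp add: vimage_def Int_def)
qed

lemma holomorphic_isometry_holomorphic_map:
  assumes "holomorphic_isometry A \<rho> X V \<phi>"
  shows "holomorphic_map {plane_chart V} A \<phi>"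
  using assms unfolding holomorphic_map_plane_chart holomorphic_isometry_def holomorphic_on_def
  by (auto intro: field_differentiable_at_within)

lemma holomorphic_isometry_imp_isometric_embedding:
  assumes V: "open V" and X: "atlas X A" and \<phi>: "holomorphic_isometry A \<rho> X V \<phi>"
  shows "isometric_embedding X A \<rho> V \<phi>"
  unfolding isometric_embedding_def
proof (intro conjI ballI allI)
  show cont: "continuous_map (top_of_set V) X \<phi>" and "inj_on \<phi> V"
    using \<phi> by (auto simp: holomorphic_isometry_def)
  fix c assume c: "c \<in> A"
  have "(snd c \<circ> \<phi>) holomorphic_on V \<inter> \<phi> -` fst c"
    using holomorphic_isometry_holomorphic_map[OF \<phi>] c by (auto simp: holomorphic_map_plane_chart)
  then show "C_infinity_on (V \<inter> \<phi> -` fst c) (snd c \<circ> \<phi>)"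
    by (intro C_infinity_on_holomorphic open_plane_preimage[OF V cont] is_chartD(1)[OF atlasD[OF X c]])
  fix z v assume "z \<in> V \<inter> \<phi> -` fst c"
  then have *: "(snd c \<circ> \<phi>) field_differentiable (at z)"
    "\<rho> c (snd c (\<phi> z)) * cmod (deriv (snd c \<circ> \<phi>) z) = cusp_density z"
    using \<phi> c by (auto simp: holomorphic_isometry_def)
  then have "((snd c \<circ> \<phi>) has_derivative (\<lambda>v. deriv (snd c \<circ> \<phi>) z * v)) (at z)"
    using field_differentiable_derivI[OF *(1)] by (simp add: has_field_derivative_def)
  then have "frechet_derivative (snd c \<circ> \<phi>) (at z) v = deriv (snd c \<circ> \<phi>) z * v"
    using frechet_derivative_at by metis
  then show "\<rho> c (snd c (\<phi> z)) * cmod (frechet_derivative (snd c \<circ> \<phi>) (at z) v)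
      = cusp_density z * cmod v"
    using *(2) by (simp add: norm_mult)
qed

text \<open>\<open>L 1\<close> and \<open>L \<i>\<close> are orthogonal and of equal length, as one sees from \<open>L (1 + \<i>)\<close> and \<open>L (1 - \<i>)\<close>.\<close>

lemma conformal_linear_cases:
  fixes L :: "complex \<Rightarrow> complex"
  assumes "linear L" "\<And>v. cmod (L v) = k * cmod v"
  shows "L \<i> = \<i> * L 1 \<or> L \<i> = - \<i> * L 1"
proof -
  have n: "cmod (L \<i>) = cmod (L 1)" using assms(2)[of 1] assms(2)[of \<i>] by simp
  have "(cmod (L 1 + L \<i>))\<^sup>2 = (cmod (L 1 - L \<i>))\<^sup>2"
    using assms(2)[of "1 + \<i>"] assms(2)[of "1 - \<i>"] linear_add[OF assms(1), of 1 \<i>]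
      linear_diff[OF assms(1), of 1 \<i>] by (simp add: cmod_def)
  then have 1: "Re (L 1) * Re (L \<i>) + Im (L 1) * Im (L \<i>) = 0"
    unfolding cmod_power2 by (simp add: power2_eq_square algebra_simps)
  have 2: "(Re (L \<i>))\<^sup>2 + (Im (L \<i>))\<^sup>2 = (Re (L 1))\<^sup>2 + (Im (L 1))\<^sup>2"
    using n cmod_power2[of "L \<i>"] cmod_power2[of "L 1"] by simp
  have "(L \<i> - \<i> * L 1) * (L \<i> + \<i> * L 1) = (L \<i>)\<^sup>2 + (L 1)\<^sup>2"
    by (simp add: power2_eq_square algebra_simps)
  also have "(L \<i>)\<^sup>2 + (L 1)\<^sup>2 = 0"
  proof -
    define a b c d where "a = Re (L 1)" and "b = Im (L 1)" and "c = Re (L \<i>)" and "d = Im (L \<i>)"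
    have ac: "a * c = - (b * d)" and s: "c\<^sup>2 + d\<^sup>2 = a\<^sup>2 + b\<^sup>2"
      using 1 2 by (auto simp: a_def b_def c_def d_def)
    have "(c\<^sup>2 - d\<^sup>2 + (a\<^sup>2 - b\<^sup>2))\<^sup>2 + (2 * c * d + 2 * a * b)\<^sup>2
        = (c\<^sup>2 + d\<^sup>2)\<^sup>2 + (a\<^sup>2 + b\<^sup>2)\<^sup>2 + 2 * ((a * c)\<^sup>2 + (b * d)\<^sup>2 + 4 * (a * c) * (b * d) - (a * d)\<^sup>2 - (b * c)\<^sup>2)"
      by (simp add: power2_eq_square algebra_simps)
    also have "\<dots> = (c\<^sup>2 + d\<^sup>2)\<^sup>2 + (a\<^sup>2 + b\<^sup>2)\<^sup>2 - 2 * (a\<^sup>2 + b\<^sup>2) * (c\<^sup>2 + d\<^sup>2)"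
      unfolding ac by (simp add: power2_eq_square algebra_simps) (use ac in algebra)
    also have "\<dots> = 0" unfolding s by (simp add: power2_eq_square algebra_simps)
    finally have "(c\<^sup>2 - d\<^sup>2 + (a\<^sup>2 - b\<^sup>2))\<^sup>2 + (2 * c * d + 2 * a * b)\<^sup>2 = 0" .
    then have "c\<^sup>2 - d\<^sup>2 + (a\<^sup>2 - b\<^sup>2) = 0" "2 * c * d + 2 * a * b = 0"
      by (auto simp: sum_power2_eq_zero_iff)
    then show ?thesis
      by (simp add: complex_eq_iff power2_eq_square a_def b_def c_def d_def algebra_simps)
  qed
  finally show ?thesis by (auto simp: add_eq_0_iff)
qed

lemma has_derivative_complex_linear:
  assumes "(F has_derivative L) (at z)" "L \<i> = \<i> * L 1"
  shows "(F has_field_derivative L 1) (at z)"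
proof -
  interpret bounded_linear L using assms(1) by (rule has_derivative_bounded_linear)
  have "L v = L 1 * v" for v
  proof -
    have "v = Re v *\<^sub>R 1 + Im v *\<^sub>R \<i>" by (simp add: complex_eq_iff)
    then have "L v = L (Re v *\<^sub>R 1 + Im v *\<^sub>R \<i>)" by (rule arg_cong)
    also have "\<dots> = Re v *\<^sub>R L 1 + Im v *\<^sub>R L \<i>" by (simp only: add scaleR)
    also have "\<dots> = L 1 * v" by (simp add: assms(2) complex_eq_iff algebra_simps)
    finally show ?thesis .
  qed
  then have "L = (*) (L 1)" by (rule ext)
  then show ?thesis using assms(1) by (simp add: has_field_derivative_def)
qed

lemma dir_deriv_change_chart:
  assumes X: "atlas X A" and V: "open V" and \<phi>: "continuous_map (top_of_set V) X \<phi>"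
    and c: "c \<in> A" "d \<in> A" and z: "z \<in> V" "\<phi> z \<in> fst c" "\<phi> z \<in> fst d"
    and diff: "(snd c \<circ> \<phi>) differentiable (at z)"
  shows "dir_deriv v (snd d \<circ> \<phi>) z
    = deriv (in_coords id c d) (snd c (\<phi> z)) * dir_deriv v (snd c \<circ> \<phi>) z"
proof -
  note cc = atlasD[OF X c(1)] and cd = atlasD[OF X c(2)]
  have id: "continuous_map X X id" by (simp add: id_def)
  have "in_coords id c d field_differentiable (at (snd c (\<phi> z)))"
    using holomorphic_map_in_coords_differentiable[OF _ c cc id cd z(2)] X z(3)
    by (simp add: atlas_def)
  then have "(in_coords id c d has_derivative (*) (deriv (in_coords id c d) (snd c (\<phi> z))))
      (at ((snd c \<circ> \<phi>) z))"
    using field_differentiable_derivI by (fastforce simp: has_field_derivative_def)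
  from has_derivative_compose[OF dir_deriv_has_derivative[OF diff] this]
  have *: "((\<lambda>w. in_coords id c d ((snd c \<circ> \<phi>) w)) has_derivative
      (\<lambda>v. deriv (in_coords id c d) (snd c (\<phi> z)) * dir_deriv v (snd c \<circ> \<phi>) z)) (at z)" .
  have "(snd d \<circ> \<phi> has_derivative
      (\<lambda>v. deriv (in_coords id c d) (snd c (\<phi> z)) * dir_deriv v (snd c \<circ> \<phi>) z)) (at z)"
  proof (rule has_derivative_transform_within_open[OF *])
    show "open (V \<inter> \<phi> -` fst c)" by (rule open_plane_preimage[OF V \<phi> is_chartD(1)[OF cc]])
    show "z \<in> V \<inter> \<phi> -` fst c" using z by simp
    fix w assume "w \<in> V \<inter> \<phi> -` fst c"
    then show "in_coords id c d ((snd c \<circ> \<phi>) w) = (snd d \<circ> \<phi>) w"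
      using in_coords_apply[OF cc, of "\<phi> w" id d] by simp
  qed
  then show ?thesis by (rule dir_deriv_eq)
qed

lemma cusp_density_pos: "z \<in> cusp_disc 1 \<Longrightarrow> cusp_density z > 0"
  by (simp add: cusp_disc_def cusp_density_def field_simps mult_less_0_iff)

lemma cusp_density_cnj [simp]: "cusp_density (cnj z) = cusp_density z"
  by (simp add: cusp_density_def)

text \<open>The set of points where the differential is complex linear and the set where it is
  antilinear are both open, so one of them is everything.\<close>

lemma isometric_embedding_orientation:
  assumes X: "atlas X A" and \<rho>: "conformal_metric X A \<rho>"
    and V: "open V" "connected V" "V \<subseteq> cusp_disc 1" and \<phi>: "isometric_embedding X A \<rho> V \<phi>"
  shows "holomorphic_isometry A \<rho> X V \<phi> \<or> holomorphic_isometry A \<rho> X (cnj ` V) (\<phi> \<circ> cnj)"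
proof -
  have cont: "continuous_map (top_of_set V) X \<phi>" and inj: "inj_on \<phi> V"
    using \<phi> by (auto simp: isometric_embedding_def)
  have o: "open (V \<inter> \<phi> -` fst c)" if "c \<in> A" for c
    by (rule open_plane_preimage[OF V(1) cont is_chartD(1)[OF atlasD[OF X that]]])
  have C: "C_k_on k (V \<inter> \<phi> -` fst c) (snd c \<circ> \<phi>)" if "c \<in> A" for c k
    using \<phi> that by (simp add: isometric_embedding_def C_infinity_on_def)
  have diff: "(snd c \<circ> \<phi>) differentiable (at z)" if "c \<in> A" "z \<in> V" "\<phi> z \<in> fst c" for c z
    using C[OF that(1), of 1] that by auto
  have pos: "\<rho> c (snd c (\<phi> z)) > 0" if "c \<in> A" "\<phi> z \<in> fst c" for c z
    using \<rho> that by (auto simp: conformal_metric_def)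
  have iso: "cmod (dir_deriv v (snd c \<circ> \<phi>) z) = cusp_density z / \<rho> c (snd c (\<phi> z)) * cmod v"
    if "c \<in> A" "z \<in> V" "\<phi> z \<in> fst c" for c z v
    using \<phi> that pos[OF that(1,3)] by (auto simp: isometric_embedding_def dir_deriv_def field_simps)
  have nz: "dir_deriv 1 (snd c \<circ> \<phi>) z \<noteq> 0" if "c \<in> A" "z \<in> V" "\<phi> z \<in> fst c" for c z
    using iso[OF that, of 1] pos[OF that(1,3)] cusp_density_pos[of z] V(3) that(2) by fastforce
  have cases: "dir_deriv \<i> (snd c \<circ> \<phi>) z = \<i> * dir_deriv 1 (snd c \<circ> \<phi>) z
      \<or> dir_deriv \<i> (snd c \<circ> \<phi>) z = - \<i> * dir_deriv 1 (snd c \<circ> \<phi>) z"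
    if "c \<in> A" "z \<in> V" "\<phi> z \<in> fst c" for c z
    by (rule conformal_linear_cases[OF _ iso[OF that]])
       (rule has_derivative_linear[OF dir_deriv_has_derivative[OF diff[OF that]]])
  define P where "P e = {z \<in> V. \<exists>c\<in>A. \<phi> z \<in> fst c \<and>
      dir_deriv \<i> (snd c \<circ> \<phi>) z = e * dir_deriv 1 (snd c \<circ> \<phi>) z}" for e :: complex
  have indep: "dir_deriv \<i> (snd d \<circ> \<phi>) z = e * dir_deriv 1 (snd d \<circ> \<phi>) z"
    if z: "z \<in> P e" and d: "d \<in> A" "\<phi> z \<in> fst d" for e z d
  proof -
    obtain c where c: "c \<in> A" "\<phi> z \<in> fst c" "z \<in> V"
      "dir_deriv \<i> (snd c \<circ> \<phi>) z = e * dir_deriv 1 (snd c \<circ> \<phi>) z"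
      using z by (auto simp: P_def)
    show ?thesis
      unfolding dir_deriv_change_chart[OF X V(1) cont c(1) d(1) c(3,2) d(2) diff[OF c(1,3,2)]] c(4)
      by simp
  qed
  have openP: "open (P e)" if e: "e = \<i> \<or> e = - \<i>" for e
  proof (subst open_subopen, intro ballI)
    fix z assume z: "z \<in> P e"
    then obtain c where c: "c \<in> A" "\<phi> z \<in> fst c" "z \<in> V" by (auto simp: P_def)
    let ?U = "V \<inter> \<phi> -` fst c"
    let ?G = "\<lambda>z. dir_deriv \<i> (snd c \<circ> \<phi>) z + e * dir_deriv 1 (snd c \<circ> \<phi>) z"
    have "continuous_on ?U ?G"
      using C[OF c(1), of 1] by (auto intro!: continuous_intros)
    then have "openin (top_of_set ?U) (?U \<inter> ?G -` (- {0}))"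
      by (rule continuous_openin_preimage_gen) auto
    then have "open (?U \<inter> ?G -` (- {0}))" using o[OF c(1)] openin_open_trans by blast
    moreover have "z \<in> ?U \<inter> ?G -` (- {0})"
      using indep[OF z c(1,2)] c nz[OF c(1,3,2)] e by auto
    moreover have "?U \<inter> ?G -` (- {0}) \<subseteq> P e"
      using cases[OF c(1)] c(1) e by (fastforce simp: P_def)
    ultimately show "\<exists>T. open T \<and> z \<in> T \<and> T \<subseteq> P e" by blast
  qed
  have cover: "V \<subseteq> P \<i> \<union> P (- \<i>)"
  proof
    fix z assume z: "z \<in> V"
    then have "\<phi> z \<in> topspace X" using cont by (auto simp: continuous_map_def)
    then obtain c where "c \<in> A" "\<phi> z \<in> fst c" using atlas_chart_at[OF X] by blast
    then show "z \<in> P \<i> \<union> P (- \<i>)" using cases[of c z] z by (auto simp: P_def)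
  qed
  have "P \<i> \<inter> P (- \<i>) = {}"
  proof (rule ccontr)
    assume "P \<i> \<inter> P (- \<i>) \<noteq> {}"
    then obtain z where z: "z \<in> P \<i>" "z \<in> P (- \<i>)" by auto
    then obtain c where c: "c \<in> A" "\<phi> z \<in> fst c" "z \<in> V" by (auto simp: P_def)
    show False using indep[OF z(1) c(1,2)] indep[OF z(2) c(1,2)] nz[OF c(1,3,2)] by simp
  qed
  then have "P \<i> \<inter> V = {} \<or> P (- \<i>) \<inter> V = {}"
    using connectedD[OF V(2) openP openP, of \<i> "- \<i>"] cover by blast
  then consider "V \<subseteq> P \<i>" | "V \<subseteq> P (- \<i>)" using cover by blast
  then show ?thesis
  proof cases
    case 1
    have "(snd c \<circ> \<phi> has_field_derivative dir_deriv 1 (snd c \<circ> \<phi>) z) (at z)"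
      if "c \<in> A" "z \<in> V" "\<phi> z \<in> fst c" for c z
      using has_derivative_complex_linear[OF dir_deriv_has_derivative[OF diff[OF that]]]
        indep[of z \<i> c] that 1 by auto
    then have "holomorphic_isometry A \<rho> X V \<phi>"
      unfolding holomorphic_isometry_def
      using cont inj iso[of _ _ 1] pos DERIV_imp_deriv
      by (fastforce simp: field_differentiable_def)
    then show ?thesis ..
  next
    case 2
    have *: "((snd c \<circ> (\<phi> \<circ> cnj)) has_field_derivative dir_deriv 1 (snd c \<circ> \<phi>) (cnj z)) (at z)"
      if "c \<in> A" "cnj z \<in> V" "\<phi> (cnj z) \<in> fst c" for c z
    proof -
      have D: "((snd c \<circ> (\<phi> \<circ> cnj)) has_derivative (\<lambda>v. dir_deriv (cnj v) (snd c \<circ> \<phi>) (cnj z))) (at z)"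
        using has_derivative_compose[OF bounded_linear_imp_has_derivative[OF bounded_linear_cnj]
            dir_deriv_has_derivative[OF diff[OF that]], of UNIV] by (simp add: comp_def)
      have "dir_deriv (cnj \<i>) (snd c \<circ> \<phi>) (cnj z) = - dir_deriv \<i> (snd c \<circ> \<phi>) (cnj z)"
        using linear_neg[OF has_derivative_linear[OF dir_deriv_has_derivative[OF diff[OF that]]], of \<i>]
        by simp
      also have "\<dots> = \<i> * dir_deriv (cnj 1) (snd c \<circ> \<phi>) (cnj z)"
        using indep[of "cnj z" "- \<i>" c] that 2 by auto
      finally show ?thesis using has_derivative_complex_linear[OF D] by simp
    qed
    have "continuous_map (top_of_set (cnj ` V)) (top_of_set V) cnj"
      by (auto simp: continuous_map_in_subtopology intro: continuous_intros)
    then have "continuous_map (top_of_set (cnj ` V)) X (\<phi> \<circ> cnj)"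
      using cont by (rule continuous_map_compose)
    moreover have "inj_on (\<phi> \<circ> cnj) (cnj ` V)"
      using inj by (auto simp: inj_on_def)
    moreover have "(snd c \<circ> (\<phi> \<circ> cnj)) field_differentiable (at z) \<and>
        \<rho> c (snd c ((\<phi> \<circ> cnj) z)) * cmod (deriv (snd c \<circ> (\<phi> \<circ> cnj)) z) = cusp_density z"
      if "c \<in> A" "z \<in> cnj ` V" "(\<phi> \<circ> cnj) z \<in> fst c" for c z
    proof -
      have z: "cnj z \<in> V" "\<phi> (cnj z) \<in> fst c" using that by auto
      show ?thesis
        using *[OF that(1) z] iso[OF that(1) z, of 1] pos[OF that(1) z(2)] DERIV_imp_deriv[OF *[OF that(1) z]]
        by (auto simp: field_differentiable_def)
    qed
    ultimately have "holomorphic_isometry A \<rho> X (cnj ` V) (\<phi> \<circ> cnj)"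
      by (simp add: holomorphic_isometry_def)
    then show ?thesis ..
  qed
qed

section \<open>The differential of a conformal density\<close>

text \<open>Twice the Wirtinger derivative \<open>\<partial>u/\<partial>z\<close>: the complex number representing the differential
  of a real function.\<close>

definition dz :: "(complex \<Rightarrow> real) \<Rightarrow> complex \<Rightarrow> complex" where
  "dz u z = Complex (dir_deriv 1 u z) (- dir_deriv \<i> u z)"

lemma dir_deriv_dz:
  assumes "u differentiable (at z)"
  shows "dir_deriv v u z = Re (dz u z * v)"
  unfolding dir_deriv_linear[OF assms, of v] by (simp add: dz_def)

lemma dz_eqI:
  assumes "(u has_derivative (\<lambda>v. Re (G * v))) (at z)"
  shows "dz u z = G"
  using dir_deriv_eq[OF assms] by (simp add: dz_def complex_eq_iff)

text \<open>The first order consequence of \<open>e\<^sup>u |dz|\<close> being the pullback of \<open>e\<^sup>U |dw|\<close>.\<close>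

lemma conformal_change:
  assumes S: "open S" "h holomorphic_on S" "z \<in> S" and h': "\<And>z. z \<in> S \<Longrightarrow> deriv h z \<noteq> 0"
    and U: "U differentiable (at (h z))"
    and eq: "\<And>z. z \<in> S \<Longrightarrow> U (h z) + ln (cmod (deriv h z)) = u z"
  shows "deriv (deriv h) z / deriv h z = dz u z - dz U (h z) * deriv h z"
proof -
  have h: "(h has_derivative (\<lambda>v. deriv h z * v)) (at z)"
    using holomorphic_derivI[OF S(2,1,3)] by (simp add: has_field_derivative_def)
  have 1: "((\<lambda>z. U (h z)) has_derivative (\<lambda>v. Re (dz U (h z) * (deriv h z * v)))) (at z)"
    using has_derivative_compose[OF h dir_deriv_has_derivative[OF U]] unfolding dir_deriv_dz[OF U] .
  have 2: "((\<lambda>z. ln (cmod (deriv h z))) has_derivative (\<lambda>v. Re (deriv (deriv h) z / deriv h z * v))) (at z)"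
    by (rule has_derivative_ln_cmod[OF holomorphic_derivI[OF holomorphic_deriv[OF S(2,1)] S(1,3)] h'[OF S(3)]])
  have "((\<lambda>z. U (h z) + ln (cmod (deriv h z))) has_derivative
     (\<lambda>v. Re ((dz U (h z) * deriv h z + deriv (deriv h) z / deriv h z) * v))) (at z)"
    using has_derivative_add[OF 1 2] by (simp add: algebra_simps)
  then have "(u has_derivative
     (\<lambda>v. Re ((dz U (h z) * deriv h z + deriv (deriv h) z / deriv h z) * v))) (at z)"
    by (rule has_derivative_transform_within_open[OF _ S(1,3) eq])
  then have "dz u z = dz U (h z) * deriv h z + deriv (deriv h) z / deriv h z" by (rule dz_eqI)
  then show ?thesis by simp
qed

lemma ln_cusp_density:
  assumes "z \<in> cusp_disc 1"
  shows "ln (cusp_density z) = - ln (cmod z) - ln (- ln (cmod z))"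
proof -
  have z: "cmod z > 0" and L: "- ln (cmod z) > 0" using assms by (auto simp: cusp_disc_def)
  have "cusp_density z = inverse (cmod z * (- ln (cmod z)))"
    by (simp add: cusp_density_def divide_simps)
  then have "ln (cusp_density z) = - ln (cmod z * (- ln (cmod z)))"
    by (simp only: ln_inverse)
  then show ?thesis using ln_mult[of "cmod z" "- ln (cmod z)"] z L by simp
qed

lemma has_derivative_ln_cusp_density:
  assumes "z \<in> cusp_disc 1"
  shows "((\<lambda>z. ln (cusp_density z)) has_derivative
    (\<lambda>v. Re (- (1 + 1 / of_real (ln (cmod z))) / z * v))) (at z)"
proof -
  have z: "z \<noteq> 0" and L: "ln (cmod z) < 0" using assms by (auto simp: cusp_disc_def)
  have 1: "((\<lambda>z. ln (cmod z)) has_derivative (\<lambda>v. Re (1 / z * v))) (at z)"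
    using has_derivative_ln_cmod[of "\<lambda>z. z" 1 z] z by simp
  have 2: "((\<lambda>z. ln (- ln (cmod z))) has_derivative (\<lambda>v. Re (1 / z * v) / ln (cmod z))) (at z)"
  proof -
    have "((\<lambda>x. ln (- x)) has_derivative (\<lambda>t. t / ln (cmod z))) (at (ln (cmod z)))"
      using L by (auto intro!: derivative_eq_intros simp: fun_eq_iff divide_simps)
    from has_derivative_compose[OF 1 this] show ?thesis .
  qed
  have "((\<lambda>z. - ln (cmod z) - ln (- ln (cmod z))) has_derivative
      (\<lambda>v. - Re (1 / z * v) - Re (1 / z * v) / ln (cmod z))) (at z)"
    by (intro has_derivative_diff has_derivative_minus 1 2)
  moreover have "- Re (1 / z * v) - Re (1 / z * v) / ln (cmod z)
      = Re (- (1 + 1 / of_real (ln (cmod z))) / z * v)" for v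
  proof -
    have "- (1 + 1 / of_real (ln (cmod z))) / z * v
        = - (1 / z * v) - (1 / ln (cmod z)) *\<^sub>R (1 / z * v)"
      using z L by (simp add: scaleR_conv_of_real field_simps)
    then have "Re (- (1 + 1 / of_real (ln (cmod z))) / z * v)
        = Re (- (1 / z * v) - (1 / ln (cmod z)) *\<^sub>R (1 / z * v))" by (rule arg_cong)
    then show ?thesis by simp
  qed
  ultimately have *: "((\<lambda>z. - ln (cmod z) - ln (- ln (cmod z))) has_derivative
      (\<lambda>v. Re (- (1 + 1 / of_real (ln (cmod z))) / z * v))) (at z)" by simp
  have "open (cusp_disc 1)"
    unfolding cusp_disc_def by (intro open_Collect_conj open_Collect_less continuous_intros)
  then show ?thesis
  proof (rule has_derivative_transform_within_open[OF * _ assms])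
  qed (rule ln_cusp_density[symmetric])
qed

section \<open>Rigidity of isometries near a horocycle\<close>

text \<open>In the coordinate \<open>log z\<close> the map \<open>\<psi>\<close> is a local isometry of the hyperbolic half plane,
  i.e. a Moebius map, with derivative \<open>\<eta>\<close> and \<open>g = \<eta>'/\<eta>\<close>. The isometry condition forces
  \<open>2 Re g = y |g|\<^sup>2 \<ge> 0\<close> with \<open>y = - ln |z|\<close>, so by the open mapping theorem \<open>g\<close> vanishes everywhere
  or nowhere. If nowhere, \<open>2/g\<close> is up to an additive constant a branch of \<open>- log z\<close>, which does not
  exist on an annulus. Hence \<open>\<psi>\<close> is a power map, and injectivity leaves only a rotation or its
  inverse.\<close>

lemma annulus_isometry_preserves_norm:
  assumes ab: "0 \<le> a" "a < b" "b \<le> 1" and S_def: "S = {z. a < cmod z \<and> cmod z < b}"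
    and hol: "\<psi> holomorphic_on S" and inj: "inj_on \<psi> S" and im: "\<psi> ` S \<subseteq> cusp_disc 1"
    and iso: "\<And>z. z \<in> S \<Longrightarrow> cusp_density (\<psi> z) * cmod (deriv \<psi> z) = cusp_density z"
    and z: "z \<in> S"
  shows "cmod (\<psi> z) = cmod z"
proof -
  have S: "open S" "connected S"
    using connected_annulus(1)[of a "0::complex" b]
    by (auto simp: S_def intro!: open_Collect_conj open_Collect_less continuous_intros)
  have Sd: "z \<in> cusp_disc 1" if "z \<in> S" for z
    using that ab by (auto simp: S_def cusp_disc_def)
  define \<rho> where "\<rho> = (a + b) / 2"
  have \<rho>0: "\<rho> > 0" "a < \<rho>" "\<rho> < b" using ab by (auto simp: \<rho>_def)
  then have \<rho>: "\<rho> > 0" "\<And>s. \<rho> * exp (\<i> * of_real s) \<in> S" by (auto simp: S_def norm_mult)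
  have nz: "z \<noteq> 0" "\<psi> z \<noteq> 0" "ln (cmod z) < 0" "ln (cmod (\<psi> z)) < 0" if "z \<in> S" for z
    using Sd[OF that] im that by (auto simp: cusp_disc_def)
  have d': "deriv \<psi> z \<noteq> 0" if "z \<in> S" for z
    using holomorphic_injective_imp_regular[OF hol S(1) inj that] .
  define \<eta> g where "\<eta> = (\<lambda>z. z * deriv \<psi> z / \<psi> z)" and "g = (\<lambda>z. z * deriv \<eta> z / \<eta> z)"
  have h': "deriv \<psi> holomorphic_on S" by (rule holomorphic_deriv[OF hol S(1)])
  have \<eta>: "\<eta> holomorphic_on S" "\<And>z. z \<in> S \<Longrightarrow> \<eta> z \<noteq> 0"
    unfolding \<eta>_def using nz d' by (auto intro!: holomorphic_intros hol h')
  have g: "g holomorphic_on S"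
    unfolding g_def using \<eta> S by (auto intro!: holomorphic_intros)
  have norm\<eta>: "cmod (\<eta> z) = ln (cmod (\<psi> z)) / ln (cmod z)" if "z \<in> S" for z
    using iso[OF that] nz[OF that] d'[OF that]
    by (simp add: \<eta>_def cusp_density_def norm_mult norm_divide divide_simps mult_ac)
  have geq: "g z = - 1 / of_real (ln (cmod z)) + \<eta> z / of_real (ln (cmod (\<psi> z)))" if z: "z \<in> S" for z
  proof -
    let ?L = "of_real (ln (cmod z)) :: complex" and ?M = "of_real (ln (cmod (\<psi> z))) :: complex"
    have c: "deriv (deriv \<psi>) z / deriv \<psi> z = dz (\<lambda>z. ln (cusp_density z)) z
        - dz (\<lambda>z. ln (cusp_density z)) (\<psi> z) * deriv \<psi> z"
    proof (rule conformal_change[OF S(1) hol z d'])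
      show "(\<lambda>z. ln (cusp_density z)) differentiable (at (\<psi> z))"
        using has_derivative_ln_cusp_density[of "\<psi> z"] im z by (auto simp: differentiable_def)
      fix w assume w: "w \<in> S"
      then have "\<psi> w \<in> cusp_disc 1" using im by auto
      then show "ln (cusp_density (\<psi> w)) + ln (cmod (deriv \<psi> w)) = ln (cusp_density w)"
        using iso[OF w] cusp_density_pos[of "\<psi> w"] d'[OF w]
          ln_mult[of "cusp_density (\<psi> w)" "cmod (deriv \<psi> w)"] by simp
    qed
    have c2: "deriv (deriv \<psi>) z / deriv \<psi> z
        = - (1 + 1 / ?L) / z + (1 + 1 / ?M) / \<psi> z * deriv \<psi> z"
    proof -
      have "\<psi> z \<in> cusp_disc 1" using im z by auto
      then show ?thesis
        unfolding c dz_eqI[OF has_derivative_ln_cusp_density[OF Sd[OF z]]]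
          dz_eqI[OF has_derivative_ln_cusp_density[OF \<open>\<psi> z \<in> cusp_disc 1\<close>]]
        by (simp add: algebra_simps add_divide_distrib diff_divide_distrib)
    qed
    have d\<eta>: "deriv \<eta> z = (deriv \<psi> z + z * deriv (deriv \<psi>) z) / \<psi> z - z * (deriv \<psi> z)\<^sup>2 / (\<psi> z)\<^sup>2"
    proof (rule DERIV_imp_deriv)
      show "(\<eta> has_field_derivative (deriv \<psi> z + z * deriv (deriv \<psi>) z) / \<psi> z
          - z * (deriv \<psi> z)\<^sup>2 / (\<psi> z)\<^sup>2) (at z)"
        unfolding \<eta>_def using nz[OF z]
        by (auto intro!: derivative_eq_intros holomorphic_derivI[OF hol S(1) z]
            holomorphic_derivI[OF h' S(1) z] simp: field_simps power2_eq_square)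
    qed
    have "g z = 1 + z * (deriv (deriv \<psi>) z / deriv \<psi> z) - z * deriv \<psi> z / \<psi> z"
      unfolding g_def d\<eta> unfolding \<eta>_def
      using nz[OF z] d'[OF z] by (simp add: field_simps power2_eq_square)
    then have e: "g z = 1 + z * (- (1 + 1 / ?L) / z + (1 + 1 / ?M) / \<psi> z * deriv \<psi> z) - z * deriv \<psi> z / \<psi> z"
      unfolding c2 .
    show ?thesis
      unfolding e \<eta>_def using nz[OF z] by (simp add: field_simps)
  qed
  have g2: "2 * Re (g z) = - ln (cmod z) * (cmod (g z))\<^sup>2" if "z \<in> S" for z
  proof -
    let ?L = "ln (cmod z)"
    have "cmod (g z + of_real (1 / ?L)) = - 1 / ?L"
      using norm\<eta>[OF that] nz[OF that] by (simp add: geq[OF that] norm_divide divide_simps)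
    then have "(cmod (g z + of_real (1 / ?L)))\<^sup>2 = (1 / ?L)\<^sup>2" by (simp add: power2_eq_square)
    then have "(cmod (g z))\<^sup>2 + 2 * Re (g z) / ?L = 0"
      unfolding cmod_power2 by (simp add: power2_eq_square algebra_simps)
    then show ?thesis using nz[OF that] by (simp add: field_simps)
  qed
  have "\<forall>z\<in>S. g z = 0"
  proof (rule ccontr)
    assume ne: "\<not> (\<forall>z\<in>S. g z = 0)"
    \<comment> \<open>As \<open>g\<close> is not constant, a zero would be an interior point of its image, which lies in \<open>Re w \<ge> 0\<close>.\<close>
    have g0: "g z \<noteq> 0" if z: "z \<in> S" for z
    proof
      assume "g z = 0"
      with ne z have "\<not> g constant_on S" by (metis constant_on_def)
      then have "open (g ` S)" using open_mapping_thm[OF g S S(1)] by blast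
      moreover have "0 \<in> g ` S" using \<open>g z = 0\<close> z by force
      ultimately obtain e where e: "e > 0" "ball 0 e \<subseteq> g ` S" by (auto simp: open_contains_ball)
      then have "- of_real (e / 2) \<in> g ` S" by (auto simp: subset_iff)
      then obtain w where w: "w \<in> S" "g w = - of_real (e / 2)" by auto
      have "Re (g w) \<ge> 0" using g2[OF w(1)] nz[OF w(1)]
        by (smt (verit) mult_nonneg_nonneg zero_le_power2)
      then show False using w(2) e(1) by simp
    qed
    \<comment> \<open>The function \<open>E\<close> has modulus \<open>1\<close>, so it is constant and \<open>- 2 q\<close> is a logarithm of \<open>z\<close> up to a constant.\<close>
    define q E where "q = (\<lambda>z. 1 / g z)" and "E = (\<lambda>z. z * exp (2 * q z))"
    have q: "q holomorphic_on S" unfolding q_def using g0 by (auto intro!: holomorphic_intros g)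
    have E: "E holomorphic_on S" unfolding E_def by (intro holomorphic_intros q)
    have "Re (q z) = - ln (cmod z) / 2" if "z \<in> S" for z
      using g2[OF that] g0[OF that] by (simp add: q_def Re_divide flip: cmod_power2) (simp add: field_simps)
    then have E1: "cmod (E z) = 1" if "z \<in> S" for z
      using that nz[OF that] by (simp add: E_def norm_mult exp_minus)
    have "E constant_on S"
    proof (rule ccontr)
      assume "\<not> E constant_on S"
      then have "open (E ` S)" using open_mapping_thm[OF E S S(1)] by blast
      moreover have "E z \<in> E ` S" using z by blast
      ultimately obtain e where e: "e > 0" "ball (E z) e \<subseteq> E ` S" by (meson open_contains_ball)
      have "(1 + of_real (e / 2)) * E z \<in> ball (E z) e"
        using e(1) E1[OF z] by (simp add: dist_norm algebra_simps norm_mult)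
      then obtain w where "w \<in> S" "E w = (1 + of_real (e / 2)) * E z" using e(2) by auto
      then have "cmod (1 + of_real (e / 2)) * cmod (E z) = cmod (E w)" by (simp only: norm_mult)
      then have "cmod (of_real (1 + e / 2)) = 1" using E1[OF z] E1[OF \<open>w \<in> S\<close>] by simp
      then show False using e(1) unfolding norm_of_real by simp
    qed
    then obtain k where k: "\<And>z. z \<in> S \<Longrightarrow> E z = k" by (auto simp: constant_on_def)
    have dq: "(q has_field_derivative - 1 / (2 * z)) (at z)" if z: "z \<in> S" for z
    proof -
      have D: "(q has_field_derivative deriv q z) (at z)" by (rule holomorphic_derivI[OF q S(1) z])
      have "(E has_field_derivative exp (2 * q z) + z * (exp (2 * q z) * (2 * deriv q z))) (at z)"
        unfolding E_def by (auto intro!: derivative_eq_intros D)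
      moreover have "(E has_field_derivative 0) (at z)"
        by (rule has_field_derivative_transform_within_open[OF DERIV_const S(1) z]) (simp add: k)
      ultimately have "exp (2 * q z) + z * (exp (2 * q z) * (2 * deriv q z)) = 0"
        by (rule DERIV_unique)
      then have "exp (2 * q z) * (1 + 2 * z * deriv q z) = 0" by (simp add: algebra_simps)
      then have "1 + 2 * z * deriv q z = 0" by simp
      then have "deriv q z = - 1 / (2 * z)"
        using nz[OF z] by (simp add: field_simps add_eq_0_iff)
      then show ?thesis using D by simp
    qed
    have im: "path_image (circlepath 0 \<rho>) \<subseteq> S" using \<rho>0 by (auto simp: S_def)
    have "((\<lambda>z. - 1 / (2 * z)) has_contour_integral 0) (circlepath 0 \<rho>)"
      by (rule Cauchy_theorem_primitive[OF has_field_derivative_at_within[OF dq] _ im]) auto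
    then have "contour_integral (circlepath 0 \<rho>) (\<lambda>z. (- 1 / 2) * (1 / (z - 0))) = 0"
      using contour_integral_unique by (simp add: divide_simps)
    moreover have "contour_integral (circlepath 0 \<rho>) (\<lambda>z. (- 1 / 2) * (1 / (z - 0)))
        = (- 1 / 2) * (2 * of_real pi * \<i>)"
      using \<rho>(1) by (subst contour_integral_lmul)
        (auto intro!: contour_integrable_holomorphic_simple[of _ "- {0}"] holomorphic_intros
          simp: contour_integral_circlepath[of \<rho> 0, simplified])
    ultimately show False by simp
  qed
  then have "deriv \<eta> z = 0" if "z \<in> S" for z
    using that nz[OF that] \<eta>(2)[OF that] by (auto simp: g_def)
  then have "\<forall>z\<in>S - {}. (\<eta> has_field_derivative 0) (at z)"
    using holomorphic_derivI[OF \<eta>(1) S(1)] by fastforce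
  then obtain c where c: "\<And>z. z \<in> S \<Longrightarrow> \<eta> z = c"
    using DERIV_zero_connected_constant[OF S(2,1) finite.emptyI holomorphic_on_imp_continuous_on[OF \<eta>(1)]]
    by blast
  \<comment> \<open>Since \<open>z \<psi>' = c \<psi>\<close>, going around the circle multiplies \<open>\<psi>\<close> by \<open>exp (2 \<pi> \<i> c)\<close>; so \<open>c\<close> is an integer.\<close>
  define F where "F = (\<lambda>s::complex. \<psi> (\<rho> * exp (\<i> * s)) * exp (- \<i> * c * s))"
  have "F (of_real s) = F 0" for s
  proof -
    have "((\<lambda>s. F (of_real s)) has_vector_derivative 0) (at s within UNIV)" for s
    proof -
      let ?w = "\<rho> * exp (\<i> * of_real s)"
      have "deriv \<psi> ?w * ?w = c * \<psi> ?w"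
        using c[OF \<rho>(2)[of s]] nz[OF \<rho>(2)[of s]] by (simp add: \<eta>_def field_simps)
      then have *: "exp (- \<i> * c * s) * (deriv \<psi> ?w * ?w * \<i>) - \<i> * c * exp (- \<i> * c * s) * \<psi> ?w = 0"
        by simp
      have "(\<psi> has_field_derivative deriv \<psi> ?w) (at ?w)"
        by (rule holomorphic_derivI[OF hol S(1) \<rho>(2)])
      moreover have "((\<lambda>s. \<rho> * exp (\<i> * s)) has_field_derivative \<rho> * (exp (\<i> * of_real s) * \<i>)) (at (of_real s))"
        by (auto intro!: derivative_eq_intros)
      ultimately have D: "((\<lambda>s. \<psi> (\<rho> * exp (\<i> * s))) has_field_derivative
          deriv \<psi> ?w * (\<rho> * (exp (\<i> * of_real s) * \<i>))) (at (of_real s))"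
        by (rule DERIV_chain2)
      have "(F has_field_derivative deriv \<psi> ?w * (\<rho> * (exp (\<i> * of_real s) * \<i>)) * exp (- \<i> * c * s)
          + exp (- \<i> * c * s) * (- \<i> * c) * \<psi> ?w) (at (of_real s))"
        unfolding F_def by (rule DERIV_mult[OF D]) (auto intro!: derivative_eq_intros)
      moreover have "deriv \<psi> ?w * (\<rho> * (exp (\<i> * of_real s) * \<i>)) * exp (- \<i> * c * s)
          + exp (- \<i> * c * s) * (- \<i> * c) * \<psi> ?w
          = exp (- \<i> * c * s) * (deriv \<psi> ?w * ?w * \<i>) - \<i> * c * exp (- \<i> * c * s) * \<psi> ?w"
        by (simp add: algebra_simps)
      ultimately have "(F has_field_derivative 0) (at (of_real s))" by (simp only: *)
      then show ?thesis using has_vector_derivative_real_field by fastforce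
    qed
    then obtain k where "\<And>s. F (of_real s) = k"
      using has_vector_derivative_zero_constant[of UNIV "\<lambda>s. F (of_real s)"] by auto
    from this[of s] this[of 0] show ?thesis by simp
  qed
  then have per: "\<psi> (\<rho> * exp (\<i> * of_real s)) = \<psi> \<rho> * exp (\<i> * c * s)" for s :: real
    by (simp add: F_def exp_minus field_simps)
  have \<rho>S: "of_real \<rho> \<in> S" using \<rho>(2)[of 0] by simp
  have "exp (\<i> * c * of_real (2 * pi)) = 1"
    using per[of "2 * pi"] nz(2)[OF \<rho>S] by (simp add: exp_eq_1[THEN iffD2])
  then obtain n :: int where n: "Im (\<i> * c * of_real (2 * pi)) = of_int (2 * n) * pi"
      "Re (\<i> * c * of_real (2 * pi)) = 0"
    unfolding exp_eq_1 by blast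
  then have cn: "c = of_int n" by (simp add: complex_eq_iff)
  have "n \<noteq> 0" using cn c[OF z] \<eta>(2)[OF z] by auto
  have "\<bar>n\<bar> = 1"
  proof (rule ccontr)
    assume "\<bar>n\<bar> \<noteq> 1"
    then have n2: "\<bar>n\<bar> \<ge> 2" using \<open>n \<noteq> 0\<close> by simp
    define s where "s = 2 * pi / n"
    have "exp (\<i> * c * of_real s) = 1"
      using \<open>n \<noteq> 0\<close> by (simp add: cn s_def exp_eq_1)
    then have "\<psi> (\<rho> * exp (\<i> * of_real s)) = \<psi> \<rho>" using per[of s] by simp
    then have "\<rho> * exp (\<i> * of_real s) = \<rho>" using inj \<rho>(2)[of s] \<rho>S by (auto dest: inj_onD)
    then have "exp (\<i> * of_real s) = 1" using \<rho>(1) by simp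
    then obtain m :: int where "s = of_int (2 * m) * pi" unfolding exp_eq_1 by auto
    then have "2 * pi = (2 * pi) * (of_int m * of_int n)" using \<open>n \<noteq> 0\<close> by (simp add: s_def field_simps)
    then have "of_int m * of_int n = (1::real)" by simp
    then have "m * n = 1" by (metis of_int_eq_1_iff of_int_mult)
    then show False using n2 by (auto simp: zmult_eq_1_iff)
  qed
  then have "cmod c = 1" unfolding cn by simp
  then have "ln (cmod (\<psi> z)) = ln (cmod z)"
    using norm\<eta>[OF z] c[OF z] nz[OF z] by (simp add: field_simps)
  then show ?thesis using nz[OF z] by simp
qed

section \<open>A boundary point lemma\<close>

lemma ln_norm_C_infinity_harmonic:
  assumes "0 \<notin> S" "open S"
  shows "C_infinity_on S (\<lambda>z. ln (cmod z))" "z \<in> S \<Longrightarrow> laplacian (\<lambda>z. ln (cmod z)) z = 0"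
  using C_infinity_on_ln_cmod[OF assms(2) holomorphic_on_ident]
    laplacian_ln_cmod[OF assms(2) holomorphic_on_ident] assms(1) by blast+

text \<open>Hopf's lemma on a disc: a strictly subharmonic function stays below its constant boundary
  value by at least a multiple of the distance to the boundary. The logarithm is the barrier.\<close>

lemma subharmonic_boundary_point:
  fixes W :: "complex \<Rightarrow> real"
  assumes r: "r > 0" and W: "C_k_on 2 (ball 0 r) W"
    and lap: "\<And>z. z \<in> ball 0 r \<Longrightarrow> laplacian W z > 0"
    and bd: "\<And>e. e > 0 \<Longrightarrow> \<exists>s<r. \<forall>z. s < cmod z \<and> cmod z < r \<longrightarrow> \<bar>W z - C\<bar> < e"
  obtains e where "e > 0" "\<And>z. r / 2 \<le> cmod z \<Longrightarrow> cmod z < r \<Longrightarrow> W z \<le> C + e * ln (cmod z / r)"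
proof -
  define V where "V = (\<lambda>z. if cmod z < r then W z else C)"
  have contW: "continuous_on (ball 0 r) W"
    using C_k_on_Suc_imp[of 1 _ W] C_k_on_Suc_imp[of 0 _ W] W by (simp add: numeral_2_eq_2)
  have contV: "continuous_on (cball 0 r) V"
    unfolding continuous_on_iff
  proof (intro ballI allI impI)
    fix x :: complex and e :: real assume x: "x \<in> cball 0 r" and e: "e > 0"
    show "\<exists>d>0. \<forall>y\<in>cball 0 r. dist y x < d \<longrightarrow> dist (V y) (V x) < e"
    proof (cases "cmod x < r")
      case True
      then obtain d where d: "d > 0" "\<And>y. y \<in> ball 0 r \<Longrightarrow> dist y x < d \<Longrightarrow> dist (W y) (W x) < e"
        using contW e unfolding continuous_on_iff by (metis mem_ball_0)
      show ?thesis
      proof (intro exI conjI ballI impI)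
        show "min d (r - cmod x) > 0" using d True by simp
        fix y assume "dist y x < min d (r - cmod x)"
        moreover have "cmod y \<le> cmod x + dist y x" by (metis dist_norm norm_triangle_sub)
        ultimately show "dist (V y) (V x) < e" using d(2)[of y] True by (simp add: V_def)
      qed
    next
      case False
      then have xr: "cmod x = r" using x by simp
      obtain s where s: "s < r" "\<And>z. s < cmod z \<Longrightarrow> cmod z < r \<Longrightarrow> \<bar>W z - C\<bar> < e"
        using bd[OF e] by blast
      show ?thesis
      proof (intro exI conjI ballI impI)
        show "r - s > 0" using s by simp
        fix y assume "dist y x < r - s"
        moreover have "cmod x \<le> cmod y + dist y x" by (metis dist_commute dist_norm norm_triangle_sub)
        ultimately have "cmod y > s" using xr by simp
        then show "dist (V y) (V x) < e" using s(2)[of y] e xr by (auto simp: V_def dist_real_def)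
      qed
    qed
  qed
  have nomax: False if "cmod z0 < r" "\<And>z. cmod z < r \<Longrightarrow> W z \<le> W z0" for z0
    using local_max_laplacian_nonpos[OF open_ball W, of z0] lap[of z0] that by auto
  have "\<exists>x\<in>cball 0 r. \<forall>y\<in>cball 0 r. V y \<le> V x"
    using contV r by (intro continuous_attains_sup) auto
  then obtain z0 where z0: "cmod z0 \<le> r" "\<And>y. cmod y \<le> r \<Longrightarrow> V y \<le> V z0" by auto
  have WC: "W z < C" if z: "cmod z < r" for z
  proof (rule ccontr)
    assume ge: "\<not> W z < C"
    have le: "W y \<le> V z0" if "cmod y < r" for y using z0(2)[of y] that by (simp add: V_def)
    show False
    proof (cases "cmod z0 < r")
      case True
      then show False using nomax[OF True] le by (simp add: V_def)
    next
      case False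
      then have "W y \<le> W z" if "cmod y < r" for y using le[OF that] ge by (simp add: V_def)
      then show False using nomax[OF z] by blast
    qed
  qed
  have "\<exists>x\<in>sphere (0::complex) (r/2). \<forall>y\<in>sphere 0 (r/2). W y \<le> W x"
  proof (rule continuous_attains_sup)
    show "continuous_on (sphere 0 (r/2)) W" using contW r by (rule_tac continuous_on_subset) auto
  qed (use r in auto)
  then obtain x1 where x1: "cmod x1 = r/2" "\<And>y. cmod y = r/2 \<Longrightarrow> W y \<le> W x1" by auto
  \<comment> \<open>With this constant \<open>W\<close> is at most \<open>C + e ln (|z| / r)\<close> on the circle of radius \<open>r / 2\<close>.\<close>
  define e where "e = (C - W x1) / ln 2"
  have e: "e > 0" using WC[of x1] x1 r by (simp add: e_def)
  define K where "K = {z. r / 2 \<le> cmod z \<and> cmod z \<le> r}"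
  have "compact K"
    unfolding K_def compact_eq_bounded_closed
    by (auto intro!: closed_Collect_conj closed_Collect_le continuous_intros boundedI)
  moreover have "K \<noteq> {}" using r by (auto simp: K_def intro!: exI[of _ "of_real r"])
  moreover have "continuous_on K (\<lambda>z. V z - e * ln (cmod z))"
  proof (intro continuous_intros)
    show "continuous_on K V" using contV by (rule continuous_on_subset) (auto simp: K_def)
  qed (use r in \<open>auto simp: K_def\<close>)
  ultimately have "\<exists>x\<in>K. \<forall>y\<in>K. V y - e * ln (cmod y) \<le> V x - e * ln (cmod x)"
    by (rule continuous_attains_sup)
  then obtain y0 where y0: "y0 \<in> K"
      "\<And>z. z \<in> K \<Longrightarrow> V z - e * ln (cmod z) \<le> V y0 - e * ln (cmod y0)"
    by blast
  \<comment> \<open>In the interior of the annulus \<open>W - e ln |z|\<close> is strictly subharmonic, so it has no maximum there.\<close>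
  have "V y0 - e * ln (cmod y0) \<le> C - e * ln r"
  proof -
    consider "cmod y0 = r" | "cmod y0 = r/2" | "r/2 < cmod y0" "cmod y0 < r"
      using y0(1) by (force simp: K_def)
    then show ?thesis
    proof cases
      case 2
      then have "V y0 \<le> W x1" using x1 r by (simp add: V_def)
      also have "W x1 = C - e * ln 2" by (simp add: e_def)
      finally have "V y0 \<le> C - e * ln 2" .
      moreover have "e * ln (cmod y0) = e * ln r - e * ln 2"
        unfolding 2 using r by (simp add: ln_div right_diff_distrib)
      ultimately show ?thesis by simp
    next
      case 3
      define S where "S = {z. r / 2 < cmod z \<and> cmod z < r}"
      have S: "open S" "0 \<notin> S" "y0 \<in> S" "S \<subseteq> ball 0 r"
        using 3 r by (auto simp: S_def intro!: open_Collect_conj open_Collect_less continuous_intros)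
      note l = ln_norm_C_infinity_harmonic[OF S(2,1)]
      have l2: "C_k_on 2 S (\<lambda>z. (- e) * ln (cmod z))"
        by (intro C_k_on_bilinear[OF S(1) bounded_bilinear_mult] C_k_on_const C_infinity_on_C_2 l)
      have W2: "C_k_on 2 S W" using W S(4) by (rule C_k_on_subset)
      have "laplacian (\<lambda>z. W z + (- e) * ln (cmod z)) y0 = laplacian W y0"
        using laplacian_add[OF S(1) W2 l2 S(3)] laplacian_cmult[OF S(1) C_infinity_on_C_2[OF l(1)] S(3), of "- e"]
          l(2)[OF S(3)] by simp
      moreover have "laplacian (\<lambda>z. W z + (- e) * ln (cmod z)) y0 \<le> 0"
      proof (rule local_max_laplacian_nonpos[OF S(1) C_k_on_add[OF S(1) W2 l2] S(3)])
        fix w assume "w \<in> S"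
        then show "W w + (- e) * ln (cmod w) \<le> W y0 + (- e) * ln (cmod y0)"
          using y0(2)[of w] S(3) by (auto simp: S_def K_def V_def)
      qed
      ultimately show ?thesis using lap[of y0] 3 by simp
    qed (simp add: V_def)
  qed
  then have *: "V z - e * ln (cmod z) \<le> C - e * ln r" if "z \<in> K" for z using y0(2)[OF that] by simp
  show ?thesis
  proof (rule that[OF e])
    fix z assume z: "r / 2 \<le> cmod z" "cmod z < r"
    then have "z \<in> K" "cmod z > 0" using r by (auto simp: K_def)
    then have "W z - e * ln (cmod z) \<le> C - e * ln r" using *[of z] z by (simp add: V_def)
    moreover have "e * ln (cmod z / r) = e * ln (cmod z) - e * ln r"
      using \<open>cmod z > 0\<close> r by (simp add: ln_div right_diff_distrib)
    ultimately show "W z \<le> C + e * ln (cmod z / r)" by simp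
  qed
qed

section \<open>Radial metrics capping off a cusp\<close>

text \<open>The functions \<open>flat p\<close>, among them the familiar \<open>exp (- 1 / x)\<close> extended by \<open>0\<close>, form a class that
  is closed under differentiation; this gives their smoothness.\<close>

definition flat :: "real poly \<Rightarrow> real \<Rightarrow> real" where
  "flat p x = (if x > 0 then poly p (1 / x) * exp (- (1 / x)) else 0)"

lemma poly_exp_tendsto_0: "((\<lambda>y. y ^ k * poly p y * exp (- y)) \<longlongrightarrow> (0::real)) at_top"
proof (induction p arbitrary: k)
  case (pCons a p)
  have "((\<lambda>y. a * (y ^ k / exp y) + y ^ Suc k * poly p y * exp (- y)) \<longlongrightarrow> a * 0 + 0) at_top"
    by (intro tendsto_intros tendsto_power_div_exp_0 pCons.IH)
  then show ?case by (simp add: exp_minus divide_inverse algebra_simps)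
qed simp

lemma DERIV_flat:
  "(flat p has_real_derivative flat (pCons 0 (pCons 0 (p - pderiv p))) x) (at x)"
proof -
  consider "x > 0" | "x < 0" | "x = 0" by linarith
  then show ?thesis
  proof cases
    case 1
    have D: "((\<lambda>x. 1 / x) has_real_derivative - (1 / x\<^sup>2)) (at x)"
      using 1 by (auto intro!: derivative_eq_intros simp: power2_eq_square)
    have "((\<lambda>x. poly p (1 / x)) has_real_derivative poly (pderiv p) (1 / x) * - (1 / x\<^sup>2)) (at x)"
      by (rule DERIV_chain2[OF poly_DERIV D])
    moreover have "((\<lambda>x. exp (- (1 / x))) has_real_derivative exp (- (1 / x)) * (1 / x\<^sup>2)) (at x)"
      using DERIV_chain2[OF DERIV_exp DERIV_minus[OF D]] by simp
    ultimately have "((\<lambda>x. poly p (1 / x) * exp (- (1 / x))) has_real_derivative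
        poly (pderiv p) (1 / x) * - (1 / x\<^sup>2) * exp (- (1 / x)) +
        exp (- (1 / x)) * (1 / x\<^sup>2) * poly p (1 / x)) (at x)"
      by (rule DERIV_mult)
    then have "(flat p has_real_derivative
        poly (pderiv p) (1 / x) * - (1 / x\<^sup>2) * exp (- (1 / x)) +
        exp (- (1 / x)) * (1 / x\<^sup>2) * poly p (1 / x)) (at x)"
      by (rule has_field_derivative_transform_within_open[of _ _ _ "{0<..}"]) (use 1 in \<open>auto simp: flat_def\<close>)
    then show ?thesis using 1 by (simp add: flat_def power2_eq_square algebra_simps)
  next
    case 2
    have "(flat p has_real_derivative 0) (at x)"
      by (rule has_field_derivative_transform_within_open[OF DERIV_const[of 0], of "{..<0}"])
         (use 2 in \<open>auto simp: flat_def\<close>)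
    then show ?thesis using 2 by (simp add: flat_def)
  next
    case 3
    have "((\<lambda>h. (flat p (0 + h) - flat p 0) / h) \<longlongrightarrow> 0) (at 0)"
    proof (rule filterlim_split_at)
      show "((\<lambda>h. (flat p (0 + h) - flat p 0) / h) \<longlongrightarrow> 0) (at_left 0)"
        by (rule tendsto_eventually) (auto simp: eventually_at_filter flat_def)
      have "((\<lambda>h. (\<lambda>y. y ^ 1 * poly p y * exp (- y)) (inverse h)) \<longlongrightarrow> 0) (at_right 0)"
        by (rule filterlim_compose[OF poly_exp_tendsto_0 filterlim_inverse_at_top_right])
      then show "((\<lambda>h. (flat p (0 + h) - flat p 0) / h) \<longlongrightarrow> 0) (at_right 0)"
        by (rule Lim_transform_eventually)
           (auto simp: eventually_at_filter flat_def divide_inverse mult_ac)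
    qed
    then show ?thesis using 3 by (simp add: has_field_derivative_iff flat_def)
  qed
qed

lemma C_infinity_on_flat:
  assumes "open S" "C_infinity_on S g"
  shows "C_infinity_on S (\<lambda>z. flat p (g z))"
  by (rule C_infinity_on_compose_real[of S g UNIV "flat p" "range flat"])
     (use assms DERIV_flat in auto)

lemma laplacian_compose_real:
  fixes g :: "complex \<Rightarrow> real"
  assumes S: "open S" "C_k_on 2 S g" "z \<in> S"
    and F: "\<And>z. z \<in> S \<Longrightarrow> (F has_real_derivative F1 (g z)) (at (g z))"
    and F1: "(F1 has_real_derivative F2) (at (g z))"
  shows "laplacian (\<lambda>z. F (g z)) z
    = F2 * ((dir_deriv 1 g z)\<^sup>2 + (dir_deriv \<i> g z)\<^sup>2) + F1 (g z) * laplacian g z"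
proof -
  have *: "dir_deriv v (dir_deriv v (\<lambda>z. F (g z))) z
      = F2 * (dir_deriv v g z)\<^sup>2 + F1 (g z) * dir_deriv v (dir_deriv v g) z" if v: "v = 1 \<or> v = \<i>" for v
  proof -
    have 1: "dir_deriv v (\<lambda>z. F (g z)) w = F1 (g w) * dir_deriv v g w" if "w \<in> S" for w
      using has_derivative_compose[OF dir_deriv_has_derivative[OF C_2_differentiable(1)[OF S(2) that]]
          F[OF that, unfolded has_field_derivative_def]] by (rule dir_deriv_eq)
    have "dir_deriv v (dir_deriv v (\<lambda>z. F (g z))) z = dir_deriv v (\<lambda>w. F1 (g w) * dir_deriv v g w) z"
      by (rule dir_deriv_cong_open[OF S(1,3) 1])
    also have "\<dots> = F1 (g z) * dir_deriv v (dir_deriv v g) z + F2 * dir_deriv v g z * dir_deriv v g z"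
      using has_derivative_compose[OF dir_deriv_has_derivative[OF C_2_differentiable(1)[OF S(2,3)]]
          F1[unfolded has_field_derivative_def]]
      by (intro dir_deriv_eq has_derivative_mult dir_deriv_has_derivative C_2_differentiable(2)[OF S(2,3) v])
         (simp add: mult_ac)
    finally show ?thesis by (simp add: power2_eq_square algebra_simps)
  qed
  show ?thesis unfolding laplacian_def *[of 1, simplified] *[of \<i>, simplified] by (simp add: algebra_simps)
qed

lemma smooth_step:
  fixes a b :: real
  assumes "a < b"
  obtains h h' :: "real \<Rightarrow> real" where
    "\<And>t. (h has_real_derivative h' t) (at t)"
    "\<And>t. h t \<ge> 0" "\<And>t. h t \<le> 1" "\<And>t. h' t \<ge> 0"
    "\<And>t. t \<le> a \<Longrightarrow> h t = 0" "\<And>t. t \<le> a \<Longrightarrow> h' t = 0" "\<And>t. t \<ge> b \<Longrightarrow> h t = 1"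
    "\<And>S g. open S \<Longrightarrow> C_infinity_on S g \<Longrightarrow> C_infinity_on S (\<lambda>z. h (g z))"
proof -
  define f f' where "f = flat 1" and "f' = flat [:0, 0, 1:]"
  have Df: "(f has_real_derivative f' x) (at x)" for x
    using DERIV_flat[of 1 x] by (simp add: f_def f'_def one_pCons)
  have f: "f x \<ge> 0" "f' x \<ge> 0" "x \<le> 0 \<Longrightarrow> f x = 0" "x \<le> 0 \<Longrightarrow> f' x = 0" "x > 0 \<Longrightarrow> f x > 0" for x
    by (auto simp: f_def f'_def flat_def)
  define den where "den = (\<lambda>t. f (t - a) + f (b - t))"
  have den: "den t > 0" for t
    using f(1)[of "t - a"] f(1)[of "b - t"] f(5)[of "t - a"] f(5)[of "b - t"] assms
    by (cases "t > a") (auto simp: den_def)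
  define h where "h = (\<lambda>t. f (t - a) / den t)"
  define h' where "h' = (\<lambda>t. (f' (t - a) * f (b - t) + f (t - a) * f' (b - t)) / (den t)\<^sup>2)"
  show ?thesis
  proof
    fix t
    have 1: "((\<lambda>t. f (t - a)) has_real_derivative f' (t - a)) (at t)"
    proof -
      have "((\<lambda>t. t - a) has_real_derivative 1) (at t)" by (auto intro!: derivative_eq_intros)
      from DERIV_chain2[where f = f, OF Df this] show ?thesis by simp
    qed
    have 2: "((\<lambda>t. f (b - t)) has_real_derivative - f' (b - t)) (at t)"
    proof -
      have "((\<lambda>t. b - t) has_real_derivative - 1) (at t)" by (auto intro!: derivative_eq_intros)
      from DERIV_chain2[where f = f, OF Df this] show ?thesis by simp
    qed
    have dd: "(den has_real_derivative f' (t - a) + - f' (b - t)) (at t)"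
      unfolding den_def by (rule DERIV_add[OF 1 2])
    have "(h has_real_derivative (f' (t - a) * den t - f (t - a) * (f' (t - a) + - f' (b - t))) / (den t * den t)) (at t)"
      unfolding h_def using den[of t] by (intro DERIV_divide[OF 1 dd]) simp
    then show "(h has_real_derivative h' t) (at t)"
      by (simp add: h'_def den_def power2_eq_square algebra_simps)
    show "h t \<ge> 0" using f(1) den[of t] by (simp add: h_def)
    show "h t \<le> 1" using f(1)[of "b - t"] den[of t] by (simp add: h_def) (simp add: den_def)
    show "h' t \<ge> 0" using f(1,2) by (simp add: h'_def)
    show "h t = 0" "h' t = 0" if "t \<le> a" using f(3,4)[of "t - a"] that by (auto simp: h_def h'_def)
    show "h t = 1" if "t \<ge> b" using f(3)[of "b - t"] that den[of t] by (auto simp: h_def den_def)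
  next
    fix S and g :: "complex \<Rightarrow> real" assume S: "open S" and g: "C_infinity_on S g"
    have c: "C_infinity_on S (\<lambda>z. f (g z - a))" "C_infinity_on S (\<lambda>z. f (b - g z))"
      unfolding f_def by (intro C_infinity_on_flat C_infinity_on_diff S g C_infinity_on_const)+
    have "C_infinity_on S (\<lambda>z. f (g z - a) * inverse (den (g z)))"
      unfolding den_def
      by (intro C_infinity_on_mult C_infinity_on_inverse C_infinity_on_add S c)
         (metis den den_def less_irrefl)
    then show "C_infinity_on S (\<lambda>z. h (g z))" by (simp add: h_def divide_inverse)
  qed
qed

text \<open>Smoothness of \<open>q\<close> is assumed only through composition with \<open>g\<close>, which is how it is known for
  functions built from a smooth step.\<close>

lemma C_infinity_on_antiderivative:
  fixes g :: "complex \<Rightarrow> real"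
  assumes "open S" "C_infinity_on S g" "C_infinity_on S (\<lambda>z. q (g z))"
    and "\<And>z. z \<in> S \<Longrightarrow> (U has_real_derivative q (g z)) (at (g z))"
  shows "C_infinity_on S (\<lambda>z. U (g z))"
  unfolding C_infinity_on_def
proof
  fix k
  have diff: "g differentiable (at z)" if "z \<in> S" for z
    using assms(2) that C_2_differentiable(1) C_infinity_on_C_2 by blast
  have *: "((\<lambda>z. U (g z)) has_derivative (\<lambda>v. q (g z) * dir_deriv v g z)) (at z)" if "z \<in> S" for z
    using has_derivative_compose[OF dir_deriv_has_derivative[OF diff[OF that]]
        assms(4)[OF that, unfolded has_field_derivative_def]] .
  show "C_k_on k S (\<lambda>z. U (g z))"
  proof (cases k)
    case 0
    have "continuous_on S (\<lambda>z. U (g z))"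
      using has_derivative_continuous[OF *] by (intro continuous_at_imp_continuous_on) blast
    then show ?thesis using 0 by simp
  next
    case (Suc m)
    have "C_k_on m S (dir_deriv v (\<lambda>z. U (g z))) = C_k_on m S (\<lambda>z. q (g z) * dir_deriv v g z)" for v
      by (intro C_k_on_cong[OF assms(1)] dir_deriv_eq *)
    moreover have "C_k_on m S (\<lambda>z. q (g z) * dir_deriv v g z)" if "v = 1 \<or> v = \<i>" for v
    proof (rule C_k_on_bilinear[OF assms(1) bounded_bilinear_mult])
      show "C_k_on m S (\<lambda>z. q (g z))" using assms(3) by (simp add: C_infinity_on_def)
      have "C_k_on (Suc m) S g" using assms(2) unfolding C_infinity_on_def by blast
      then show "C_k_on m S (dir_deriv v g)" using that by auto
    qed
    ultimately show ?thesis using * by (auto simp: Suc differentiable_def)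
  qed
qed

lemma norm_squared_C_infinity_laplacian:
  assumes "open S"
  shows "C_infinity_on S (\<lambda>z. c + k * (cmod z)\<^sup>2)"
    and "z \<in> S \<Longrightarrow> laplacian (\<lambda>z. c + k * (cmod z)\<^sup>2) z = 4 * k"
proof -
  have id: "C_infinity_on S (\<lambda>z. z)" by (rule C_infinity_on_holomorphic[OF assms holomorphic_on_ident])
  show "C_infinity_on S (\<lambda>z. c + k * (cmod z)\<^sup>2)"
    unfolding cmod_power2 unfolding power2_eq_square
    by (intro C_infinity_on_add C_infinity_on_mult assms C_infinity_on_const
        C_infinity_on_linear[OF assms bounded_linear_Re id] C_infinity_on_linear[OF assms bounded_linear_Im id])
  have 1: "dir_deriv v (\<lambda>z. c + k * (cmod z)\<^sup>2) = (\<lambda>z. 2 * k * (Re z * Re v + Im z * Im v))" for v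
    unfolding cmod_power2
    by (rule ext, rule dir_deriv_eq) (auto intro!: derivative_eq_intros simp: algebra_simps)
  have "dir_deriv v (\<lambda>z. 2 * k * (Re z * Re v + Im z * Im v)) z = 2 * k * (Re v * Re v + Im v * Im v)" for v z
    by (rule dir_deriv_eq) (auto intro!: derivative_eq_intros simp: algebra_simps)
  note 2 = this
  show "laplacian (\<lambda>z. c + k * (cmod z)\<^sup>2) z = 4 * k" unfolding laplacian_def 1 2 by simp
qed

text \<open>Written as \<open>e\<^sup>v |dz/z|\<close> with \<open>v\<close> a function of \<open>t = ln |z|\<close>, a radial metric is negatively curved
  iff \<open>v'' > 0\<close>. It extends smoothly over \<open>0\<close> if \<open>v' = 1 + k e\<^sup>2\<^sup>t\<close> near \<open>- \<infinity>\<close>, and the cusp has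
  \<open>v' = - 1/t\<close>, which exceeds \<open>1\<close> exactly when \<open>t > - 1\<close>. So beyond the circle of radius \<open>1/e\<close>
  there is room for interpolating monotonically between the two; \<open>q\<close> below is \<open>v' - 1\<close>.\<close>

lemma cusp_cap:
  assumes "exp (- 1) < r" "r < 1"
  obtains u s where "0 < s" "s < r" "C_infinity_on (ball 0 r) u"
    "\<And>z. z \<in> ball 0 r \<Longrightarrow> laplacian u z > 0"
    "\<And>z. s \<le> cmod z \<Longrightarrow> cmod z < r \<Longrightarrow> u z = ln (cusp_density z)"
proof -
  have r0: "r > 0" using assms(1) exp_gt_zero[of "-1::real"] by linarith
  define \<beta> where "\<beta> = ln r"
  have \<beta>: "- 1 < \<beta>" "\<beta> < 0"
  proof -
    have "exp (- 1) < exp \<beta>" "exp \<beta> < exp 0" using assms r0 by (simp_all add: \<beta>_def)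
    then show "- 1 < \<beta>" "\<beta> < 0" unfolding exp_less_cancel_iff .
  qed
  define a b where "a = - 1 + (\<beta> + 1) / 3" and "b = - 1 + 2 * (\<beta> + 1) / 3"
  have ab: "- 1 < a" "a < b" "b < \<beta>" "a < 0" using \<beta> by (auto simp: a_def b_def field_simps)
  \<comment> \<open>The value at \<open>t = a\<close> of \<open>v' - 1\<close> for the cusp. It makes the switch from \<open>k e\<^sup>2\<^sup>t\<close> to \<open>- 1/t - 1\<close> increase \<open>q\<close>.\<close>
  define k where "k = - inverse a - 1"
  have k: "k > 0" using ab by (simp add: k_def field_simps)
  obtain h h' :: "real \<Rightarrow> real" where Dh: "\<And>t. (h has_real_derivative h' t) (at t)"
    and h: "\<And>t. h t \<ge> 0" "\<And>t. h t \<le> 1" "\<And>t. h' t \<ge> 0"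
      "\<And>t. t \<le> a \<Longrightarrow> h t = 0" "\<And>t. t \<le> a \<Longrightarrow> h' t = 0" "\<And>t. t \<ge> b \<Longrightarrow> h t = 1"
    and Ch: "\<And>S g. open S \<Longrightarrow> C_infinity_on S g \<Longrightarrow> C_infinity_on S (\<lambda>z. h (g z))"
    by (rule smooth_step[OF ab(2)]; rule that; assumption)
  define q where "q = (\<lambda>t. (1 - h t) * (k * exp (2 * t)) + h t * (- inverse t - 1))"
  define q' where "q' = (\<lambda>t. (1 - h t) * (2 * k * exp (2 * t)) + h t * (inverse t)\<^sup>2
      + h' t * (- inverse t - 1 - k * exp (2 * t)))"
  have Dq: "(q has_real_derivative q' t) (at t)" if "t < 0" for t
    unfolding q_def q'_def using that
    by (auto intro!: derivative_eq_intros Dh simp: power2_eq_square algebra_simps)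
  have q'_pos: "q' t > 0" if t: "t < 0" for t
  proof (cases "t \<le> a")
    case True
    then show ?thesis using h(4,5) k by (simp add: q'_def)
  next
    case False
    have "k \<le> - inverse t - 1" using False t ab by (simp add: k_def field_simps)
    moreover have "k * exp (2 * t) \<le> k * 1" using k t by (intro mult_left_mono) auto
    ultimately have "h' t * (- inverse t - 1 - k * exp (2 * t)) \<ge> 0" using h(3) by simp
    moreover have "(1 - h t) * (2 * k * exp (2 * t)) + h t * (inverse t)\<^sup>2 > 0"
    proof (cases "h t = 0")
      case False
      then have "h t * (inverse t)\<^sup>2 > 0" using h(1)[of t] t by (simp add: less_le)
      moreover have "(1 - h t) * (2 * k * exp (2 * t)) \<ge> 0" using h(2)[of t] k by simp
      ultimately show ?thesis by linarith
    qed (use k in simp)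
    ultimately show ?thesis by (simp add: q'_def)
  qed
  have "continuous_on {a-1..\<beta>} q"
    using DERIV_isCont[OF Dq] \<beta> by (intro continuous_at_imp_continuous_on) auto
  then obtain U0 where U0: "\<And>x. x \<in> {a-1..\<beta>} \<Longrightarrow> (U0 has_vector_derivative q x) (at x within {a-1..\<beta>})"
    using antiderivative_continuous by blast
  have DU0: "(U0 has_real_derivative q t) (at t)" if "a - 1 < t" "t < \<beta>" for t
    using U0[of t] that at_within_Icc_at[OF that] by (simp add: has_real_derivative_iff_has_vector_derivative)
  \<comment> \<open>The antiderivative is known up to constants where the step function is \<open>0\<close> or \<open>1\<close>.\<close>
  define t1 t2 where "t1 = a - 1/2" and "t2 = (b + \<beta>) / 2"
  define C1 C2 where "C1 = U0 t1 - k / 2 * exp (2 * t1)" and "C2 = U0 t2 - (- ln (- t2) - t2)"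
  have C1: "U0 t = C1 + k / 2 * exp (2 * t)" if t: "a - 1 < t" "t < a" for t
  proof -
    have "U0 t - k / 2 * exp (2 * t) = U0 t1 - k / 2 * exp (2 * t1)"
    proof (rule DERIV_isconst3[of "a - 1" a t t1 "\<lambda>t. U0 t - k / 2 * exp (2 * t)"])
      fix x assume x: "x \<in> {a-1<..<a}"
      then have "q x = k * exp (2 * x)" using h(4) by (simp add: q_def)
      then have "(U0 has_real_derivative k * exp (2 * x)) (at x)" using DU0[of x] x ab by auto
      then show "((\<lambda>t. U0 t - k / 2 * exp (2 * t)) has_real_derivative 0) (at x)"
        by (auto intro!: derivative_eq_intros)
    qed (use t in \<open>auto simp: t1_def\<close>)
    then show ?thesis by (simp add: C1_def)
  qed
  have C2: "U0 t = C2 + (- ln (- t) - t)" if t: "b < t" "t < \<beta>" for t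
  proof -
    have "U0 t - (- ln (- t) - t) = U0 t2 - (- ln (- t2) - t2)"
    proof (rule DERIV_isconst3[of b \<beta> t t2 "\<lambda>t. U0 t - (- ln (- t) - t)"])
      fix x assume x: "x \<in> {b<..<\<beta>}"
      then have "q x = - inverse x - 1" using h(6) by (simp add: q_def)
      then have "(U0 has_real_derivative - inverse x - 1) (at x)" using DU0[of x] x ab by auto
      then show "((\<lambda>t. U0 t - (- ln (- t) - t)) has_real_derivative 0) (at x)"
        using x \<beta> by (auto intro!: derivative_eq_intros simp: field_simps)
    qed (use t ab in \<open>auto simp: t2_def\<close>)
    then show ?thesis by (simp add: C2_def)
  qed
  define U where "U = (\<lambda>t. U0 t - C2)"
  define u where "u = (\<lambda>z. if cmod z < exp a then (C1 - C2) + k / 2 * (cmod z)\<^sup>2 else U (ln (cmod z)))"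
  define S1 S2 where "S1 = ball (0::complex) (exp a)" and "S2 = {z::complex. exp (a - 1) < cmod z \<and> cmod z < r}"
  have S: "open S1" "open S2"
    unfolding S1_def S2_def by (auto intro!: open_Collect_conj open_Collect_less continuous_intros)
  have cover: "z \<in> S1 \<or> z \<in> S2" if "z \<in> ball 0 r" for z
  proof -
    have "exp (a - 1) < exp a" by simp
    then show ?thesis using that unfolding S1_def S2_def mem_ball_0 mem_Collect_eq by linarith
  qed
  have ln2: "a - 1 < ln (cmod z)" "ln (cmod z) < \<beta>" "z \<noteq> 0" if "z \<in> S2" for z
  proof -
    have p: "cmod z > 0" using that exp_gt_zero[of "a - 1"] unfolding S2_def mem_Collect_eq by linarith
    then show "z \<noteq> 0" by auto
    have "exp (a - 1) < exp (ln (cmod z))" using that p by (simp add: S2_def)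
    then show "a - 1 < ln (cmod z)" unfolding exp_less_cancel_iff .
    show "ln (cmod z) < \<beta>" using that p r0 by (simp add: S2_def \<beta>_def)
  qed
  have u1: "u z = (C1 - C2) + k / 2 * (cmod z)\<^sup>2" if "z \<in> S1" for z
    using that by (simp add: u_def S1_def)
  have u2: "u z = U (ln (cmod z))" if z: "z \<in> S2" for z
  proof (cases "cmod z < exp a")
    case True
    then have "exp (ln (cmod z)) < exp a" using ln2(3)[OF z] by simp
    then have "ln (cmod z) < a" unfolding exp_less_cancel_iff .
    moreover have "exp (2 * ln (cmod z)) = (cmod z)\<^sup>2"
      using ln2(3)[OF z] by (simp add: exp_double)
    ultimately show ?thesis using C1[of "ln (cmod z)"] ln2[OF z] True by (simp add: u_def U_def)
  qed (simp add: u_def)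
  note sq = norm_squared_C_infinity_laplacian[OF S(1), where c = "C1 - C2" and k = "k / 2"]
  have z0: "0 \<notin> S2" using ln2(3) by blast
  note lg = ln_norm_C_infinity_harmonic[OF z0 S(2)]
  have DU: "(U has_real_derivative q (ln (cmod z))) (at (ln (cmod z)))" if "z \<in> S2" for z
    unfolding U_def using DU0[of "ln (cmod z)"] ln2[OF that] by (auto intro!: derivative_eq_intros)
  have Cq: "C_infinity_on S2 (\<lambda>z. q (ln (cmod z)))"
  proof -
    have 1: "C_infinity_on S2 (\<lambda>z. 1 - h (ln (cmod z)))"
      by (intro C_infinity_on_diff S C_infinity_on_const Ch lg)
    have 2: "C_infinity_on S2 (\<lambda>z. k * exp (2 * ln (cmod z)))"
      by (intro C_infinity_on_mult S C_infinity_on_const C_infinity_on_exp lg)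
    have "C_infinity_on S2 (\<lambda>z. inverse (ln (cmod z)))"
      using ln2 \<beta> by (intro C_infinity_on_inverse S lg) fastforce
    then have "C_infinity_on S2 (\<lambda>z. (0 - inverse (ln (cmod z))) - 1)"
      by (intro C_infinity_on_diff S C_infinity_on_const)
    then have 3: "C_infinity_on S2 (\<lambda>z. - inverse (ln (cmod z)) - 1)" by simp
    show ?thesis
      unfolding q_def
      by (intro C_infinity_on_add[OF S(2)] C_infinity_on_mult[OF S(2)] 1 2 3 Ch S lg)
  qed
  have CU: "C_infinity_on S2 (\<lambda>z. U (ln (cmod z)))"
    by (rule C_infinity_on_antiderivative[OF S(2) lg(1) Cq DU])
  show ?thesis
  proof
    show "0 < exp t2" by simp
    have "exp t2 < exp \<beta>" using ab by (simp add: t2_def)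
    then show "exp t2 < r" using r0 by (simp add: \<beta>_def)
    show "C_infinity_on (ball 0 r) u"
    proof (rule C_infinity_on_local)
      fix z :: complex assume "z \<in> ball 0 r"
      moreover have "C_infinity_on S1 u = C_infinity_on S1 (\<lambda>z. (C1 - C2) + k / 2 * (cmod z)\<^sup>2)"
        by (rule C_infinity_on_cong[OF S(1)]) (rule u1)
      moreover have "C_infinity_on S2 u = C_infinity_on S2 (\<lambda>z. U (ln (cmod z)))"
        by (rule C_infinity_on_cong[OF S(2)]) (rule u2)
      ultimately show "\<exists>U. open U \<and> z \<in> U \<and> C_infinity_on U u"
        using sq(1) CU cover[of z] S by blast
    qed
    fix z :: complex
    show "laplacian u z > 0" if z: "z \<in> ball 0 r"
    proof (cases "z \<in> S1")
      case True
      have "laplacian u z = laplacian (\<lambda>z. (C1 - C2) + k / 2 * (cmod z)\<^sup>2) z"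
        by (rule laplacian_cong_open[OF S(1) True]) (rule u1)
      then show ?thesis using sq(2)[OF True] k by simp
    next
      case False
      then have z2: "z \<in> S2" using cover[OF z] by blast
      have "laplacian u z = laplacian (\<lambda>z. U (ln (cmod z))) z"
        by (rule laplacian_cong_open[OF S(2) z2]) (rule u2)
      also have "\<dots> = q' (ln (cmod z)) * ((dir_deriv 1 (\<lambda>z. ln (cmod z)) z)\<^sup>2
          + (dir_deriv \<i> (\<lambda>z. ln (cmod z)) z)\<^sup>2) + q (ln (cmod z)) * laplacian (\<lambda>z. ln (cmod z)) z"
      proof (rule laplacian_compose_real[OF S(2) C_infinity_on_C_2[OF lg(1)] z2 DU])
        show "(q has_real_derivative q' (ln (cmod z))) (at (ln (cmod z)))"
          using ln2[OF z2] \<beta> by (intro Dq) linarith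
      qed
      also have "(dir_deriv 1 (\<lambda>z. ln (cmod z)) z)\<^sup>2 + (dir_deriv \<i> (\<lambda>z. ln (cmod z)) z)\<^sup>2
          = (cmod (1 / z))\<^sup>2"
      proof -
        have "dir_deriv v (\<lambda>z. ln (cmod z)) z = Re (1 / z * v)" for v
          using dir_deriv_ln_cmod[OF open_UNIV holomorphic_on_ident, of z v] ln2(3)[OF z2] by simp
        moreover have "(Re (w * 1))\<^sup>2 + (Re (w * \<i>))\<^sup>2 = (cmod w)\<^sup>2" for w
          unfolding cmod_power2 by simp
        ultimately show ?thesis by (simp only:)
      qed
      finally have "laplacian u z = q' (ln (cmod z)) * (cmod (1 / z))\<^sup>2" using lg(2)[OF z2] by simp
      moreover have "q' (ln (cmod z)) > 0" using ln2[OF z2] \<beta> by (intro q'_pos) linarith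
      ultimately show ?thesis using ln2(3)[OF z2] by simp
    qed
    assume z: "exp t2 \<le> cmod z" "cmod z < r"
    have "exp (a - 1) < exp t2" using ab by (simp add: t2_def)
    then have z2: "z \<in> S2" using z unfolding S2_def mem_Collect_eq by linarith
    have "ln (cmod z) \<ge> t2" using z(1) ln2(3)[OF z2] by (simp add: ln_ge_iff)
    then have "u z = - ln (- ln (cmod z)) - ln (cmod z)"
      using u2[OF z2] C2[of "ln (cmod z)"] ln2[OF z2] ab by (simp add: U_def t2_def)
    moreover have "z \<in> cusp_disc 1" using ln2(3)[OF z2] z(2) assms(2) by (simp add: cusp_disc_def)
    ultimately show "u z = ln (cusp_density z)" by (simp add: ln_cusp_density)
  qed
qed

section \<open>Functions vanishing on a boundary segment\<close>

definition half_disc :: "complex \<Rightarrow> real \<Rightarrow> complex set" where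
  "half_disc \<zeta> \<kappa> = {z \<in> ball \<zeta> \<kappa>. Re z < Re \<zeta>}"

lemma half_disc_simps:
  "open (half_disc \<zeta> \<kappa>)" "convex (half_disc \<zeta> \<kappa>)"
proof -
  have "half_disc \<zeta> \<kappa> = ball \<zeta> \<kappa> \<inter> {z. Re z < Re \<zeta>}" by (auto simp: half_disc_def)
  then show "open (half_disc \<zeta> \<kappa>)" "convex (half_disc \<zeta> \<kappa>)"
    by (auto intro: open_halfspace_Re_lt convex_Int convex_halfspace_Re_lt)
qed

lemma half_disc_approach:
  assumes "w \<in> ball \<zeta> \<kappa>" "Re w = Re \<zeta>"
  shows "filterlim (\<lambda>s. w - of_real s) (at w within half_disc \<zeta> \<kappa>) (at_right 0)"
proof -
  have "((\<lambda>s. w - of_real s) \<longlongrightarrow> w - of_real 0) (at_right 0)" by (intro tendsto_intros)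
  then have 1: "((\<lambda>s. w - of_real s) \<longlongrightarrow> w) (at_right 0)" by simp
  have "eventually (\<lambda>s. w - of_real s \<in> ball \<zeta> \<kappa>) (at_right 0)"
    using topological_tendstoD[OF 1 open_ball assms(1)] .
  moreover have "eventually (\<lambda>s::real. s > 0) (at_right 0)" by (simp add: eventually_at_filter)
  ultimately have "eventually (\<lambda>s. w - of_real s \<in> half_disc \<zeta> \<kappa> \<and> w - of_real s \<noteq> w) (at_right 0)"
    by eventually_elim (use assms(2) in \<open>auto simp: half_disc_def\<close>)
  with 1 show ?thesis by (auto simp: filterlim_at)
qed

text \<open>First and second differences of \<open>J\<close> along a parallel to the diameter tend to \<open>0\<close> as the parallel
  approaches the diameter. By the mean value theorem they would stay away from \<open>0\<close>, if the
  corresponding derivative had a limit other than \<open>0\<close>.\<close>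

lemma boundary_tangential_limits:
  fixes J :: "complex \<Rightarrow> real"
  assumes \<kappa>: "\<kappa> > 0" and J: "C_k_on 2 (half_disc \<zeta> \<kappa>) J"
    and bd: "\<And>w. w \<in> ball \<zeta> \<kappa> \<Longrightarrow> Re w = Re \<zeta> \<Longrightarrow> (J \<longlongrightarrow> 0) (at w within half_disc \<zeta> \<kappa>)"
  shows "(dir_deriv \<i> J \<longlongrightarrow> j1) (at \<zeta> within half_disc \<zeta> \<kappa>) \<Longrightarrow> j1 = 0"
    and "(dir_deriv \<i> (dir_deriv \<i> J) \<longlongrightarrow> j2) (at \<zeta> within half_disc \<zeta> \<kappa>) \<Longrightarrow> j2 = 0"
proof -
  let ?T = "half_disc \<zeta> \<kappa>"
  have near: "\<exists>\<delta>>0. \<delta> \<le> \<kappa> \<and> (\<forall>z\<in>?T. dist z \<zeta> < \<delta> \<longrightarrow> \<bar>F z - j\<bar> < \<bar>j\<bar> / 2)"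
    if "(F \<longlongrightarrow> j) (at \<zeta> within ?T)" "j \<noteq> 0" for F :: "complex \<Rightarrow> real" and j
  proof -
    have "\<bar>j\<bar> / 2 > 0" using that by simp
    from tendstoD[OF that(1) this] obtain \<delta> where "\<delta> > 0"
        "\<forall>z\<in>?T. z \<noteq> \<zeta> \<and> dist z \<zeta> < \<delta> \<longrightarrow> dist (F z) j < \<bar>j\<bar> / 2"
      unfolding eventually_at by blast
    then show ?thesis
      using \<kappa> by (intro exI[of _ "min \<delta> \<kappa>"]) (auto simp: half_disc_def dist_real_def)
  qed
  have lim: "((\<lambda>s. J (w - of_real s)) \<longlongrightarrow> 0) (at_right 0)" if "w \<in> ball \<zeta> \<kappa>" "Re w = Re \<zeta>" for w
    by (rule filterlim_compose[OF bd[OF that] half_disc_approach[OF that]])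
  have inT: "\<zeta> - of_real s + of_real \<tau> * \<i> \<in> ?T" "dist (\<zeta> - of_real s + of_real \<tau> * \<i>) \<zeta> < \<delta>"
    if "0 < s" "s < \<delta> / 2" "\<bar>\<tau>\<bar> < \<delta> / 2" "\<delta> \<le> \<kappa>" for s \<tau> \<delta>
  proof -
    have "cmod (of_real \<tau> * \<i> - of_real s) \<le> \<bar>\<tau>\<bar> + s"
      using norm_triangle_ineq4[of "of_real \<tau> * \<i>" "of_real s"] that(1) by (simp add: norm_mult)
    then show "dist (\<zeta> - of_real s + of_real \<tau> * \<i>) \<zeta> < \<delta>"
      using that by (simp add: dist_norm algebra_simps)
    then show "\<zeta> - of_real s + of_real \<tau> * \<i> \<in> ?T"
      using that by (simp add: half_disc_def dist_commute)
  qed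
  have small: "eventually (\<lambda>s::real. 0 < s \<and> s < \<delta> / 2) (at_right 0)" if "\<delta> > 0" for \<delta>
    using that by (auto simp: eventually_at_right_field intro!: exI[of _ "\<delta> / 2"])
  have D1: "((\<lambda>\<tau>. J (\<zeta> - of_real s + of_real \<tau> * \<i>)) has_real_derivative
      dir_deriv \<i> J (\<zeta> - of_real s + of_real \<tau> * \<i>)) (at \<tau>)"
    and D2: "((\<lambda>\<tau>. dir_deriv \<i> J (\<zeta> - of_real s + of_real \<tau> * \<i>)) has_real_derivative
      dir_deriv \<i> (dir_deriv \<i> J) (\<zeta> - of_real s + of_real \<tau> * \<i>)) (at \<tau>)"
    if "\<zeta> - of_real s + of_real \<tau> * \<i> \<in> ?T" for s \<tau>
    using DERIV_along_line[of J "\<zeta> - of_real s" \<tau> \<i>] DERIV_along_line[of "dir_deriv \<i> J" "\<zeta> - of_real s" \<tau> \<i>]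
      C_2_differentiable[OF J that] by auto
  show "j1 = 0" if F: "(dir_deriv \<i> J \<longlongrightarrow> j1) (at \<zeta> within ?T)"
  proof (rule ccontr)
    assume "j1 \<noteq> 0"
    with near[OF F] obtain \<delta> where \<delta>: "\<delta> > 0" "\<delta> \<le> \<kappa>"
      "\<And>z. z \<in> ?T \<Longrightarrow> dist z \<zeta> < \<delta> \<Longrightarrow> \<bar>dir_deriv \<i> J z - j1\<bar> < \<bar>j1\<bar> / 2" by blast
    define \<tau> where "\<tau> = \<delta> / 4"
    have \<tau>: "\<tau> > 0" "\<tau> < \<delta> / 2" using \<delta> by (auto simp: \<tau>_def)
    have "\<tau> * \<bar>j1\<bar> / 2 \<le> \<bar>J ((\<zeta> + of_real \<tau> * \<i>) - of_real s) - J (\<zeta> - of_real s)\<bar>"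
      if s: "0 < s" "s < \<delta> / 2" for s
    proof -
      obtain x where x: "0 < x" "x < \<tau>" "J (\<zeta> - of_real s + of_real \<tau> * \<i>) - J (\<zeta> - of_real s + of_real 0 * \<i>)
          = (\<tau> - 0) * dir_deriv \<i> J (\<zeta> - of_real s + of_real x * \<i>)"
        using MVT2[of 0 \<tau> "\<lambda>\<tau>. J (\<zeta> - of_real s + of_real \<tau> * \<i>)"
            "\<lambda>\<tau>. dir_deriv \<i> J (\<zeta> - of_real s + of_real \<tau> * \<i>)"] D1 inT(1)[OF s _ \<delta>(2)] \<tau> by auto
      have "\<bar>dir_deriv \<i> J (\<zeta> - of_real s + of_real x * \<i>) - j1\<bar> < \<bar>j1\<bar> / 2"
        using inT[OF s _ \<delta>(2), of x] x \<tau> by (intro \<delta>(3)) auto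
      then have "\<bar>j1\<bar> / 2 \<le> \<bar>dir_deriv \<i> J (\<zeta> - of_real s + of_real x * \<i>)\<bar>" by linarith
      then have "\<tau> * (\<bar>j1\<bar> / 2) \<le> \<tau> * \<bar>dir_deriv \<i> J (\<zeta> - of_real s + of_real x * \<i>)\<bar>"
        using \<tau> by (intro mult_left_mono) auto
      then show ?thesis using x(3) \<tau>(1) by (simp add: abs_mult algebra_simps)
    qed
    then have "eventually (\<lambda>s. \<tau> * \<bar>j1\<bar> / 2 \<le> \<bar>J ((\<zeta> + of_real \<tau> * \<i>) - of_real s) - J (\<zeta> - of_real s)\<bar>) (at_right 0)"
      using small[OF \<delta>(1)] by (auto elim: eventually_mono)
    moreover have "((\<lambda>s. \<bar>J ((\<zeta> + of_real \<tau> * \<i>) - of_real s) - J (\<zeta> - of_real s)\<bar>) \<longlongrightarrow> \<bar>0 - 0\<bar>) (at_right 0)"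
      using \<tau> \<delta> \<kappa> by (intro tendsto_intros lim) (auto simp: dist_norm norm_mult)
    ultimately have "\<tau> * \<bar>j1\<bar> / 2 \<le> \<bar>0 - 0\<bar>"
      by (intro tendsto_lowerbound[of _ _ "at_right (0::real)"]) auto
    then show False using \<tau>(1) \<open>j1 \<noteq> 0\<close> by (simp add: mult_le_0_iff)
  qed
  show "j2 = 0" if F: "(dir_deriv \<i> (dir_deriv \<i> J) \<longlongrightarrow> j2) (at \<zeta> within ?T)"
  proof (rule ccontr)
    assume "j2 \<noteq> 0"
    with near[OF F] obtain \<delta> where \<delta>: "\<delta> > 0" "\<delta> \<le> \<kappa>"
      "\<And>z. z \<in> ?T \<Longrightarrow> dist z \<zeta> < \<delta> \<Longrightarrow> \<bar>dir_deriv \<i> (dir_deriv \<i> J) z - j2\<bar> < \<bar>j2\<bar> / 2" by blast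
    define \<tau> where "\<tau> = \<delta> / 4"
    have \<tau>: "\<tau> > 0" "\<tau> < \<delta> / 2" using \<delta> by (auto simp: \<tau>_def)
    have "\<tau> * (\<tau> * \<bar>j2\<bar> / 2) \<le> \<bar>J ((\<zeta> + of_real \<tau> * \<i>) - of_real s) - J (\<zeta> - of_real s)
        - (J (\<zeta> - of_real s) - J ((\<zeta> - of_real \<tau> * \<i>) - of_real s))\<bar>"
      if s: "0 < s" "s < \<delta> / 2" for s
    proof -
      define f f' f'' where "f = (\<lambda>\<tau>. J (\<zeta> - of_real s + of_real \<tau> * \<i>))"
        and "f' = (\<lambda>\<tau>. dir_deriv \<i> J (\<zeta> - of_real s + of_real \<tau> * \<i>))"
        and "f'' = (\<lambda>\<tau>. dir_deriv \<i> (dir_deriv \<i> J) (\<zeta> - of_real s + of_real \<tau> * \<i>))"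
      have Df: "(f has_real_derivative f' x) (at x)" "(f' has_real_derivative f'' x) (at x)"
        if "\<bar>x\<bar> \<le> \<tau>" for x
        using D1 D2 inT(1)[OF s _ \<delta>(2), of x] that \<tau> by (auto simp: f_def f'_def f''_def)
      have "((\<lambda>x. f x - f (x - \<tau>)) has_real_derivative f' x - f' (x - \<tau>)) (at x)" if "0 \<le> x" "x \<le> \<tau>" for x
      proof -
        have "((\<lambda>x. x - \<tau>) has_real_derivative 1) (at x)" by (auto intro!: derivative_eq_intros)
        from DERIV_chain2[where f = f, OF Df(1) this]
        have "((\<lambda>x. f (x - \<tau>)) has_real_derivative f' (x - \<tau>)) (at x)" using that by simp
        with Df(1)[of x] that show ?thesis by (intro DERIV_diff) auto
      qed
      then obtain x where x: "0 < x" "x < \<tau>" "(f \<tau> - f (\<tau> - \<tau>)) - (f 0 - f (0 - \<tau>)) = (\<tau> - 0) * (f' x - f' (x - \<tau>))"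
        using MVT2[of 0 \<tau> "\<lambda>x. f x - f (x - \<tau>)" "\<lambda>x. f' x - f' (x - \<tau>)"] \<tau>(1) by auto
      have "(f' has_real_derivative f'' y) (at y)" if "x - \<tau> \<le> y" "y \<le> x" for y
        using Df(2)[of y] that x by auto
      then obtain y where y: "x - \<tau> < y" "y < x" "f' x - f' (x - \<tau>) = (x - (x - \<tau>)) * f'' y"
        using MVT2[of "x - \<tau>" x f' f''] \<tau>(1) by auto
      have "\<bar>f'' y - j2\<bar> < \<bar>j2\<bar> / 2"
        unfolding f''_def using inT[OF s _ \<delta>(2), of y] x y \<tau> by (intro \<delta>(3)) auto
      then have "\<bar>j2\<bar> / 2 \<le> \<bar>f'' y\<bar>" by linarith
      then have "\<tau> * (\<tau> * (\<bar>j2\<bar> / 2)) \<le> \<tau> * (\<tau> * \<bar>f'' y\<bar>)"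
        using \<tau> by (intro mult_left_mono) auto
      also have "\<dots> = \<bar>(f \<tau> - f (\<tau> - \<tau>)) - (f 0 - f (0 - \<tau>))\<bar>"
        unfolding x(3) y(3) using \<tau>(1) by (simp add: abs_mult)
      finally show ?thesis by (simp add: f_def algebra_simps)
    qed
    then have "eventually (\<lambda>s. \<tau> * (\<tau> * \<bar>j2\<bar> / 2) \<le> \<bar>J ((\<zeta> + of_real \<tau> * \<i>) - of_real s) - J (\<zeta> - of_real s)
        - (J (\<zeta> - of_real s) - J ((\<zeta> - of_real \<tau> * \<i>) - of_real s))\<bar>) (at_right 0)"
      using small[OF \<delta>(1)] by (auto elim: eventually_mono)
    moreover have "((\<lambda>s. \<bar>J ((\<zeta> + of_real \<tau> * \<i>) - of_real s) - J (\<zeta> - of_real s)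
        - (J (\<zeta> - of_real s) - J ((\<zeta> - of_real \<tau> * \<i>) - of_real s))\<bar>) \<longlongrightarrow> \<bar>0 - 0 - (0 - 0)\<bar>) (at_right 0)"
      using \<tau> \<delta> \<kappa> by (intro tendsto_intros lim) (auto simp: dist_norm norm_mult)
    ultimately have "\<tau> * (\<tau> * \<bar>j2\<bar> / 2) \<le> \<bar>0 - 0 - (0 - 0)\<bar>"
      by (intro tendsto_lowerbound[of _ _ "at_right (0::real)"]) auto
    then show False using \<tau>(1) \<open>j2 \<noteq> 0\<close> by (simp add: mult_le_0_iff)
  qed
qed

text \<open>The normal derivative is one-sided here. A linear upper bound forces it to be at least the slope, and
  conversely, if it is positive, then the function is not positive near the boundary point.\<close>

lemma boundary_normal_limit:
  fixes J :: "complex \<Rightarrow> real"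
  assumes \<kappa>: "\<kappa> > 0" and J: "C_k_on 2 (half_disc \<zeta> \<kappa>) J"
    and bd: "\<And>w. w \<in> ball \<zeta> \<kappa> \<Longrightarrow> Re w = Re \<zeta> \<Longrightarrow> (J \<longlongrightarrow> 0) (at w within half_disc \<zeta> \<kappa>)"
    and lim: "(dir_deriv 1 J \<longlongrightarrow> j) (at \<zeta> within half_disc \<zeta> \<kappa>)"
  shows "(\<And>z. z \<in> half_disc \<zeta> \<kappa> \<Longrightarrow> J z \<le> e * (Re z - Re \<zeta>)) \<Longrightarrow> e \<le> j"
    and "j > 0 \<Longrightarrow> \<exists>\<delta>>0. \<forall>z\<in>half_disc \<zeta> \<kappa>. dist z \<zeta> < \<delta> \<longrightarrow> J z \<le> 0"
proof -
  let ?T = "half_disc \<zeta> \<kappa>"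
  have lim0: "((\<lambda>s. J (w - of_real s)) \<longlongrightarrow> 0) (at_right 0)" if "w \<in> ball \<zeta> \<kappa>" "Re w = Re \<zeta>" for w
    by (rule filterlim_compose[OF bd[OF that] half_disc_approach[OF that]])
  have mvt: "\<exists>x. s' < x \<and> x < s \<and> J (w - of_real s') - J (w - of_real s) = (s - s') * dir_deriv 1 J (w - of_real x)"
    if "s' < s" "\<And>x. s' \<le> x \<Longrightarrow> x \<le> s \<Longrightarrow> w - of_real x \<in> ?T" for w s s'
  proof -
    have "((\<lambda>x. J (w + of_real x * 1)) has_real_derivative dir_deriv 1 J (w + of_real x * 1)) (at x)"
      if "- s \<le> x" "x \<le> - s'" for x
      using \<open>\<And>x. s' \<le> x \<Longrightarrow> x \<le> s \<Longrightarrow> w - of_real x \<in> ?T\<close>[of "- x"] that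
      by (intro DERIV_along_line C_2_differentiable(1)[OF J]) auto
    then obtain x where "- s < x" "x < - s'" "J (w + of_real (- s') * 1) - J (w + of_real (- s) * 1)
        = (- s' - (- s)) * dir_deriv 1 J (w + of_real x * 1)"
      using MVT2[of "- s" "- s'" "\<lambda>x. J (w + of_real x * 1)" "\<lambda>x. dir_deriv 1 J (w + of_real x * 1)"]
        \<open>s' < s\<close> by auto
    then show ?thesis by (intro exI[of _ "- x"]) auto
  qed
  show "e \<le> j" if le: "\<And>z. z \<in> ?T \<Longrightarrow> J z \<le> e * (Re z - Re \<zeta>)"
  proof (rule field_le_epsilon)
    fix \<epsilon> :: real assume "\<epsilon> > 0"
    then obtain \<delta>0 where \<delta>0: "\<delta>0 > 0" "\<And>z. z \<in> ?T \<Longrightarrow> z \<noteq> \<zeta> \<Longrightarrow> dist z \<zeta> < \<delta>0 \<Longrightarrow> dist (dir_deriv 1 J z) j < \<epsilon>"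
      using tendstoD[OF lim] unfolding eventually_at by blast
    define s where "s = min \<delta>0 \<kappa> / 2"
    have s: "s > 0" "s < \<delta>0" "s < \<kappa>" using \<delta>0 \<kappa> by (auto simp: s_def)
    have T: "\<zeta> - of_real x \<in> ?T" if "0 < x" "x \<le> s" for x
      using that s by (simp add: half_disc_def dist_norm)
    have "J (\<zeta> - of_real s') - J (\<zeta> - of_real s) \<le> s * (j + \<epsilon>) - s' * (j + \<epsilon>)" if s': "0 < s'" "s' < s" for s'
    proof -
      obtain x where x: "s' < x" "x < s" "J (\<zeta> - of_real s') - J (\<zeta> - of_real s) = (s - s') * dir_deriv 1 J (\<zeta> - of_real x)"
        using mvt[of s' s \<zeta>] s' T by auto
      have "dist (dir_deriv 1 J (\<zeta> - of_real x)) j < \<epsilon>"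
        using x s' s T[of x] by (intro \<delta>0(2)) (auto simp: dist_norm)
      then have "(s - s') * dir_deriv 1 J (\<zeta> - of_real x) \<le> (s - s') * (j + \<epsilon>)"
        using s' by (intro mult_left_mono) (auto simp: dist_real_def)
      then show ?thesis using x(3) by (simp add: left_diff_distrib)
    qed
    then have "eventually (\<lambda>s'. J (\<zeta> - of_real s') - J (\<zeta> - of_real s) \<le> s * (j + \<epsilon>) - s' * (j + \<epsilon>)) (at_right 0)"
      using s(1) by (auto simp: eventually_at_right_field)
    moreover have "((\<lambda>s'. J (\<zeta> - of_real s') - J (\<zeta> - of_real s)) \<longlongrightarrow> 0 - J (\<zeta> - of_real s)) (at_right 0)"
      using \<kappa> by (intro tendsto_intros lim0) auto
    moreover have "((\<lambda>s'. s * (j + \<epsilon>) - s' * (j + \<epsilon>)) \<longlongrightarrow> s * (j + \<epsilon>) - 0 * (j + \<epsilon>)) (at_right 0)"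
      by (intro tendsto_intros)
    ultimately have "0 - J (\<zeta> - of_real s) \<le> s * (j + \<epsilon>) - 0 * (j + \<epsilon>)"
      by (intro tendsto_le[of "at_right (0::real)"]) auto
    moreover have "J (\<zeta> - of_real s) \<le> e * (- s)" using le[OF T[OF s(1) order_refl]] by simp
    ultimately have "s * e \<le> s * (j + \<epsilon>)" by (simp add: mult.commute)
    then show "e \<le> j + \<epsilon>" using s(1) by simp
  qed
  assume j: "j > 0"
  then obtain \<delta> where \<delta>: "\<delta> > 0" "\<And>z. z \<in> ?T \<Longrightarrow> z \<noteq> \<zeta> \<Longrightarrow> dist z \<zeta> < \<delta> \<Longrightarrow> dist (dir_deriv 1 J z) j < j"
    using tendstoD[OF lim j] unfolding eventually_at by blast
  show "\<exists>\<delta>>0. \<forall>z\<in>?T. dist z \<zeta> < \<delta> \<longrightarrow> J z \<le> 0"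
  proof (intro exI conjI ballI impI, rule \<delta>(1))
    fix z assume z: "z \<in> ?T" "dist z \<zeta> < \<delta>"
    define s w where "s = Re \<zeta> - Re z" and "w = z + of_real s"
    have s: "s > 0" using z by (simp add: s_def half_disc_def)
    have dist: "dist (w - of_real x) \<zeta> \<le> dist z \<zeta>" if "0 \<le> x" "x \<le> s" for x
    proof -
      have "(Re (w - of_real x - \<zeta>))\<^sup>2 \<le> (Re (z - \<zeta>))\<^sup>2"
        using that by (intro abs_le_square_iff[THEN iffD1]) (auto simp: w_def s_def)
      moreover have "Im (w - of_real x - \<zeta>) = Im (z - \<zeta>)" by (simp add: w_def)
      ultimately show ?thesis by (simp add: dist_norm cmod_def)
    qed
    have T: "w - of_real x \<in> ?T" if "0 < x" "x \<le> s" for x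
      using dist[of x] that z(1) by (auto simp: half_disc_def w_def s_def dist_commute)
    have w: "w \<in> ball \<zeta> \<kappa>" "Re w = Re \<zeta>"
      using dist[of 0] s z(1) by (auto simp: half_disc_def w_def s_def dist_commute)
    have "J (w - of_real s) \<le> J (w - of_real s')" if s': "0 < s'" "s' < s" for s'
    proof -
      obtain x where x: "s' < x" "x < s" "J (w - of_real s') - J (w - of_real s) = (s - s') * dir_deriv 1 J (w - of_real x)"
        using mvt[of s' s w] s' T by auto
      have "w - of_real x \<in> ?T" using T[of x] x s' by auto
      moreover from this have "w - of_real x \<noteq> \<zeta>" by (auto simp: half_disc_def)
      ultimately have "dist (dir_deriv 1 J (w - of_real x)) j < j"
        using dist[of x] x s' z(2) by (intro \<delta>(2)) auto
      then have "(s - s') * dir_deriv 1 J (w - of_real x) \<ge> 0"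
        using s' by (intro mult_nonneg_nonneg) (auto simp: dist_real_def)
      then show ?thesis using x(3) by simp
    qed
    then have "eventually (\<lambda>s'. J (w - of_real s) \<le> J (w - of_real s')) (at_right 0)"
      using s by (auto simp: eventually_at_right_field)
    then have "J (w - of_real s) \<le> 0"
      by (intro tendsto_lowerbound[OF lim0[OF w]]) auto
    then show "J z \<le> 0" by (simp add: w_def)
  qed
qed

section \<open>Convergence on surfaces\<close>

lemma chart_inverse_continuous:
  assumes c: "is_chart X c"
  shows "continuous_map (top_of_set (snd c ` fst c)) X (inv_into (fst c) (snd c))"
  unfolding continuous_map_def
proof (intro conjI allI impI)
  let ?g = "inv_into (fst c) (snd c)"
  note D = is_chartD[OF c]
  show "?g \<in> topspace (top_of_set (snd c ` fst c)) \<rightarrow> topspace X" using D(4,8) by auto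
  fix U assume U: "openin X U"
  have "{z \<in> topspace (top_of_set (snd c ` fst c)). ?g z \<in> U} = snd c ` (U \<inter> fst c)"
    using D(8) by auto
  moreover have "open (snd c ` (U \<inter> fst c))" using U D(1) by (intro D(6)) auto
  ultimately show "openin (top_of_set (snd c ` fst c)) {z \<in> topspace (top_of_set (snd c ` fst c)). ?g z \<in> U}"
    using D(2) by (auto simp: openin_open_eq)
qed

lemma limitin_chart:
  assumes d: "is_chart Y d" and q: "q \<in> fst d"
  shows "limitin Y f q F \<longleftrightarrow>
    eventually (\<lambda>n. f n \<in> fst d) F \<and> ((\<lambda>n. snd d (f n)) \<longlongrightarrow> snd d q) F"
proof (intro iffI conjI)
  assume lim: "limitin Y f q F"
  show ev: "eventually (\<lambda>n. f n \<in> fst d) F"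
    using lim q is_chartD(1)[OF d] by (auto simp: limitin_def)
  show "((\<lambda>n. snd d (f n)) \<longlongrightarrow> snd d q) F"
  proof (rule topological_tendstoI)
    fix S assume "open S" "snd d q \<in> S"
    then have "eventually (\<lambda>n. f n \<in> fst d \<inter> snd d -` S) F"
      using lim q is_chartD(7)[OF d, of S] by (auto simp: limitin_def)
    then show "eventually (\<lambda>n. snd d (f n) \<in> S) F" by (rule eventually_mono) auto
  qed
next
  assume *: "eventually (\<lambda>n. f n \<in> fst d) F \<and> ((\<lambda>n. snd d (f n)) \<longlongrightarrow> snd d q) F"
  show "limitin Y f q F"
    unfolding limitin_def
  proof (intro conjI allI impI)
    show "q \<in> topspace Y" using q is_chartD(4)[OF d] by auto
    fix U assume U: "openin Y U \<and> q \<in> U"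
    have "open (snd d ` (U \<inter> fst d))"
      using U is_chartD(1)[OF d] by (intro is_chartD(6)[OF d]) auto
    then have "eventually (\<lambda>n. snd d (f n) \<in> snd d ` (U \<inter> fst d)) F"
      using * U q by (intro topological_tendstoD[of _ "snd d q"]) auto
    with *[THEN conjunct1] show "eventually (\<lambda>n. f n \<in> U) F"
      by eventually_elim (use is_chartD(3)[OF d] in \<open>auto dest: inj_onD\<close>)
  qed
qed

lemma limitin_subsequence:
  "limitin Y f q sequentially \<Longrightarrow> strict_mono k \<Longrightarrow> limitin Y (f \<circ> k) q sequentially"
  unfolding limitin_def by (auto dest: eventually_subseq)

lemma surface_compact_imp_convergent_subsequence:
  fixes f :: "nat \<Rightarrow> 'b"
  assumes Y: "atlas Y B" "compact_space Y" and f: "\<And>n. f n \<in> topspace Y"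
  obtains q k where "q \<in> topspace Y" "strict_mono (k :: nat \<Rightarrow> nat)" "limitin Y (f \<circ> k) q sequentially"
proof -
  have "\<exists>q\<in>topspace Y. \<forall>U. openin Y U \<and> q \<in> U \<longrightarrow> (\<exists>\<^sub>\<infinity>n. f n \<in> U)"
  proof (rule ccontr)
    assume "\<not> ?thesis"
    then have "\<forall>q\<in>topspace Y. \<exists>U. openin Y U \<and> q \<in> U \<and> finite {n. f n \<in> U}"
      by (auto simp: INFM_iff_infinite)
    then obtain U where U: "\<And>q. q \<in> topspace Y \<Longrightarrow> openin Y (U q) \<and> q \<in> U q \<and> finite {n. f n \<in> U q}"
      by metis
    have "\<exists>\<F>. finite \<F> \<and> \<F> \<subseteq> U ` topspace Y \<and> topspace Y \<subseteq> \<Union>\<F>"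
      using Y(2) U unfolding compact_space_alt by (elim allE[of _ "U ` topspace Y"]) blast
    then obtain \<F> where \<F>: "finite \<F>" "\<F> \<subseteq> U ` topspace Y" "topspace Y \<subseteq> \<Union>\<F>" by blast
    have "finite (\<Union>V\<in>\<F>. {n. f n \<in> V})" using \<F>(1,2) U by auto
    moreover have "(\<Union>V\<in>\<F>. {n. f n \<in> V}) = UNIV" using \<F>(3) f by auto
    ultimately show False by simp
  qed
  then obtain q where q: "q \<in> topspace Y" "\<And>U. openin Y U \<Longrightarrow> q \<in> U \<Longrightarrow> infinite {n. f n \<in> U}"
    by (auto simp: INFM_iff_infinite)
  obtain d where d: "d \<in> B" "q \<in> fst d" "is_chart Y d" using atlas_chart_at[OF Y(1) q(1)] by blast
  define V where "V n = fst d \<inter> snd d -` ball (snd d q) (1 / Suc n)" for n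
  have V: "openin Y (V n)" "q \<in> V n" for n
    using is_chartD(7)[OF d(3), of "ball (snd d q) (1 / Suc n)"] d(2) by (auto simp: V_def)
  have "\<exists>m>j. f m \<in> V n" for j n
    using q(2)[OF V, of n] unfolding infinite_nat_iff_unbounded by auto
  then obtain next' where next': "\<And>j n. next' j n > j" "\<And>j n. f (next' j n) \<in> V n" by metis
  define k where "k = rec_nat (next' 0 0) (\<lambda>n j. next' j (Suc n))"
  have k: "k (Suc n) > k n" "f (k n) \<in> V n" for n
    using next' by (cases n; simp add: k_def)+
  have "strict_mono k" using k(1) by (simp add: strict_mono_Suc_iff)
  moreover have "limitin Y (f \<circ> k) q sequentially"
  proof (subst limitin_chart[OF d(3,2)], intro conjI)
    show "eventually (\<lambda>n. (f \<circ> k) n \<in> fst d) sequentially" using k(2) by (auto simp: V_def)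
    show "(\<lambda>n. snd d ((f \<circ> k) n)) \<longlonglongrightarrow> snd d q"
    proof (rule metric_tendsto_imp_tendsto[OF LIMSEQ_Suc[OF lim_inverse_n']])
      show "eventually (\<lambda>n. dist (snd d ((f \<circ> k) n)) (snd d q) \<le> dist (1 / real (Suc n)) 0) sequentially"
        using k(2) by (intro always_eventually) (auto simp: V_def dist_commute less_imp_le)
    qed
  qed
  ultimately show ?thesis using that q(1) by blast
qed

section \<open>The surface, its cusps and their coordinates\<close>

lemma open_cusp_disc: "open (cusp_disc r)"
  unfolding cusp_disc_def by (intro open_Collect_conj open_Collect_less continuous_intros)

lemma ball_eq_insert_cusp_disc: "r > 0 \<Longrightarrow> ball 0 r = insert 0 (cusp_disc r)"
  by (auto simp: cusp_disc_def)

lemma connected_cusp_disc: "connected (cusp_disc r)"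
  using connected_annulus(1)[of 0 "0::complex" r] by (simp add: cusp_disc_def)

lemma cnj_image_cusp_disc: "cnj ` cusp_disc r = cusp_disc r"
proof -
  have "z \<in> cnj ` cusp_disc r" if "z \<in> cusp_disc r" for z
    by (rule image_eqI[of _ _ "cnj z"]) (use that in \<open>auto simp: cusp_disc_def\<close>)
  then show ?thesis by (auto simp: cusp_disc_def)
qed

lemma cnj_image_sphere: "cnj ` sphere 0 r = sphere 0 r"
proof -
  have "z \<in> cnj ` sphere 0 r" if "z \<in> sphere 0 r" for z
    by (rule image_eqI[of _ _ "cnj z"]) (use that in auto)
  then show ?thesis by auto
qed

lemma sphere_neighbourhood:
  fixes V :: "complex set"
  assumes "0 < r" "open V" "sphere 0 r \<subseteq> V"
  obtains e where "e > 0" "\<And>z. r - e < cmod z \<Longrightarrow> cmod z < r + e \<Longrightarrow> z \<in> V"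
proof -
  obtain e where e: "e > 0" "(\<Union>x\<in>sphere 0 r. ball x e) \<subseteq> V"
    using compact_subset_open_imp_ball_epsilon_subset[OF compact_sphere assms(2,3)] by blast
  show ?thesis
  proof (rule that[of "min e r"])
    fix z :: complex assume z: "r - min e r < cmod z" "cmod z < r + min e r"
    then have z0: "cmod z > 0" by linarith
    have "of_real (r / cmod z) * z - z = of_real (r / cmod z - 1) * z" by (simp add: algebra_simps)
    then have "dist (of_real (r / cmod z) * z) z = \<bar>r / cmod z - 1\<bar> * \<bar>cmod z\<bar>"
      by (simp only: dist_norm norm_mult norm_of_real abs_norm_cancel)
    also have "\<dots> = \<bar>r - cmod z\<bar>" unfolding abs_mult[symmetric] using z0 by (simp add: left_diff_distrib)
    also have "\<dots> < e" using z by linarith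
    finally have "z \<in> ball (of_real (r / cmod z) * z) e" by simp
    moreover have "of_real (r / cmod z) * z \<in> sphere 0 r" using z0 assms(1) by (simp add: norm_mult norm_divide)
    ultimately show "z \<in> V" using e(2) by blast
  qed (use e assms in auto)
qed

locale cusp_surface =
  fixes X :: "'a topology" and A :: "'a chart set" and \<rho> :: "'a density"
    and Y :: "'b topology" and B :: "'b chart set" and \<iota> :: "'a \<Rightarrow> 'b"
  assumes riemann_X: "riemann_surface X A"
    and hyperbolic: "hyperbolic_metric X A \<rho>"
    and compactification: "conformal_compactification X A \<rho> Y B \<iota>"
begin

lemma atlas_X: "atlas X A"
  using riemann_X by (rule riemann_surface_atlas)

lemma atlas_Y: "atlas Y B"
  using compactification by (intro riemann_surface_atlas) (simp add: conformal_compactification_def)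

lemma Hausdorff: "Hausdorff_space X" "Hausdorff_space Y"
  using riemann_X compactification by (auto simp: conformal_compactification_def riemann_surface_def)

lemma compact_Y: "compact_space Y"
  using compactification by (simp add: conformal_compactification_def)

lemma conformal_\<rho>: "conformal_metric X A \<rho>"
  using hyperbolic by (simp add: hyperbolic_metric_def)

lemma \<rho>_pos: "c \<in> A \<Longrightarrow> x \<in> fst c \<Longrightarrow> \<rho> c (snd c x) > 0"
  using conformal_\<rho> by (auto simp: conformal_metric_def)

lemma \<iota>: "continuous_map X Y \<iota>" "inj_on \<iota> (topspace X)" "holomorphic_map A B \<iota>"
  "openin Y (\<iota> ` topspace X)" "U \<subseteq> topspace X \<Longrightarrow> openin X U \<longleftrightarrow> openin Y (\<iota> ` U)"
proof -
  have e: "homeomorphic_map X (subtopology Y (\<iota> ` topspace X)) \<iota>"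
    and o: "openin Y (\<iota> ` topspace X)" and "holomorphic_map A B \<iota>"
    using compactification by (auto simp: conformal_compactification_def embedding_map_def)
  then show "continuous_map X Y \<iota>" "inj_on \<iota> (topspace X)" "holomorphic_map A B \<iota>"
    "openin Y (\<iota> ` topspace X)"
    using homeomorphic_imp_continuous_map[OF e] homeomorphic_imp_injective_map[OF e]
    by (auto simp: continuous_map_in_subtopology)
  show "openin X U \<longleftrightarrow> openin Y (\<iota> ` U)" if "U \<subseteq> topspace X"
    using homeomorphic_map_openness[OF e that] openin_open_subtopology[OF o, of "\<iota> ` U"] that by auto
qed

lemma \<iota>_in_Y: "x \<in> topspace X \<Longrightarrow> \<iota> x \<in> topspace Y"
  using \<iota>(1) by (auto simp: continuous_map_def)

lemma cusps_iff: "P \<in> cusps X Y \<iota> \<longleftrightarrow> P \<in> topspace Y \<and> P \<notin> \<iota> ` topspace X"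
  by (auto simp: cusps_def)

text \<open>Only holomorphic embeddings need to be considered: one that reverses the orientation may be composed
  with complex conjugation, which preserves circles and discs around \<open>0\<close>.\<close>

definition cusp_coordinate :: "'b \<Rightarrow> real \<Rightarrow> (complex \<Rightarrow> 'a) \<Rightarrow> bool" where
  "cusp_coordinate P r \<phi> \<longleftrightarrow> P \<in> cusps X Y \<iota> \<and> 0 < r \<and> r \<le> 1 \<and>
     holomorphic_isometry A \<rho> X (cusp_disc r) \<phi> \<and> limitin Y (\<iota> \<circ> \<phi>) P (at 0)"

lemma cusp_coordinateD:
  assumes "cusp_coordinate P r \<phi>"
  shows "P \<in> cusps X Y \<iota>" "0 < r" "r \<le> 1" "continuous_map (top_of_set (cusp_disc r)) X \<phi>"
    "inj_on \<phi> (cusp_disc r)" "holomorphic_map {plane_chart (cusp_disc r)} A \<phi>"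
    "limitin Y (\<iota> \<circ> \<phi>) P (at 0)" "z \<in> cusp_disc r \<Longrightarrow> \<phi> z \<in> topspace X"
    "c \<in> A \<Longrightarrow> z \<in> cusp_disc r \<Longrightarrow> \<phi> z \<in> fst c \<Longrightarrow> (snd c \<circ> \<phi>) field_differentiable (at z)"
    "c \<in> A \<Longrightarrow> z \<in> cusp_disc r \<Longrightarrow> \<phi> z \<in> fst c
      \<Longrightarrow> \<rho> c (snd c (\<phi> z)) * cmod (deriv (snd c \<circ> \<phi>) z) = cusp_density z"
  using assms holomorphic_isometry_holomorphic_map[of A \<rho> X "cusp_disc r" \<phi>]
  unfolding cusp_coordinate_def holomorphic_isometry_def by (auto simp: continuous_map_def)

lemma cusp_disc_mono: "s \<le> r \<Longrightarrow> cusp_disc s \<subseteq> cusp_disc r"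
  by (auto simp: cusp_disc_def)

lemma cusp_coordinate_smaller:
  "cusp_coordinate P r \<phi> \<Longrightarrow> 0 < s \<Longrightarrow> s \<le> r \<Longrightarrow> cusp_coordinate P s \<phi>"
  unfolding cusp_coordinate_def
  using holomorphic_isometry_subset[OF _ cusp_disc_mono] by force

text \<open>The parametrization of a full neighbourhood of the cusp in the compactification.\<close>

definition extend_cusp :: "'b \<Rightarrow> (complex \<Rightarrow> 'a) \<Rightarrow> complex \<Rightarrow> 'b" where
  "extend_cusp P \<phi> z = (if z = 0 then P else \<iota> (\<phi> z))"

lemma extend_cusp_image:
  "r > 0 \<Longrightarrow> extend_cusp P \<phi> ` ball 0 r = insert P (\<iota> ` \<phi> ` cusp_disc r)"
  unfolding ball_eq_insert_cusp_disc
  by (force simp: extend_cusp_def cusp_disc_def image_iff)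

context
  fixes P r \<phi> assumes cc: "cusp_coordinate P r \<phi>"
begin

lemma extend_cusp_continuous: "continuous_map (top_of_set (ball 0 r)) Y (extend_cusp P \<phi>)"
  unfolding continuous_map_def
proof (intro conjI allI impI)
  note D = cusp_coordinateD[OF cc]
  show "extend_cusp P \<phi> \<in> topspace (top_of_set (ball 0 r)) \<rightarrow> topspace Y"
    using D(1,8) \<iota>_in_Y by (auto simp: extend_cusp_def cusps_iff cusp_disc_def)
  fix U assume U: "openin Y U"
  let ?S = "{z \<in> topspace (top_of_set (ball 0 r)). extend_cusp P \<phi> z \<in> U}"
  have "continuous_map (top_of_set (cusp_disc r)) Y (\<iota> \<circ> \<phi>)"
    using D(4) \<iota>(1) by (rule continuous_map_compose)
  then have o: "open (cusp_disc r \<inter> (\<iota> \<circ> \<phi>) -` U)"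
    by (rule open_plane_preimage[OF open_cusp_disc _ U])
  have "open ?S"
  proof (cases "P \<in> U")
    case False
    then have "?S = cusp_disc r \<inter> (\<iota> \<circ> \<phi>) -` U"
      by (auto simp: extend_cusp_def cusp_disc_def split: if_splits)
    then show ?thesis using o by simp
  next
    case True
    then have "eventually (\<lambda>z. (\<iota> \<circ> \<phi>) z \<in> U) (at 0)" using D(7) U by (auto simp: limitin_def)
    then obtain e where e: "e > 0" "\<And>z. z \<noteq> 0 \<Longrightarrow> cmod z < e \<Longrightarrow> \<iota> (\<phi> z) \<in> U"
      by (auto simp: eventually_at)
    have "?S = (cusp_disc r \<inter> (\<iota> \<circ> \<phi>) -` U) \<union> ball 0 (min e r)"
      using True e D(2) by (auto simp: extend_cusp_def cusp_disc_def split: if_splits)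
    then show ?thesis using open_Un[OF o open_ball] by (simp only:)
  qed
  then show "openin (top_of_set (ball 0 r)) ?S" by (simp add: openin_open_eq) auto
qed

lemma extend_cusp_inj: "inj_on (extend_cusp P \<phi>) (ball 0 r)"
proof (rule inj_onI)
  note D = cusp_coordinateD[OF cc]
  fix u v assume uv: "u \<in> ball 0 r" "v \<in> ball 0 r" "extend_cusp P \<phi> u = extend_cusp P \<phi> v"
  have "u \<noteq> 0 \<Longrightarrow> u \<in> cusp_disc r" "v \<noteq> 0 \<Longrightarrow> v \<in> cusp_disc r"
    using uv by (auto simp: cusp_disc_def)
  then show "u = v"
    using uv(3) D(1) D(8)[of u] D(8)[of v] inj_onD[OF \<iota>(2), of "\<phi> u" "\<phi> v"] inj_onD[OF D(5), of u v]
    by (auto simp: extend_cusp_def cusps_iff split: if_splits)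
qed

lemma extend_cusp_open: "open U \<Longrightarrow> U \<subseteq> ball 0 r \<Longrightarrow> openin Y (extend_cusp P \<phi> ` U)"
  by (rule open_map_into_surface[OF atlas_Y open_ball extend_cusp_continuous extend_cusp_inj])

text \<open>The puncture is a removable singularity.\<close>

lemma extend_cusp_holomorphic: "holomorphic_map {plane_chart (ball 0 r)} B (extend_cusp P \<phi>)"
  unfolding holomorphic_map_plane_chart
proof
  note D = cusp_coordinateD[OF cc]
  fix d assume d: "d \<in> B"
  note cd = atlasD[OF atlas_Y d]
  let ?f = "snd d \<circ> extend_cusp P \<phi>" and ?W = "ball 0 r \<inter> extend_cusp P \<phi> -` fst d"
  have oW: "open ?W"
    by (rule open_plane_preimage[OF open_ball extend_cusp_continuous is_chartD(1)[OF cd]])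
  have "continuous_map (top_of_set ?W) (subtopology Y (fst d)) (extend_cusp P \<phi>)"
    using continuous_map_from_subtopology_mono[OF extend_cusp_continuous, of ?W]
    by (auto simp: continuous_map_in_subtopology)
  then have "continuous_map (top_of_set ?W) euclidean ?f"
    using is_chartD(5)[OF cd] by (rule continuous_map_compose)
  then have cont: "continuous_on ?W ?f" by simp
  have "holomorphic_map {plane_chart (cusp_disc r)} B (\<iota> \<circ> \<phi>)"
    using holomorphic_map_compose[OF atlas_plane_chart[OF open_cusp_disc] atlas_X atlas_Y D(4,6) \<iota>(1,3)] .
  then have "(snd d \<circ> (\<iota> \<circ> \<phi>)) holomorphic_on cusp_disc r \<inter> (\<iota> \<circ> \<phi>) -` fst d"
    using d by (auto simp: holomorphic_map_plane_chart)
  then have "?f holomorphic_on cusp_disc r \<inter> (\<iota> \<circ> \<phi>) -` fst d"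
    by (rule holomorphic_transform) (auto simp: extend_cusp_def cusp_disc_def)
  then have "?f holomorphic_on ?W - {0}"
    by (rule holomorphic_on_subset) (auto simp: extend_cusp_def cusp_disc_def)
  then show "?f holomorphic_on ?W"
    by (rule no_isolated_singularity[OF cont _ oW]) simp
qed

lemma deriv_extend_cusp:
  assumes z: "z \<in> cusp_disc r" and c: "c \<in> A" "\<phi> z \<in> fst c" and d: "d \<in> B" "\<iota> (\<phi> z) \<in> fst d"
  shows "deriv (snd d \<circ> extend_cusp P \<phi>) z
    = deriv (in_coords \<iota> c d) (snd c (\<phi> z)) * deriv (snd c \<circ> \<phi>) z"
proof -
  note D = cusp_coordinateD[OF cc]
  note cc' = atlasD[OF atlas_X c(1)] and cd = atlasD[OF atlas_Y d(1)]
  have f: "(snd c \<circ> \<phi> has_field_derivative deriv (snd c \<circ> \<phi>) z) (at z)"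
    using D(9)[OF c(1) z c(2)] by (rule field_differentiable_derivI)
  have "in_coords \<iota> c d field_differentiable (at (snd c (\<phi> z)))"
    by (rule holomorphic_map_in_coords_differentiable[OF \<iota>(3) c(1) d(1) cc' \<iota>(1) cd c(2) d(2)])
  then have "(in_coords \<iota> c d has_field_derivative deriv (in_coords \<iota> c d) (snd c (\<phi> z))) (at ((snd c \<circ> \<phi>) z))"
    by (simp add: field_differentiable_derivI)
  from DERIV_chain[OF this f] have "(snd d \<circ> extend_cusp P \<phi> has_field_derivative
      deriv (in_coords \<iota> c d) (snd c (\<phi> z)) * deriv (snd c \<circ> \<phi>) z) (at z)"
  proof (rule has_field_derivative_transform_within_open)
    show "open (cusp_disc r \<inter> \<phi> -` fst c)"
      by (rule open_plane_preimage[OF open_cusp_disc D(4) is_chartD(1)[OF cc']])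
    show "z \<in> cusp_disc r \<inter> \<phi> -` fst c" using z c(2) by simp
    fix w assume w: "w \<in> cusp_disc r \<inter> \<phi> -` fst c"
    then have "w \<noteq> 0" by (auto simp: cusp_disc_def)
    then show "(in_coords \<iota> c d \<circ> (snd c \<circ> \<phi>)) w = (snd d \<circ> extend_cusp P \<phi>) w"
      using in_coords_apply[OF cc', of "\<phi> w" \<iota> d] w by (simp add: extend_cusp_def)
  qed
  then show ?thesis by (rule DERIV_imp_deriv)
qed

lemma cusp_coordinate_imp_horocyclic_nhd:
  assumes "r < 1"
  shows "horocyclic_nhd X A \<rho> Y \<iota> P (\<phi> ` cusp_disc r)"
proof -
  note D = cusp_coordinateD[OF cc]
  have "isometric_embedding X A \<rho> (cusp_disc r) \<phi>"
    using cc by (intro holomorphic_isometry_imp_isometric_embedding open_cusp_disc atlas_X)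
      (simp add: cusp_coordinate_def)
  moreover have "openin Y (insert P (\<iota> ` \<phi> ` cusp_disc r))"
    using extend_cusp_open[of "ball 0 r"] extend_cusp_image[OF D(2)] by simp
  ultimately show ?thesis using D assms unfolding horocyclic_nhd_def by blast
qed

lemma cusp_coordinate_imp_closed_horocycle:
  assumes "0 < s" "s < r"
  shows "closed_horocycle X A \<rho> Y \<iota> P (\<phi> ` sphere 0 s) (- 2 * pi / ln s)"
proof -
  note D = cusp_coordinateD[OF cc]
  have "isometric_embedding X A \<rho> (cusp_disc r) \<phi>"
    using cc by (intro holomorphic_isometry_imp_isometric_embedding open_cusp_disc atlas_X)
      (simp add: cusp_coordinate_def)
  moreover have "cusp_disc s \<union> sphere 0 s \<subseteq> cusp_disc r" "cusp_disc r \<subseteq> cusp_disc 1" "s < 1"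
    using assms D(3) by (auto simp: cusp_disc_def)
  ultimately show ?thesis
    using D(7) assms open_cusp_disc connected_cusp_disc unfolding closed_horocycle_def by blast
qed

end

lemma limitin_at_0_cnj:
  assumes "limitin Y (\<iota> \<circ> \<phi>) P (at 0)"
  shows "limitin Y (\<iota> \<circ> (\<phi> \<circ> cnj)) P (at 0)"
proof -
  have "filterlim cnj (at 0) (at 0)"
    using tendsto_cnj[OF tendsto_ident_at[of "0::complex" UNIV]]
    by (auto simp: filterlim_at eventually_at_filter)
  then show ?thesis
    using assms unfolding limitin_def by (auto simp: filterlim_iff)
qed

lemma isometric_embedding_orient:
  assumes P: "P \<in> cusps X Y \<iota>" and s: "0 < s" "s \<le> 1"
    and \<phi>: "isometric_embedding X A \<rho> (cusp_disc s) \<phi>" "limitin Y (\<iota> \<circ> \<phi>) P (at 0)"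
  obtains \<psi> where "cusp_coordinate P s \<psi>" "\<And>r. \<psi> ` sphere 0 r = \<phi> ` sphere 0 r"
    "\<psi> ` cusp_disc s = \<phi> ` cusp_disc s"
proof -
  have "holomorphic_isometry A \<rho> X (cusp_disc s) \<phi>
      \<or> holomorphic_isometry A \<rho> X (cnj ` cusp_disc s) (\<phi> \<circ> cnj)"
    by (rule isometric_embedding_orientation[OF atlas_X conformal_\<rho> open_cusp_disc connected_cusp_disc
        cusp_disc_mono[OF s(2)] \<phi>(1)])
  then show ?thesis
  proof
    assume "holomorphic_isometry A \<rho> X (cusp_disc s) \<phi>"
    then show ?thesis using that[of \<phi>] P s \<phi>(2) by (simp add: cusp_coordinate_def)
  next
    assume "holomorphic_isometry A \<rho> X (cnj ` cusp_disc s) (\<phi> \<circ> cnj)"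
    then have "cusp_coordinate P s (\<phi> \<circ> cnj)"
      using P s limitin_at_0_cnj[OF \<phi>(2)] by (simp add: cusp_coordinate_def cnj_image_cusp_disc)
    then show ?thesis by (rule that) (simp_all only: image_comp[symmetric] cnj_image_cusp_disc cnj_image_sphere)
  qed
qed

lemma isometric_embedding_subset:
  "isometric_embedding X A \<rho> V \<phi> \<Longrightarrow> W \<subseteq> V \<Longrightarrow> isometric_embedding X A \<rho> W \<phi>"
  unfolding isometric_embedding_def
  by (meson C_infinity_on_subset Int_mono continuous_map_from_subtopology_mono inj_on_subset
      order_refl subsetD)

lemma horocyclic_nhdD:
  assumes "P \<in> cusps X Y \<iota>" "horocyclic_nhd X A \<rho> Y \<iota> P N"
  obtains r \<phi> where "r < 1" "cusp_coordinate P r \<phi>" "N = \<phi> ` cusp_disc r"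
proof -
  obtain r \<phi> where *: "0 < r" "r < 1" "isometric_embedding X A \<rho> (cusp_disc r) \<phi>"
    "limitin Y (\<iota> \<circ> \<phi>) P (at 0)" "N = \<phi> ` cusp_disc r"
    using assms(2) unfolding horocyclic_nhd_def by blast
  obtain \<psi> where "cusp_coordinate P r \<psi>" "\<psi> ` cusp_disc r = \<phi> ` cusp_disc r"
    using isometric_embedding_orient[OF assms(1) *(1) _ *(3,4)] *(2) by (metis less_imp_le)
  then show ?thesis using that *(2,5) by metis
qed

text \<open>A neighbourhood of the closed disc contains a slightly larger disc, by compactness of the circle.\<close>

lemma closed_horocycleD:
  assumes P: "P \<in> cusps X Y \<iota>" and H: "closed_horocycle X A \<rho> Y \<iota> P H l"
  obtains r s \<phi> where "0 < r" "r < s" "cusp_coordinate P s \<phi>" "H = \<phi> ` sphere 0 r" "l = - 2 * pi / ln r"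
proof -
  obtain r V \<phi> where *: "0 < r" "r < 1" "open V" "V \<subseteq> cusp_disc 1" "cusp_disc r \<union> sphere 0 r \<subseteq> V"
    "isometric_embedding X A \<rho> V \<phi>" "limitin Y (\<iota> \<circ> \<phi>) P (at 0)" "H = \<phi> ` sphere 0 r" "l = - 2 * pi / ln r"
    using H unfolding closed_horocycle_def by blast
  obtain e where e: "e > 0" "\<And>z. r - e < cmod z \<Longrightarrow> cmod z < r + e \<Longrightarrow> z \<in> V"
    using sphere_neighbourhood[OF *(1,3)] *(5) by (metis le_sup_iff)
  define s where "s = min 1 (r + e)"
  have s: "r < s" "s \<le> 1" using e(1) *(2) by (auto simp: s_def)
  have "cusp_disc s \<subseteq> V"
  proof
    fix z assume z: "z \<in> cusp_disc s"
    show "z \<in> V"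
    proof (cases "cmod z < r")
      case True
      then show ?thesis using z *(5) by (auto simp: cusp_disc_def)
    next
      case False
      then show ?thesis using z e by (intro e(2)) (auto simp: cusp_disc_def s_def)
    qed
  qed
  then have "isometric_embedding X A \<rho> (cusp_disc s) \<phi>"
    using *(6) isometric_embedding_subset by blast
  then obtain \<psi> where "cusp_coordinate P s \<psi>" "\<And>r. \<psi> ` sphere 0 r = \<phi> ` sphere 0 r"
    using isometric_embedding_orient[OF P _ s(2) _ *(7)] s(1) *(1) by (metis less_trans)
  then show ?thesis using that *(1,8,9) s(1) by metis
qed

lemma ex_cusp_coordinate:
  assumes "P \<in> cusps X Y \<iota>"
  obtains r \<phi> where "cusp_coordinate P r \<phi>"
  using assms compactification horocyclic_nhdD[OF assms]
  unfolding conformal_compactification_def by metis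

text \<open>Each cusp is isolated, and the compactification is compact.\<close>

lemma finite_cusps: "finite (cusps X Y \<iota>)"
proof -
  define W where "W P = (SOME W. openin Y W \<and> P \<in> W \<and> W \<inter> cusps X Y \<iota> = {P})" for P
  have W: "openin Y (W P) \<and> P \<in> W P \<and> W P \<inter> cusps X Y \<iota> = {P}" if P: "P \<in> cusps X Y \<iota>" for P
    unfolding W_def
  proof (rule someI_ex)
    obtain r \<phi> where cc: "cusp_coordinate P r \<phi>" using ex_cusp_coordinate[OF P] .
    note D = cusp_coordinateD[OF cc]
    have "openin Y (insert P (\<iota> ` \<phi> ` cusp_disc r))"
      using extend_cusp_open[OF cc, of "ball 0 r"] extend_cusp_image[OF D(2)] by simp
    moreover have "insert P (\<iota> ` \<phi> ` cusp_disc r) \<inter> cusps X Y \<iota> = {P}"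
      using P D(8) by (auto simp: cusps_iff)
    ultimately show "\<exists>W. openin Y W \<and> P \<in> W \<and> W \<inter> cusps X Y \<iota> = {P}" by blast
  qed
  let ?U = "insert (\<iota> ` topspace X) (W ` cusps X Y \<iota>)"
  have "topspace Y \<subseteq> \<Union>?U" "\<forall>U\<in>?U. openin Y U" using W \<iota>(4) by (auto simp: cusps_iff) 
  then obtain \<F> where \<F>: "finite \<F>" "\<F> \<subseteq> ?U" "topspace Y \<subseteq> \<Union>\<F>"
    using compact_Y unfolding compact_space_alt by meson
  have "cusps X Y \<iota> \<subseteq> (\<Union>F\<in>\<F>. F \<inter> cusps X Y \<iota>)"
    using \<F>(3) by (auto simp: cusps_iff)
  moreover have "finite (F \<inter> cusps X Y \<iota>)" if "F \<in> \<F>" for F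
  proof -
    have "F = \<iota> ` topspace X \<or> F \<in> W ` cusps X Y \<iota>" using \<F>(2) that by blast
    then show ?thesis
    proof
      assume "F = \<iota> ` topspace X"
      then have "F \<inter> cusps X Y \<iota> = {}" by (auto simp: cusps_iff)
      then show ?thesis by simp
    next
      assume "F \<in> W ` cusps X Y \<iota>"
      then obtain P where "P \<in> cusps X Y \<iota>" "F = W P" by blast
      then show ?thesis using W[of P] by simp
    qed
  qed
  ultimately show ?thesis using \<F>(1) by (meson finite_UN_I finite_subset)
qed

end

section \<open>Boundary regularity of horocyclic neighbourhoods\<close>

lemma chart_preimage_compact_closed:
  assumes c: "is_chart X c" and X: "Hausdorff_space X" and K: "compact K" "K \<subseteq> snd c ` fst c"
  shows "closedin X (fst c \<inter> snd c -` K)"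
proof (rule compactin_imp_closedin[OF X])
  let ?g = "inv_into (fst c) (snd c)"
  have "compactin (top_of_set (snd c ` fst c)) K"
    using K by (simp add: compactin_subtopology)
  then have "compactin X (?g ` K)" using chart_inverse_continuous[OF c] by (rule image_compactin)
  moreover have "?g ` K = fst c \<inter> snd c -` K"
    using K(2) is_chartD(8)[OF c] by (force simp: image_iff)
  ultimately show "compactin X (fst c \<inter> snd c -` K)" by simp
qed

lemma half_disc_limit_point:
  assumes "\<kappa> > 0"
  shows "\<zeta> \<in> closure (half_disc \<zeta> \<kappa>)" "at \<zeta> within half_disc \<zeta> \<kappa> \<noteq> bot"
proof -
  show cl: "\<zeta> \<in> closure (half_disc \<zeta> \<kappa>)"
    unfolding closure_approachable
  proof (intro allI impI)
    fix e :: real assume "e > 0"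
    then show "\<exists>y\<in>half_disc \<zeta> \<kappa>. dist y \<zeta> < e"
      using assms by (intro bexI[of _ "\<zeta> - of_real (min e \<kappa> / 2)"]) (auto simp: half_disc_def dist_norm)
  qed
  then have "\<zeta> islimpt half_disc \<zeta> \<kappa>" by (auto simp: closure_def half_disc_def)
  then show "at \<zeta> within half_disc \<zeta> \<kappa> \<noteq> bot" by (simp add: trivial_limit_within)
qed

lemma bounded_deriv_imp_boundary_limit:
  assumes T: "open T" "convex T" "f holomorphic_on T" and M: "\<And>z. z \<in> T \<Longrightarrow> cmod (deriv f z) \<le> M"
    and x: "x \<in> closure T"
  obtains l where "(f \<longlongrightarrow> l) (at x within T)"
proof -
  have lip: "cmod (f u - f v) \<le> M * cmod (u - v)" if "u \<in> T" "v \<in> T" for u v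
    by (rule field_differentiable_bound[OF T(2) has_field_derivative_at_within[OF holomorphic_derivI[OF T(3,1)]] M])
       (use that in auto)
  have "uniformly_continuous_on T f"
    unfolding uniformly_continuous_on_def
  proof (intro allI impI)
    fix e :: real assume e: "e > 0"
    show "\<exists>d>0. \<forall>x\<in>T. \<forall>x'\<in>T. dist x' x < d \<longrightarrow> dist (f x') (f x) < e"
    proof (intro exI conjI ballI impI)
      show "e / (\<bar>M\<bar> + 1) > 0" using e by simp
      fix u v assume uv: "u \<in> T" "v \<in> T" "dist v u < e / (\<bar>M\<bar> + 1)"
      have "dist (f v) (f u) \<le> M * dist v u" using lip[OF uv(2,1)] by (simp add: dist_norm)
      also have "\<dots> \<le> (\<bar>M\<bar> + 1) * dist v u" by (intro mult_right_mono) auto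
      also have "\<dots> < e" using uv(3) by (simp add: field_simps)
      finally show "dist (f v) (f u) < e" .
    qed
  qed
  then show ?thesis using uniformly_continuous_on_extension_at_closure[OF _ x] that by blast
qed

lemma isCont_dz:
  assumes "open S" "C_k_on 1 S u" "z \<in> S"
  shows "isCont (dz u) z"
proof -
  have "continuous_on S (dir_deriv 1 u)" "continuous_on S (dir_deriv \<i> u)" using assms(2) by auto
  then have "continuous_on S (\<lambda>z. Complex (dir_deriv 1 u z) (- dir_deriv \<i> u z))"
    by (intro continuous_intros)
  then have "continuous_on S (dz u)" by (simp add: dz_def[abs_def])
  then show ?thesis using assms(1,3) by (simp add: continuous_on_eq_continuous_at)
qed

context cusp_surface
begin

text \<open>The embedding of a horocyclic neighbourhood need not extend over the bounding horocycle, but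
  in the coordinate \<open>log z\<close> its first two derivatives are locally bounded: the first because it is an
  isometry, and the second because \<open>conformal_change\<close> expresses it by the first one and the densities. So
  the map and its derivative have boundary values, and by the same formula so has the second
  derivative, whose value says that the boundary is curved like a horocycle.\<close>

lemma horocycle_boundary_expansion:
  assumes cc: "cusp_coordinate P r \<phi>" and r: "r < 1" and c: "c \<in> A" and p: "p \<in> fst c"
    and \<zeta>: "\<And>n. Re (\<zeta> n) < ln r" "\<zeta> \<longlonglongrightarrow> \<zeta>0" "Re \<zeta>0 = ln r"
    and lim: "limitin X (\<lambda>n. \<phi> (exp (\<zeta> n))) p sequentially"
  defines "\<Xi> \<equiv> \<lambda>z. snd c (\<phi> (exp z))"
  obtains \<kappa> \<Lambda> where "\<kappa> > 0"
    "\<And>z. z \<in> half_disc \<zeta>0 \<kappa> \<Longrightarrow> \<phi> (exp z) \<in> fst c"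
    "\<Xi> holomorphic_on half_disc \<zeta>0 \<kappa>"
    "(\<Xi> \<longlongrightarrow> snd c p) (at \<zeta>0 within half_disc \<zeta>0 \<kappa>)"
    "(deriv \<Xi> \<longlongrightarrow> \<Lambda>) (at \<zeta>0 within half_disc \<zeta>0 \<kappa>)"
    "\<rho> c (snd c p) * cmod \<Lambda> * (- ln r) = 1"
    "(deriv (deriv \<Xi>) \<longlongrightarrow> \<Lambda> * (1 / of_real (- ln r) - dz (\<lambda>z. ln (\<rho> c z)) (snd c p) * \<Lambda>))
       (at \<zeta>0 within half_disc \<zeta>0 \<kappa>)"
proof -
  note D = cusp_coordinateD[OF cc] and ch = atlasD[OF atlas_X c]
  note CD = is_chartD[OF ch]
  define H where "H = {z. Re z < ln r}"
  define y0 where "y0 = - ln r"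
  have y0: "y0 > 0" using D(2) r by (simp add: y0_def)
  have H: "open H" "z \<in> H \<Longrightarrow> exp z \<in> cusp_disc r" for z
  proof -
    show "open H" unfolding H_def by (rule open_halfspace_Re_lt)
    assume "z \<in> H"
    then have "exp (Re z) < exp (ln r)" by (simp add: H_def del: exp_ln_iff)
    then show "exp z \<in> cusp_disc r" using D(2) by (simp add: cusp_disc_def)
  qed
  have d\<Xi>: "\<Xi> field_differentiable (at z)" "\<rho> c (\<Xi> z) * cmod (deriv \<Xi> z) = 1 / (- Re z)"
    if z: "z \<in> H" "\<phi> (exp z) \<in> fst c" for z
  proof -
    have f: "(snd c \<circ> \<phi> has_field_derivative deriv (snd c \<circ> \<phi>) (exp z)) (at (exp z))"
      using D(9)[OF c H(2)[OF z(1)] z(2)] by (rule field_differentiable_derivI)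
    have g: "(\<Xi> has_field_derivative deriv (snd c \<circ> \<phi>) (exp z) * exp z) (at z)"
      using DERIV_chain2[OF f DERIV_exp] by (simp add: \<Xi>_def)
    then show "\<Xi> field_differentiable (at z)" by (auto simp: field_differentiable_def)
    have "\<rho> c (\<Xi> z) * cmod (deriv \<Xi> z) = cusp_density (exp z) * exp (Re z)"
      unfolding DERIV_imp_deriv[OF g] norm_mult norm_exp_eq_Re D(10)[OF c H(2)[OF z(1)] z(2), symmetric]
      by (simp add: \<Xi>_def)
    then show "\<rho> c (\<Xi> z) * cmod (deriv \<Xi> z) = 1 / (- Re z)" by (simp add: cusp_density_def)
  qed
  have contE: "continuous_map (top_of_set H) X (\<phi> \<circ> exp)"
  proof (rule continuous_map_compose[OF _ D(4)])
    show "continuous_map (top_of_set H) (top_of_set (cusp_disc r)) exp"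
      using H(2) by (auto simp: continuous_map_in_subtopology intro: continuous_intros)
  qed
  obtain \<epsilon> where \<epsilon>: "\<epsilon> > 0" "cball (snd c p) \<epsilon> \<subseteq> snd c ` fst c"
    using CD(2) p open_contains_cball by blast
  have Csm: "C_infinity_on (snd c ` fst c) (\<rho> c)" "\<And>z. z \<in> snd c ` fst c \<Longrightarrow> \<rho> c z > 0"
    using conformal_\<rho> c by (auto simp: conformal_metric_def)
  define U where "U = (\<lambda>z. ln (\<rho> c z))"
  have CU: "C_infinity_on (snd c ` fst c) U" unfolding U_def by (rule C_infinity_on_ln[OF CD(2) Csm])
  have contU: "isCont (dz U) z" if "z \<in> snd c ` fst c" for z
    by (rule isCont_dz[OF CD(2) _ that]) (use CU in \<open>unfold C_infinity_on_def, blast\<close>)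
  have cont\<rho>: "continuous_on (snd c ` fst c) (\<rho> c)"
    using Csm(1) unfolding C_infinity_on_def by (metis C_k_on.simps(1))
  have "\<exists>x\<in>cball (snd c p) \<epsilon>. \<forall>y\<in>cball (snd c p) \<epsilon>. \<rho> c x \<le> \<rho> c y"
    using \<epsilon> cont\<rho> by (intro continuous_attains_inf) (auto intro: continuous_on_subset)
  then obtain m where m: "m > 0" "\<And>z. z \<in> cball (snd c p) \<epsilon> \<Longrightarrow> m \<le> \<rho> c z"
    using Csm(2) \<epsilon>(2) by (meson subsetD)
  have "compact (dz U ` cball (snd c p) \<epsilon>)"
    using contU \<epsilon>(2) by (intro compact_continuous_image continuous_at_imp_continuous_on) auto
  then obtain M2 where M2: "M2 > 0" "\<And>z. z \<in> cball (snd c p) \<epsilon> \<Longrightarrow> cmod (dz U z) \<le> M2"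
    using bounded_pos compact_imp_bounded by (metis imageI)
  define M1 where "M1 = 1 / (m * y0)"
  have M1: "M1 > 0" using m y0 by (simp add: M1_def)
  define G where "G = {z \<in> H. \<phi> (exp z) \<in> fst c \<and> \<Xi> z \<in> ball (snd c p) \<epsilon>}"
  have G: "open G"
  proof -
    have "open (H \<inter> (\<phi> \<circ> exp) -` (fst c \<inter> snd c -` ball (snd c p) \<epsilon>))"
      by (rule open_plane_preimage[OF H(1) contE CD(7)[OF open_ball]])
    moreover have "H \<inter> (\<phi> \<circ> exp) -` (fst c \<inter> snd c -` ball (snd c p) \<epsilon>) = G"
      by (auto simp: G_def \<Xi>_def)
    ultimately show ?thesis by (simp only:)
  qed
  have bound: "cmod (deriv \<Xi> z) \<le> M1" if "z \<in> G" for z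
  proof -
    have z: "z \<in> H" "\<phi> (exp z) \<in> fst c" "\<Xi> z \<in> cball (snd c p) \<epsilon>" using that by (auto simp: G_def)
    have "m * cmod (deriv \<Xi> z) \<le> \<rho> c (\<Xi> z) * cmod (deriv \<Xi> z)"
      by (intro mult_right_mono m(2) z(3)) auto
    also have "\<dots> = 1 / (- Re z)" by (rule d\<Xi>(2)[OF z(1,2)])
    also have "\<dots> \<le> 1 / y0" using z(1) y0 by (intro divide_left_mono) (auto simp: H_def y0_def mult_neg_neg)
    finally show ?thesis using m(1) y0 by (simp add: M1_def field_simps)
  qed
  define \<kappa> where "\<kappa> = \<epsilon> / (8 * M1)"
  have \<kappa>: "\<kappa> > 0" using \<epsilon> M1 by (simp add: \<kappa>_def)
  let ?T = "half_disc \<zeta>0 \<kappa>"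
  have TH: "?T \<subseteq> H" using \<zeta>(3) by (auto simp: half_disc_def H_def)
  have limc: "eventually (\<lambda>n. \<phi> (exp (\<zeta> n)) \<in> fst c) sequentially" "(\<lambda>n. \<Xi> (\<zeta> n)) \<longlonglongrightarrow> snd c p"
    using lim unfolding limitin_chart[OF ch p] \<Xi>_def by auto
  have \<zeta>T: "eventually (\<lambda>n. \<zeta> n \<in> ?T) sequentially"
    using tendstoD[OF \<zeta>(2) \<kappa>] by (rule eventually_mono) (use \<zeta>(1,3) in \<open>auto simp: half_disc_def dist_commute\<close>)
  have "eventually (\<lambda>n. \<phi> (exp (\<zeta> n)) \<in> fst c \<and> dist (\<Xi> (\<zeta> n)) (snd c p) < \<epsilon> / 4 \<and> \<zeta> n \<in> ?T) sequentially"
    using limc(1) tendstoD[OF limc(2), of "\<epsilon> / 4"] \<epsilon>(1) \<zeta>T by (auto intro: eventually_conj)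
  then obtain n where "\<phi> (exp (\<zeta> n)) \<in> fst c \<and> dist (\<Xi> (\<zeta> n)) (snd c p) < \<epsilon> / 4 \<and> \<zeta> n \<in> ?T"
    using eventually_happens by fastforce
  then obtain z0 where z0: "z0 \<in> ?T" "\<phi> (exp z0) \<in> fst c" "dist (\<Xi> z0) (snd c p) < \<epsilon> / 4" by blast
  \<comment> \<open>Isometry bounds the speed, so short paths from a point near \<open>p\<close> cannot leave the chart.\<close>
  have TO: "?T \<subseteq> G"
  proof
    fix z assume z: "z \<in> ?T"
    define \<gamma> where "\<gamma> = (\<lambda>s::real. z0 + of_real s * (z - z0))"
    have \<gamma>T: "\<gamma> s \<in> ?T" if "0 \<le> s" "s \<le> 1" for s
    proof -
      have "\<gamma> s = (1 - s) *\<^sub>R z0 + s *\<^sub>R z" by (simp add: \<gamma>_def scaleR_conv_of_real algebra_simps)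
      then show ?thesis using convexD[OF half_disc_simps(2) z0(1) z, of "1 - s" s] that by simp
    qed
    define C where "C = {z \<in> H. \<phi> (exp z) \<in> fst c \<and> \<Xi> z \<in> cball (snd c p) (\<epsilon> / 2)}"
    have "closedin X (fst c \<inter> snd c -` cball (snd c p) (\<epsilon> / 2))"
      using \<epsilon> by (intro chart_preimage_compact_closed[OF ch Hausdorff(1)]) auto
    then have "closedin (top_of_set H) {z \<in> topspace (top_of_set H). (\<phi> \<circ> exp) z \<in> fst c \<inter> snd c -` cball (snd c p) (\<epsilon> / 2)}"
      by (rule closedin_continuous_map_preimage[OF contE])
    moreover have "{z \<in> topspace (top_of_set H). (\<phi> \<circ> exp) z \<in> fst c \<inter> snd c -` cball (snd c p) (\<epsilon> / 2)} = C"
      by (auto simp: C_def \<Xi>_def)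
    ultimately obtain K where K: "closed K" "C = H \<inter> K" by (auto simp: closedin_closed)
    have step: "\<gamma> s \<in> C" if s: "0 \<le> s" "s \<le> 1" and sub: "\<And>s'. 0 \<le> s' \<Longrightarrow> s' \<le> s \<Longrightarrow> \<gamma> s' \<in> G" for s
    proof -
      have seg: "closed_segment z0 (\<gamma> s) \<subseteq> G"
      proof
        fix x assume "x \<in> closed_segment z0 (\<gamma> s)"
        then obtain u where u: "0 \<le> u" "u \<le> 1" "x = (1 - u) *\<^sub>R z0 + u *\<^sub>R \<gamma> s"
          by (auto simp: closed_segment_def)
        then have "x = \<gamma> (u * s)" by (simp add: \<gamma>_def scaleR_conv_of_real algebra_simps)
        moreover have "u * s \<le> s" using u s by (simp add: mult_left_le_one_le)
        ultimately show "x \<in> G" using sub[of "u * s"] u s by simp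
      qed
      have "cmod (\<Xi> (\<gamma> s) - \<Xi> z0) \<le> M1 * cmod (\<gamma> s - z0)"
      proof (rule field_differentiable_bound[of "closed_segment z0 (\<gamma> s)" \<Xi> "deriv \<Xi>"])
        fix x assume "x \<in> closed_segment z0 (\<gamma> s)"
        then have x: "x \<in> G" using seg by auto
        then show "cmod (deriv \<Xi> x) \<le> M1" by (rule bound)
        show "(\<Xi> has_field_derivative deriv \<Xi> x) (at x within closed_segment z0 (\<gamma> s))"
        proof (rule has_field_derivative_at_within, rule field_differentiable_derivI)
          show "\<Xi> field_differentiable (at x)" using x by (intro d\<Xi>(1)) (auto simp: G_def)
        qed
      qed auto
      also have "cmod (\<gamma> s - z0) \<le> 2 * \<kappa>"
      proof -
        have "dist (\<gamma> s) \<zeta>0 < \<kappa>" "dist z0 \<zeta>0 < \<kappa>" using \<gamma>T[OF s] z0(1) by (auto simp: half_disc_def dist_commute)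
        then show ?thesis using dist_triangle2[of "\<gamma> s" z0 \<zeta>0] by (simp add: dist_norm)
      qed
      finally have "cmod (\<Xi> (\<gamma> s) - \<Xi> z0) \<le> \<epsilon> / 4" using M1 by (simp add: \<kappa>_def mult_left_mono)
      then have "dist (\<Xi> (\<gamma> s)) (snd c p) \<le> \<epsilon> / 2"
        using z0(3) dist_triangle[of "\<Xi> (\<gamma> s)" "snd c p" "\<Xi> z0"] by (simp add: dist_norm)
      then show ?thesis using sub[OF s(1) order_refl] by (simp add: C_def G_def dist_commute)
    qed
    have CO: "C \<subseteq> G" using \<epsilon>(1) by (auto simp: C_def G_def)
    define B where "B = {0..1} \<inter> \<gamma> -` (- G)"
    have "B = {}"
    proof (rule ccontr)
      assume "B \<noteq> {}"
      have cont\<gamma>: "isCont \<gamma> s" for s unfolding \<gamma>_def by (intro continuous_intros)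
      then have "closed (\<gamma> -` (- G))" using G by (intro continuous_closed_vimage) auto
      then have "closed B" by (auto simp: B_def)
      define s1 where "s1 = Inf B"
      have s1: "s1 \<in> B" unfolding s1_def
        by (rule closed_contains_Inf[OF \<open>B \<noteq> {}\<close> _ \<open>closed B\<close>]) (auto simp: B_def)
      have lt: "\<gamma> s \<in> G" if "0 \<le> s" "s < s1" for s
      proof (rule ccontr)
        assume "\<gamma> s \<notin> G"
        then have "s \<in> B" using that s1 by (auto simp: B_def)
        then have "s1 \<le> s" unfolding s1_def by (rule cInf_lower) (auto simp: B_def)
        then show False using that by simp
      qed
      have "z0 \<in> G" using z0 TH \<epsilon>(1) by (auto simp: G_def dist_commute)
      then have "s1 \<noteq> 0" using s1 by (auto simp: B_def \<gamma>_def)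
      then have s10: "s1 > 0" "s1 \<le> 1" using s1 by (auto simp: B_def)
      have "eventually (\<lambda>s. \<gamma> s \<in> K) (at_left s1)"
        unfolding eventually_at_left_field
      proof (intro exI[of _ 0] conjI allI impI)
        fix s assume "0 < s" "s < s1"
        then have "\<gamma> s \<in> C" using lt s10 by (intro step) auto
        then show "\<gamma> s \<in> K" using K by simp
      qed (use s10 in simp)
      moreover have "(\<gamma> \<longlongrightarrow> \<gamma> s1) (at_left s1)"
        by (rule tendsto_within_subset[OF cont\<gamma>[unfolded isCont_def] subset_UNIV])
      ultimately have "\<gamma> s1 \<in> K" by (intro Lim_in_closed_set[OF K(1)]) auto
      moreover have "\<gamma> s1 \<in> H" using \<gamma>T[of s1] s10 TH by auto
      ultimately have "\<gamma> s1 \<in> G" using K CO by auto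
      then show False using s1 by (simp add: B_def)
    qed
    have "\<gamma> 1 \<in> G"
    proof (rule ccontr)
      assume "\<gamma> 1 \<notin> G"
      then have "1 \<in> B" by (simp add: B_def)
      then show False using \<open>B = {}\<close> by simp
    qed
    then show "z \<in> G" by (simp add: \<gamma>_def)
  qed
  have TT: "open ?T" "convex ?T" by (rule half_disc_simps)+
  have inT: "z \<in> H" "\<phi> (exp z) \<in> fst c" "\<Xi> z \<in> cball (snd c p) \<epsilon>" if "z \<in> ?T" for z
    using TO that by (auto simp: G_def)
  have hol: "\<Xi> holomorphic_on ?T"
    unfolding holomorphic_on_def
    by (rule ballI, rule field_differentiable_at_within, rule d\<Xi>(1)[OF inT(1,2)])
  have hol': "deriv \<Xi> holomorphic_on ?T" by (rule holomorphic_deriv[OF hol TT(1)])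
  have bT: "cmod (deriv \<Xi> z) \<le> M1" if "z \<in> ?T" for z using bound TO that by auto
  have pos: "\<rho> c (\<Xi> z) > 0" if "z \<in> ?T" for z using inT[OF that] Csm(2) \<epsilon>(2) by auto
  have neg: "Re z < 0" if "z \<in> ?T" for z using inT(1)[OF that] y0 by (simp add: H_def y0_def)
  have nz: "deriv \<Xi> z \<noteq> 0" if "z \<in> ?T" for z
    using d\<Xi>(2)[OF inT(1,2)[OF that]] neg[OF that] by auto
  have second: "deriv (deriv \<Xi>) z = deriv \<Xi> z * (1 / of_real (- Re z) - dz U (\<Xi> z) * deriv \<Xi> z)"
    if z: "z \<in> ?T" for z
  proof -
    have "deriv (deriv \<Xi>) z / deriv \<Xi> z = dz (\<lambda>z. - ln (- Re z)) z - dz U (\<Xi> z) * deriv \<Xi> z"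
    proof (rule conformal_change[OF TT(1) hol z nz])
      have "\<Xi> z \<in> snd c ` fst c" using inT(3)[OF z] \<epsilon>(2) by auto
      then show "U differentiable (at (\<Xi> z))"
        by (rule C_2_differentiable(1)[OF C_infinity_on_C_2[OF CU]])
      fix w assume w: "w \<in> ?T"
      have "ln (\<rho> c (\<Xi> w)) + ln (cmod (deriv \<Xi> w)) = ln (\<rho> c (\<Xi> w) * cmod (deriv \<Xi> w))"
        using pos[OF w] nz[OF w] by (simp add: ln_mult)
      also have "\<dots> = ln (inverse (- Re w))" using d\<Xi>(2)[OF inT(1,2)[OF w]] by (simp add: inverse_eq_divide)
      also have "\<dots> = - ln (- Re w)" by (rule ln_inverse)
      finally show "U (\<Xi> w) + ln (cmod (deriv \<Xi> w)) = - ln (- Re w)" by (simp add: U_def)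
    qed
    also have "dz (\<lambda>z. - ln (- Re z)) z = 1 / of_real (- Re z)"
    proof (rule dz_eqI)
      have "((\<lambda>z. - ln (- Re z)) has_derivative (\<lambda>v. Re v / (- Re z))) (at z)"
        using neg[OF z] by (auto intro!: derivative_eq_intros simp: divide_simps)
      moreover have "Re (1 / of_real (- Re z) * v) = Re v / (- Re z)" for v
        using Re_divide_of_real[of v "- Re z"] by simp
      ultimately show "((\<lambda>z. - ln (- Re z)) has_derivative (\<lambda>v. Re (1 / of_real (- Re z) * v))) (at z)"
        by simp
    qed
    finally show ?thesis using nz[OF z] by (simp add: field_simps)
  qed
  have bT2: "cmod (deriv (deriv \<Xi>) z) \<le> M1 * (1 / y0 + M2 * M1)" if z: "z \<in> ?T" for z
  proof -
    have "cmod (1 / of_real (- Re z)) = 1 / (- Re z)"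
      unfolding norm_divide norm_of_real using neg[OF z] by simp
    also have "\<dots> \<le> 1 / y0"
      using inT(1)[OF z] y0 by (intro divide_left_mono) (auto simp: H_def y0_def mult_neg_neg)
    finally have "cmod (1 / of_real (- Re z)) \<le> 1 / y0" .
    moreover have "cmod (dz U (\<Xi> z) * deriv \<Xi> z) \<le> M2 * M1"
      unfolding norm_mult using M2 M1 inT(3)[OF z] bT[OF z] by (intro mult_mono) auto
    ultimately have "cmod (1 / of_real (- Re z) - dz U (\<Xi> z) * deriv \<Xi> z) \<le> 1 / y0 + M2 * M1"
      using norm_triangle_ineq4[of "1 / of_real (- Re z)" "dz U (\<Xi> z) * deriv \<Xi> z"] by linarith
    then show ?thesis unfolding second[OF z] norm_mult using bT[OF z] M1 by (intro mult_mono) auto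
  qed
  note lp = half_disc_limit_point[OF \<kappa>, of \<zeta>0]
  obtain l where l: "(\<Xi> \<longlongrightarrow> l) (at \<zeta>0 within ?T)"
    by (rule bounded_deriv_imp_boundary_limit[OF TT hol bT lp(1)])
  obtain \<Lambda> where \<Lambda>: "(deriv \<Xi> \<longlongrightarrow> \<Lambda>) (at \<zeta>0 within ?T)"
    by (rule bounded_deriv_imp_boundary_limit[OF TT hol' bT2 lp(1)])
  have "filterlim \<zeta> (at \<zeta>0 within ?T) sequentially"
    using \<zeta>(2) by (rule filterlim_at[THEN iffD2, OF conjI[rotated]])
      (use \<zeta>T in \<open>auto elim!: eventually_mono simp: half_disc_def\<close>)
  then have "(\<lambda>n. \<Xi> (\<zeta> n)) \<longlonglongrightarrow> l" by (rule filterlim_compose[OF l])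
  then have lp': "l = snd c p" using limc(2) LIMSEQ_unique by blast
  have pim: "snd c p \<in> snd c ` fst c" using p by simp
  have "isCont (\<rho> c) (snd c p)" using cont\<rho> CD(2) pim continuous_on_eq_continuous_at by blast
  then have 1: "((\<lambda>z. \<rho> c (\<Xi> z)) \<longlongrightarrow> \<rho> c (snd c p)) (at \<zeta>0 within ?T)"
    using l unfolding lp' by (rule isCont_tendsto_compose)
  have 2: "((\<lambda>z. dz U (\<Xi> z)) \<longlongrightarrow> dz U (snd c p)) (at \<zeta>0 within ?T)"
    using contU[OF pim] l unfolding lp' by (rule isCont_tendsto_compose)
  have 3: "((\<lambda>z. - Re z) \<longlongrightarrow> - ln r) (at \<zeta>0 within ?T)"
    unfolding \<zeta>(3)[symmetric] by (intro tendsto_intros)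
  have evT: "eventually (\<lambda>z. z \<in> ?T) (at \<zeta>0 within ?T)" by (simp add: eventually_at_filter)
  have "((\<lambda>z. \<rho> c (\<Xi> z) * cmod (deriv \<Xi> z) * (- Re z)) \<longlongrightarrow> \<rho> c (snd c p) * cmod \<Lambda> * (- ln r)) (at \<zeta>0 within ?T)"
    by (intro tendsto_intros 1 3 \<Lambda>)
  moreover have "((\<lambda>z. \<rho> c (\<Xi> z) * cmod (deriv \<Xi> z) * (- Re z)) \<longlongrightarrow> 1) (at \<zeta>0 within ?T)"
  proof (rule tendsto_eventually, rule eventually_mono[OF evT])
    fix z assume z: "z \<in> ?T"
    show "\<rho> c (\<Xi> z) * cmod (deriv \<Xi> z) * (- Re z) = 1"
      unfolding d\<Xi>(2)[OF inT(1,2)[OF z]] using neg[OF z] by simp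
  qed
  ultimately have norm\<Lambda>: "\<rho> c (snd c p) * cmod \<Lambda> * (- ln r) = 1" using lp(2) tendsto_unique by blast
  have "((\<lambda>z. deriv \<Xi> z * (1 / of_real (- Re z) - dz U (\<Xi> z) * deriv \<Xi> z))
      \<longlongrightarrow> \<Lambda> * (1 / of_real (- ln r) - dz U (snd c p) * \<Lambda>)) (at \<zeta>0 within ?T)"
    using y0 by (intro tendsto_intros 2 3 \<Lambda>) (auto simp: y0_def)
  then have "(deriv (deriv \<Xi>) \<longlongrightarrow> \<Lambda> * (1 / of_real (- ln r) - dz U (snd c p) * \<Lambda>)) (at \<zeta>0 within ?T)"
    by (rule Lim_transform_eventually) (rule eventually_mono[OF evT], rule second[symmetric])
  then show ?thesis
    using that[OF \<kappa> inT(2) hol l[unfolded lp'] \<Lambda> norm\<Lambda>] unfolding U_def by blast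
qed

end

section \<open>Negatively curved metrics force long horocycles\<close>

text \<open>The situation of a metric \<open>\<sigma>\<close> on the compactification that agrees with the hyperbolic one outside
  disjoint horocyclic neighbourhoods of radii \<open>R P\<close>.\<close>

locale capped_surface = cusp_surface X A \<rho> Y B \<iota>
  for X :: "'a topology" and A :: "'a chart set" and \<rho> :: "'a density"
    and Y :: "'b topology" and B :: "'b chart set" and \<iota> :: "'a \<Rightarrow> 'b" +
  fixes R :: "'b \<Rightarrow> real" and \<Phi> :: "'b \<Rightarrow> complex \<Rightarrow> 'a" and \<sigma> :: "'b density"
  assumes coord: "\<And>P. P \<in> cusps X Y \<iota> \<Longrightarrow> cusp_coordinate P (R P) (\<Phi> P)"
    and R_less_1: "\<And>P. P \<in> cusps X Y \<iota> \<Longrightarrow> R P < 1"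
    and disjoint: "disjoint_family_on (\<lambda>P. \<Phi> P ` cusp_disc (R P)) (cusps X Y \<iota>)"
    and \<sigma>: "conformal_metric Y B \<sigma>" "negatively_curved B \<sigma>"
    and outside: "\<And>x. x \<in> topspace X - (\<Union>P\<in>cusps X Y \<iota>. \<Phi> P ` cusp_disc (R P))
      \<Longrightarrow> pullback_eq_at A \<rho> B \<sigma> \<iota> x"
begin

definition thick :: "'a set" where
  "thick = topspace X - (\<Union>P\<in>cusps X Y \<iota>. \<Phi> P ` cusp_disc (R P))"

sublocale pb: local_metrics X A Y \<iota> B "\<lambda>d. d" \<sigma>
  by (rule local_metrics_conformal[OF atlas_X atlas_Y \<iota>(1-3) \<sigma>(1)])

lemma pb_pos: "c \<in> A \<Longrightarrow> z \<in> snd c ` fst c \<Longrightarrow> pb.pullback c z > 0"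
  using pb.conformal by (auto simp: conformal_metric_def)

text \<open>The logarithm of the ratio of \<open>\<sigma>\<close> to the hyperbolic metric, in a chart and as a function on the surface.\<close>

definition log_ratio :: "'a chart \<Rightarrow> complex \<Rightarrow> real" where
  "log_ratio c z = ln (pb.pullback c z) - ln (\<rho> c z)"

definition ratio :: "'a \<Rightarrow> real" where
  "ratio x = (let c = SOME c. c \<in> A \<and> x \<in> fst c in log_ratio c (snd c x))"

lemma ratio_eq:
  assumes c: "c \<in> A" "x \<in> fst c"
  shows "ratio x = log_ratio c (snd c x)"
proof -
  define e where "e = (SOME c. c \<in> A \<and> x \<in> fst c)"
  have "e \<in> A \<and> x \<in> fst e" unfolding e_def by (rule someI) (use c in blast)
  then have e: "e \<in> A" "x \<in> fst e" by auto
  have x: "x \<in> topspace X" using is_chartD(4)[OF atlasD[OF atlas_X c(1)]] c(2) by auto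
  define k where "k = cmod (deriv (in_coords id e c) (snd e x))"
  have 1: "\<rho> e (snd e x) = \<rho> c (snd c x) * k"
    using conformal_\<rho> x c e unfolding conformal_metric_def pullback_eq_at_def k_def by (metis id_apply)
  have 2: "pb.pullback e (snd e x) = pb.pullback c (snd c x) * k"
    using pb.conformal x c e unfolding conformal_metric_def pullback_eq_at_def k_def by (metis id_apply)
  have p: "\<rho> c (snd c x) > 0" "\<rho> e (snd e x) > 0" "pb.pullback c (snd c x) > 0"
    using \<rho>_pos pb_pos c e by auto
  have "k \<ge> 0" by (simp add: k_def)
  moreover have "k \<noteq> 0" using 1 p(2) by auto
  ultimately have "k > 0" by simp
  then have "log_ratio e (snd e x) = log_ratio c (snd c x)"
    using p by (simp add: log_ratio_def 1 2 ln_mult)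
  then show ?thesis by (simp add: ratio_def e_def[symmetric])
qed

lemma log_ratio_smooth: "c \<in> A \<Longrightarrow> C_infinity_on (snd c ` fst c) (log_ratio c)"
  unfolding log_ratio_def
  using pb.conformal conformal_\<rho> is_chartD(2)[OF atlasD[OF atlas_X]]
  by (intro C_infinity_on_diff C_infinity_on_ln) (auto simp: conformal_metric_def)

lemma ratio_thick:
  assumes x: "x \<in> thick"
  shows "ratio x = 0"
proof -
  have xX: "x \<in> topspace X" using x by (simp add: thick_def)
  then obtain c where c: "c \<in> A" "x \<in> fst c" using atlas_chart_at[OF atlas_X] by blast
  obtain d where d: "d \<in> B" "\<iota> x \<in> fst d" using atlas_chart_at[OF atlas_Y \<iota>_in_Y[OF xX]] by blast
  have "pullback_eq_at A \<rho> B \<sigma> \<iota> x" by (rule outside) (use x in \<open>simp add: thick_def\<close>)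
  then have "\<rho> c (snd c x) = pb.pullback c (snd c x)"
    using c d pb.pullback_eq[OF c(1) d(1) c(2) d(2)] by (simp add: pullback_eq_at_def)
  then show ?thesis using ratio_eq[OF c] by (simp add: log_ratio_def)
qed

lemma ratio_tendsto:
  assumes lim: "limitin X f p F" 
  shows "((\<lambda>n. ratio (f n)) \<longlongrightarrow> ratio p) F"
proof -
  have "p \<in> topspace X" using lim by (simp add: limitin_def)
  then obtain c where c: "c \<in> A" "p \<in> fst c" "is_chart X c" using atlas_chart_at[OF atlas_X] by blast
  have l: "eventually (\<lambda>n. f n \<in> fst c) F" "((\<lambda>n. snd c (f n)) \<longlongrightarrow> snd c p) F"
    using lim unfolding limitin_chart[OF c(3,2)] by auto
  have "continuous_on (snd c ` fst c) (log_ratio c)"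
    using log_ratio_smooth[OF c(1)] unfolding C_infinity_on_def by (metis C_k_on.simps(1))
  then have "isCont (log_ratio c) (snd c p)"
    using is_chartD(2)[OF c(3)] c(2) continuous_on_eq_continuous_at by blast
  then have "((\<lambda>n. log_ratio c (snd c (f n))) \<longlongrightarrow> ratio p) F"
    using l(2) unfolding ratio_eq[OF c(1,2)] by (rule isCont_tendsto_compose)
  then show ?thesis
    by (rule Lim_transform_eventually) (use l(1) ratio_eq[OF c(1)] in \<open>auto elim: eventually_mono\<close>)
qed

text \<open>The limit is not in the neighbourhood of \<open>P\<close>, because its parametrization is a homeomorphism
  onto an open set, and not in any other one, because these are open and disjoint from it.\<close>

lemma boundary_limit_thick:
  assumes P: "P \<in> cusps X Y \<iota>" and z: "\<And>n. z n \<in> cusp_disc (R P)" "(\<lambda>n. cmod (z n)) \<longlonglongrightarrow> R P"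
    and lim: "limitin Y (\<lambda>n. \<iota> (\<Phi> P (z n))) q sequentially"
  obtains p where "p \<in> thick" "q = \<iota> p" "limitin X (\<lambda>n. \<Phi> P (z n)) p sequentially"
proof -
  note D = cusp_coordinateD[OF coord]
  have e: "extend_cusp P (\<Phi> P) (z n) = \<iota> (\<Phi> P (z n))" for n
    using z(1)[of n] by (auto simp: extend_cusp_def cusp_disc_def)
  have notP: "q \<notin> extend_cusp P (\<Phi> P) ` ball 0 (R P)"
  proof
    assume "q \<in> extend_cusp P (\<Phi> P) ` ball 0 (R P)"
    then obtain z0 where z0: "cmod z0 < R P" "q = extend_cusp P (\<Phi> P) z0" by auto
    define s where "s = (cmod z0 + R P) / 2"
    have s: "cmod z0 < s" "s < R P" using z0 by (auto simp: s_def)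
    have "openin Y (extend_cusp P (\<Phi> P) ` ball 0 s)"
      by (rule extend_cusp_open[OF coord[OF P] open_ball]) (use s in auto)
    then have "eventually (\<lambda>n. \<iota> (\<Phi> P (z n)) \<in> extend_cusp P (\<Phi> P) ` ball 0 s) sequentially"
      using lim z0 s by (auto simp: limitin_def)
    moreover have "eventually (\<lambda>n. cmod (z n) > s) sequentially"
      using order_tendstoD(1)[OF z(2) s(2)] .
    ultimately have "eventually (\<lambda>n. False) sequentially"
    proof eventually_elim
      case (elim n)
      then obtain w where w: "cmod w < s" "extend_cusp P (\<Phi> P) (z n) = extend_cusp P (\<Phi> P) w"
        unfolding e[symmetric] by auto
      then have "z n = w"
        using extend_cusp_inj[OF coord[OF P]] z(1)[of n] s by (auto simp: cusp_disc_def dest: inj_onD)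
      then show False using w elim by simp
    qed
    then show False by simp
  qed
  have notQ: "q \<notin> extend_cusp Q (\<Phi> Q) ` ball 0 (R Q)" if Q: "Q \<in> cusps X Y \<iota>" "Q \<noteq> P" for Q
  proof
    assume "q \<in> extend_cusp Q (\<Phi> Q) ` ball 0 (R Q)"
    moreover have "openin Y (extend_cusp Q (\<Phi> Q) ` ball 0 (R Q))"
      by (rule extend_cusp_open[OF coord[OF Q(1)] open_ball]) simp
    ultimately have "eventually (\<lambda>n. \<iota> (\<Phi> P (z n)) \<in> extend_cusp Q (\<Phi> Q) ` ball 0 (R Q)) sequentially"
      using lim by (auto simp: limitin_def)
    then obtain n where "\<iota> (\<Phi> P (z n)) \<in> insert Q (\<iota> ` \<Phi> Q ` cusp_disc (R Q))"
      unfolding extend_cusp_image[OF D(2)[OF Q(1)]] using eventually_happens by force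
    moreover have "\<iota> (\<Phi> P (z n)) \<noteq> Q" using Q D(8)[OF P z(1)] by (auto simp: cusps_iff)
    ultimately obtain w where w: "w \<in> cusp_disc (R Q)" "\<iota> (\<Phi> P (z n)) = \<iota> (\<Phi> Q w)" by auto
    then have "\<Phi> P (z n) = \<Phi> Q w"
      using inj_onD[OF \<iota>(2)] D(8)[OF P z(1)] D(8)[OF Q(1)] by blast
    moreover have "\<Phi> P ` cusp_disc (R P) \<inter> \<Phi> Q ` cusp_disc (R Q) = {}"
      using disjoint P Q by (auto simp: disjoint_family_on_def)
    ultimately show False using z(1)[of n] w(1) by blast
  qed
  have "q \<notin> insert Q (\<iota> ` \<Phi> Q ` cusp_disc (R Q))" if "Q \<in> cusps X Y \<iota>" for Q
    using notP notQ that unfolding extend_cusp_image[OF D(2)[OF that], symmetric] by blast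
  then have nQ: "q \<noteq> Q" "q \<notin> \<iota> ` \<Phi> Q ` cusp_disc (R Q)" if "Q \<in> cusps X Y \<iota>" for Q
    using that by auto
  have "q \<in> topspace Y" using lim by (simp add: limitin_def)
  then obtain p where p: "p \<in> topspace X" "q = \<iota> p" using nQ(1) by (auto simp: cusps_iff)
  have "p \<in> thick" using p nQ(2) by (auto simp: thick_def)
  moreover have "limitin X (\<lambda>n. \<Phi> P (z n)) p sequentially"
    unfolding limitin_def
  proof (intro conjI allI impI p(1))
    fix U assume U: "openin X U \<and> p \<in> U"
    then have sub: "U \<subseteq> topspace X" using openin_subset by blast
    then have "openin Y (\<iota> ` U)" using U \<iota>(5) by blast
    then have "eventually (\<lambda>n. \<iota> (\<Phi> P (z n)) \<in> \<iota> ` U) sequentially"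
      using lim U p(2) by (auto simp: limitin_def)
    then show "eventually (\<lambda>n. \<Phi> P (z n) \<in> U) sequentially"
      by (rule eventually_mono) (use sub inj_onD[OF \<iota>(2)] D(8)[OF P z(1)] in blast)
  qed
  ultimately show ?thesis using that p(2) by blast
qed

text \<open>This holds uniformly along the horocycle, although the embedding need not extend to it: by
  compactness, a sequence violating it would accumulate at a point of \<open>thick\<close>, where the ratio vanishes.\<close>

lemma ratio_boundary:
  assumes P: "P \<in> cusps X Y \<iota>" and e: "e > 0"
  obtains s where "0 < s" "s < R P" "\<And>z. s < cmod z \<Longrightarrow> cmod z < R P \<Longrightarrow> \<bar>ratio (\<Phi> P z)\<bar> < e"
proof -
  note D = cusp_coordinateD[OF coord[OF P]]
  have "\<exists>s. 0 < s \<and> s < R P \<and> (\<forall>z. s < cmod z \<and> cmod z < R P \<longrightarrow> \<bar>ratio (\<Phi> P z)\<bar> < e)"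
  proof (rule ccontr)
    assume neg: "\<not> ?thesis"
    have pos: "0 < R P * (1 - 1 / real (n + 2))" for n
      using D(2) by (intro mult_pos_pos) (auto simp: field_simps)
    have "\<exists>z. R P * (1 - 1 / real (n + 2)) < cmod z \<and> cmod z < R P \<and> \<bar>ratio (\<Phi> P z)\<bar> \<ge> e" for n
    proof -
      have "R P * (1 - 1 / real (n + 2)) < R P * 1"
        using D(2) by (intro mult_strict_left_mono) auto
      then show ?thesis using neg pos[of n] by (metis mult_1_right not_less)
    qed
    then obtain z where z: "\<And>n. R P * (1 - 1 / real (n + 2)) < cmod (z n)" "\<And>n. cmod (z n) < R P"
      "\<And>n. \<bar>ratio (\<Phi> P (z n))\<bar> \<ge> e" by metis
    have zc: "z n \<in> cusp_disc (R P)" for n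
      using z(1,2)[of n] pos[of n] unfolding cusp_disc_def mem_Collect_eq by linarith
    have lim: "(\<lambda>n. cmod (z n)) \<longlonglongrightarrow> R P"
    proof (rule tendsto_sandwich)
      have "(\<lambda>n. R P * (1 - 1 / real (n + 2))) \<longlonglongrightarrow> R P * (1 - 0)"
        using LIMSEQ_ignore_initial_segment[OF lim_1_over_n, of 2] by (intro tendsto_intros) auto
      then show "(\<lambda>n. R P * (1 - 1 / real (n + 2))) \<longlonglongrightarrow> R P" by simp
    qed (use z(1,2) in \<open>auto intro!: always_eventually less_imp_le\<close>)
    obtain q k where q: "strict_mono k" "limitin Y ((\<lambda>n. \<iota> (\<Phi> P (z n))) \<circ> k) q sequentially"
      using surface_compact_imp_convergent_subsequence[OF atlas_Y compact_Y, of "\<lambda>n. \<iota> (\<Phi> P (z n))"]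
        \<iota>_in_Y[OF D(8)[OF zc]] by blast
    have limk: "(\<lambda>n. cmod (z (k n))) \<longlonglongrightarrow> R P"
      using LIMSEQ_subseq_LIMSEQ[OF lim q(1)] by (simp add: comp_def)
    obtain p where p: "p \<in> thick" "limitin X (\<lambda>n. \<Phi> P (z (k n))) p sequentially"
      using boundary_limit_thick[OF P zc limk q(2)[unfolded comp_def]] by blast
    have "(\<lambda>n. ratio (\<Phi> P (z (k n)))) \<longlonglongrightarrow> 0"
      using ratio_tendsto[OF p(2)] ratio_thick[OF p(1)] by simp
    from tendstoD[OF this e] obtain n where "dist (ratio (\<Phi> P (z (k n)))) 0 < e"
      using eventually_happens by force
    then show False using z(3)[of "k n"] by simp
  qed
  then show ?thesis using that by blast
qed

text \<open>In the closed disc the points \<open>z n\<close> have a limit point. It lies on the circle, because \<open>p\<close> is outside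
  the neighbourhood. A branch of the logarithm near the limit gives the coordinate in which the
  boundary is a line.\<close>

lemma log_coordinate_of_boundary_sequence:
  assumes P: "P \<in> cusps X Y \<iota>" and z: "\<And>n. z n \<in> cusp_disc (R P)"
    and lim: "limitin X (\<lambda>n. \<Phi> P (z n)) p sequentially" and p: "p \<in> thick"
  obtains k \<zeta> \<zeta>0 where "strict_mono (k :: nat \<Rightarrow> nat)" "\<And>n. exp (\<zeta> n) = z (k n)" "\<zeta> \<longlonglongrightarrow> \<zeta>0"
    "Re \<zeta>0 = ln (R P)" "\<And>n. Re (\<zeta> n) < ln (R P)"
proof -
  note D = cusp_coordinateD[OF coord[OF P]]
  have "z n \<in> cball 0 (R P)" for n using z[of n] by (simp add: cusp_disc_def)
  then obtain w k where w: "w \<in> cball 0 (R P)" "strict_mono (k::nat\<Rightarrow>nat)" "(z \<circ> k) \<longlonglongrightarrow> w"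
    using compact_cball[of "0::complex" "R P"] unfolding compact_def by metis
  have "cmod w = R P"
  proof (rule ccontr)
    assume "cmod w \<noteq> R P"
    then have wb: "w \<in> ball 0 (R P)" using w(1) by simp
    have "limitin (top_of_set (ball 0 (R P))) (z \<circ> k) w sequentially"
      using w(3) wb z by (simp add: limitin_subtopology cusp_disc_def)
    then have "limitin Y (extend_cusp P (\<Phi> P) \<circ> (z \<circ> k)) (extend_cusp P (\<Phi> P) w) sequentially"
      by (rule continuous_map_limit[OF extend_cusp_continuous[OF coord[OF P]]])
    moreover have "extend_cusp P (\<Phi> P) \<circ> (z \<circ> k) = (\<lambda>n. \<iota> (\<Phi> P (z (k n))))"
      using z by (auto simp: extend_cusp_def cusp_disc_def fun_eq_iff)
    ultimately have 1: "limitin Y (\<lambda>n. \<iota> (\<Phi> P (z (k n)))) (extend_cusp P (\<Phi> P) w) sequentially" by simp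
    have 2: "limitin Y (\<lambda>n. \<iota> (\<Phi> P (z (k n)))) (\<iota> p) sequentially"
      using continuous_map_limit[OF \<iota>(1) limitin_subsequence[OF lim w(2)]] by (simp add: comp_def)
    have "extend_cusp P (\<Phi> P) w = \<iota> p"
      using limitin_Hausdorff_unique[OF 1 2 _ Hausdorff(2)] by simp
    then have "\<iota> p \<in> insert P (\<iota> ` \<Phi> P ` cusp_disc (R P))"
      using wb extend_cusp_image[OF D(2), of P "\<Phi> P"] by (metis image_eqI)
    moreover have "p \<in> topspace X" "p \<notin> \<Phi> P ` cusp_disc (R P)" using p P by (auto simp: thick_def)
    ultimately show False using D(1,8) inj_onD[OF \<iota>(2), of p] by (auto simp: cusps_iff)
  qed
  then have w0: "w \<noteq> 0" using D(2) by auto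
  define \<zeta> where "\<zeta> = (\<lambda>n. Ln (z (k n) / w) + Ln w)"
  have ez: "exp (\<zeta> n) = z (k n)" for n
    using w0 z[of "k n"] by (simp add: \<zeta>_def exp_add cusp_disc_def)
  show ?thesis
  proof (rule that[OF w(2) ez])
    have "(\<lambda>n. z (k n) / w) \<longlonglongrightarrow> w / w" using w(3) w0 by (intro tendsto_intros) (auto simp: comp_def)
    then have "(\<lambda>n. Ln (z (k n) / w)) \<longlonglongrightarrow> Ln (w / w)" using w0 by (intro tendsto_Ln) auto
    then have "\<zeta> \<longlonglongrightarrow> Ln (w / w) + Ln w" unfolding \<zeta>_def by (intro tendsto_add tendsto_const)
    then show "\<zeta> \<longlonglongrightarrow> Ln w" using w0 by simp
    show "Re (Ln w) = ln (R P)" using \<open>cmod w = R P\<close> w0 by (simp add: Re_Ln)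
    fix n
    have "exp (Re (\<zeta> n)) < R P" using z[of "k n"] ez[of n] norm_exp_eq_Re[of "\<zeta> n"] by (simp add: cusp_disc_def)
    then show "Re (\<zeta> n) < ln (R P)" using D(2) by (metis exp_gt_zero ln_exp ln_less_cancel_iff)
  qed
qed

text \<open>At a point of \<open>thick\<close> in the closure of a horocyclic neighbourhood, the logarithmic ratio \<open>w\<close> of
  the two metrics vanishes along the horocycle. So its differential is normal to the horocycle, and
  its Hessian in the tangential direction is the normal derivative times the curvature; the term
  with \<open>G\<close> is the Christoffel symbol of the chart. The vector \<open>L\<close> is the outer unit normal. The
  last two claims relate the sign of the normal derivative to the behaviour of the ratio inside.\<close>

lemma horocycle_contact:
  assumes P: "P \<in> cusps X Y \<iota>" and z: "\<And>n. z n \<in> cusp_disc (R P)"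
    and lim: "limitin X (\<lambda>n. \<Phi> P (z n)) p sequentially" and p: "p \<in> thick"
    and c: "c \<in> A" "p \<in> fst c"
  defines "g \<equiv> dz (log_ratio c) (snd c p)" and "G \<equiv> dz (\<lambda>z. ln (\<rho> c z)) (snd c p)"
  obtains L where "\<rho> c (snd c p) * cmod L = 1" "Re (g * (L * \<i>)) = 0"
    "dir_deriv (L * \<i>) (dir_deriv (L * \<i>) (log_ratio c)) (snd c p) = Re (g * (L - G * L\<^sup>2))"
    "Re (g * L) > 0 \<Longrightarrow> \<exists>n. ratio (\<Phi> P (z n)) \<le> 0"
    "\<And>e s. e > 0 \<Longrightarrow> 0 < s \<Longrightarrow> s < R P \<Longrightarrow>
      (\<And>z. s < cmod z \<Longrightarrow> cmod z < R P \<Longrightarrow> ratio (\<Phi> P z) \<le> e * (ln (cmod z) - ln (R P))) \<Longrightarrow> Re (g * L) > 0"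
proof -
  note D = cusp_coordinateD[OF coord[OF P]] and ch = atlasD[OF atlas_X c(1)]
  obtain k \<zeta> \<zeta>0 where k: "strict_mono (k :: nat \<Rightarrow> nat)" and ez: "\<And>n. exp (\<zeta> n) = z (k n)"
    and \<zeta>: "\<zeta> \<longlonglongrightarrow> \<zeta>0" "Re \<zeta>0 = ln (R P)" "\<And>n. Re (\<zeta> n) < ln (R P)"
    using log_coordinate_of_boundary_sequence[OF P z lim p] by metis
  have lim': "limitin X (\<lambda>n. \<Phi> P (exp (\<zeta> n))) p sequentially"
    using limitin_subsequence[OF lim k] by (simp add: ez comp_def)
  define \<Xi> where "\<Xi> = (\<lambda>z. snd c (\<Phi> P (exp z)))"
  define y0 where "y0 = - ln (R P)"
  have y0: "y0 > 0" using D(2) R_less_1[OF P] by (simp add: y0_def)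
  obtain \<kappa> \<Lambda> where \<kappa>: "\<kappa> > 0" and in_c: "\<And>z. z \<in> half_disc \<zeta>0 \<kappa> \<Longrightarrow> \<Phi> P (exp z) \<in> fst c"
    and hol: "\<Xi> holomorphic_on half_disc \<zeta>0 \<kappa>"
    and l0: "(\<Xi> \<longlongrightarrow> snd c p) (at \<zeta>0 within half_disc \<zeta>0 \<kappa>)"
    and l1: "(deriv \<Xi> \<longlongrightarrow> \<Lambda>) (at \<zeta>0 within half_disc \<zeta>0 \<kappa>)"
    and norm\<Lambda>: "\<rho> c (snd c p) * cmod \<Lambda> * y0 = 1"
    and l2: "(deriv (deriv \<Xi>) \<longlongrightarrow> \<Lambda> * (1 / of_real y0 - G * \<Lambda>)) (at \<zeta>0 within half_disc \<zeta>0 \<kappa>)"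
    using horocycle_boundary_expansion[OF coord[OF P] R_less_1[OF P] c \<zeta>(3,1,2) lim']
    unfolding \<Xi>_def y0_def G_def by metis
  let ?T = "half_disc \<zeta>0 \<kappa>" and ?M = "\<Lambda> * (1 / of_real y0 - G * \<Lambda>)" and ?S = "snd c ` fst c"
  have oT: "open ?T" by (rule half_disc_simps)
  have oS: "open ?S" by (rule is_chartD(2)[OF ch])
  have sub: "\<Xi> ` ?T \<subseteq> ?S" using in_c by (auto simp: \<Xi>_def)
  have Cw: "C_infinity_on ?S (log_ratio c)" by (rule log_ratio_smooth[OF c(1)])
  have C2: "C_k_on 2 ?S (log_ratio c)" by (rule C_infinity_on_C_2[OF Cw])
  have pS: "snd c p \<in> ?S" using c(2) by simp
  define J where "J = (\<lambda>z. log_ratio c (\<Xi> z))"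
  have J2: "C_k_on 2 ?T J"
    unfolding J_def
    by (rule C_infinity_on_C_2[OF C_infinity_on_compose[OF oT Cw C_infinity_on_holomorphic[OF oT hol] sub]])
  have Jr: "J z = ratio (\<Phi> P (exp z))" if "z \<in> ?T" for z
    using ratio_eq[OF c(1) in_c[OF that]] by (simp add: J_def \<Xi>_def)
  have TR: "cmod (exp z) < R P" if "z \<in> ?T" for z
  proof -
    have "exp (Re z) < exp (ln (R P))" unfolding exp_less_cancel_iff using that \<zeta>(2) by (simp add: half_disc_def)
    then show ?thesis using D(2) by simp
  qed
  have bd: "(J \<longlongrightarrow> 0) (at w within ?T)" if w: "w \<in> ball \<zeta>0 \<kappa>" "Re w = Re \<zeta>0" for w
  proof (rule tendstoI)
    fix e :: real assume "e > 0"
    then obtain s where s: "0 < s" "s < R P" "\<And>z. s < cmod z \<Longrightarrow> cmod z < R P \<Longrightarrow> \<bar>ratio (\<Phi> P z)\<bar> < e"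
      using ratio_boundary[OF P] by metis
    have "((\<lambda>z. cmod (exp z)) \<longlongrightarrow> cmod (exp w)) (at w within ?T)" by (intro tendsto_intros)
    moreover have "cmod (exp w) = R P" using w(2) \<zeta>(2) D(2) by simp
    ultimately have "eventually (\<lambda>z. cmod (exp z) > s) (at w within ?T)" using s(2) by (intro order_tendstoD) auto
    moreover have "eventually (\<lambda>z. z \<in> ?T) (at w within ?T)" by (simp add: eventually_at_filter)
    ultimately show "eventually (\<lambda>z. dist (J z) 0 < e) (at w within ?T)"
      by eventually_elim (use s(3) TR Jr in \<open>auto simp: dist_real_def\<close>)
  qed
  have evT: "eventually (\<lambda>z. z \<in> ?T) (at \<zeta>0 within ?T)" by (simp add: eventually_at_filter)
  have diff: "log_ratio c differentiable (at (\<Xi> z))" if "z \<in> ?T" for z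
    using sub that by (intro C_2_differentiable(1)[OF C2]) auto
  have contdz: "isCont (dz (log_ratio c)) (snd c p)"
    by (rule isCont_dz[OF oS _ pS]) (use Cw in \<open>unfold C_infinity_on_def, blast\<close>)
  have ldz: "((\<lambda>z. dz (log_ratio c) (\<Xi> z)) \<longlongrightarrow> g) (at \<zeta>0 within ?T)"
    unfolding g_def using contdz l0 by (rule isCont_tendsto_compose)
  have first: "(dir_deriv v J \<longlongrightarrow> Re (g * (\<Lambda> * v))) (at \<zeta>0 within ?T)" for v
  proof (rule Lim_transform_eventually)
    show "((\<lambda>z. Re (dz (log_ratio c) (\<Xi> z) * (deriv \<Xi> z * v))) \<longlongrightarrow> Re (g * (\<Lambda> * v))) (at \<zeta>0 within ?T)"
      by (intro tendsto_intros ldz l1)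
    show "eventually (\<lambda>z. Re (dz (log_ratio c) (\<Xi> z) * (deriv \<Xi> z * v)) = dir_deriv v J z) (at \<zeta>0 within ?T)"
      using evT
    proof (rule eventually_mono)
      fix z assume zT: "z \<in> ?T"
      show "Re (dz (log_ratio c) (\<Xi> z) * (deriv \<Xi> z * v)) = dir_deriv v J z"
        unfolding J_def dir_deriv_compose_holomorphic[OF oT hol C2 sub oS zT] dir_deriv_dz[OF diff[OF zT]] ..
    qed
  qed
  define Q where "Q v u = Re v * Re v * dir_deriv 1 (dir_deriv 1 (log_ratio c)) u
     + Re v * Im v * dir_deriv \<i> (dir_deriv 1 (log_ratio c)) u
     + Im v * Re v * dir_deriv 1 (dir_deriv \<i> (log_ratio c)) u
     + Im v * Im v * dir_deriv \<i> (dir_deriv \<i> (log_ratio c)) u" for v u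
  have Q: "dir_deriv v (dir_deriv v (log_ratio c)) u = Q v u" if "u \<in> ?S" for v u
    unfolding Q_def by (rule dir_deriv_dir_deriv(2)[OF oS C2 that])
  have cD: "((\<lambda>z. dir_deriv a (dir_deriv b (log_ratio c)) (\<Xi> z))
      \<longlongrightarrow> dir_deriv a (dir_deriv b (log_ratio c)) (snd c p)) (at \<zeta>0 within ?T)"
    if "a = 1 \<or> a = \<i>" "b = 1 \<or> b = \<i>" for a b
  proof (rule isCont_tendsto_compose[OF _ l0])
    have "continuous_on ?S (dir_deriv a (dir_deriv b (log_ratio c)))"
      using C2 that by (auto simp: numeral_2_eq_2)
    then show "isCont (dir_deriv a (dir_deriv b (log_ratio c))) (snd c p)"
      using oS pS continuous_on_eq_continuous_at by blast
  qed
  have second: "(dir_deriv \<i> (dir_deriv \<i> J) \<longlongrightarrow> Re (g * (?M * \<i>\<^sup>2)) + Q (\<Lambda> * \<i>) (snd c p)) (at \<zeta>0 within ?T)"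
  proof (rule Lim_transform_eventually)
    have l1': "((\<lambda>z. deriv \<Xi> z * \<i>) \<longlongrightarrow> \<Lambda> * \<i>) (at \<zeta>0 within ?T)" by (intro tendsto_intros l1)
    show "((\<lambda>z. Re (dz (log_ratio c) (\<Xi> z) * (deriv (deriv \<Xi>) z * \<i>\<^sup>2)) + Q (deriv \<Xi> z * \<i>) (\<Xi> z))
        \<longlongrightarrow> Re (g * (?M * \<i>\<^sup>2)) + Q (\<Lambda> * \<i>) (snd c p)) (at \<zeta>0 within ?T)"
      unfolding Q_def by (intro tendsto_add tendsto_mult tendsto_Re tendsto_Im tendsto_const ldz l1' l2 cD) auto
    show "eventually (\<lambda>z. Re (dz (log_ratio c) (\<Xi> z) * (deriv (deriv \<Xi>) z * \<i>\<^sup>2)) + Q (deriv \<Xi> z * \<i>) (\<Xi> z)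
        = dir_deriv \<i> (dir_deriv \<i> J) z) (at \<zeta>0 within ?T)"
      using evT
    proof (rule eventually_mono)
      fix z assume zT: "z \<in> ?T"
      then have "\<Xi> z \<in> ?S" using sub by auto
      then show "Re (dz (log_ratio c) (\<Xi> z) * (deriv (deriv \<Xi>) z * \<i>\<^sup>2)) + Q (deriv \<Xi> z * \<i>) (\<Xi> z)
          = dir_deriv \<i> (dir_deriv \<i> J) z"
        unfolding J_def dir_deriv2_compose_holomorphic[OF oT hol C2 sub oS zT] dir_deriv_dz[OF diff[OF zT]]
        by (simp only: Q)
    qed
  qed
  have t1: "Re (g * (\<Lambda> * \<i>)) = 0" by (rule boundary_tangential_limits(1)[OF \<kappa> J2 bd first])
  have t2: "Re (g * (?M * \<i>\<^sup>2)) + Q (\<Lambda> * \<i>) (snd c p) = 0"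
    by (rule boundary_tangential_limits(2)[OF \<kappa> J2 bd second])
  have n1: "(dir_deriv 1 J \<longlongrightarrow> Re (g * \<Lambda>)) (at \<zeta>0 within ?T)" using first[of 1] by simp
  define L where "L = of_real y0 * \<Lambda>"
  have ReL: "Re (g * (L * v)) = y0 * Re (g * (\<Lambda> * v))" for v
  proof -
    have "g * (L * v) = y0 *\<^sub>R (g * (\<Lambda> * v))" by (simp add: L_def scaleR_conv_of_real)
    then show ?thesis by (simp only: scaleR_complex.sel)
  qed
  show ?thesis
  proof (rule that)
    show "\<rho> c (snd c p) * cmod L = 1" using norm\<Lambda> y0 by (simp add: L_def norm_mult mult_ac)
    show "Re (g * (L * \<i>)) = 0" using ReL[of \<i>] t1 by simp
    have "Q (L * \<i>) (snd c p) = y0\<^sup>2 * Q (\<Lambda> * \<i>) (snd c p)"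
      by (simp add: Q_def L_def power2_eq_square algebra_simps)
    also have "\<dots> = y0\<^sup>2 * Re (g * ?M)"
    proof -
      have "g * (?M * \<i>\<^sup>2) = - (g * ?M)" by simp
      then have "Re (g * (?M * \<i>\<^sup>2)) = - Re (g * ?M)" by (simp only: uminus_complex.sel)
      then have "Q (\<Lambda> * \<i>) (snd c p) = Re (g * ?M)" using t2 by linarith
      then show ?thesis by (simp only:)
    qed
    also have "\<dots> = Re (y0\<^sup>2 *\<^sub>R (g * ?M))" by (simp only: scaleR_complex.sel)
    also have "y0\<^sup>2 *\<^sub>R (g * ?M) = g * (L - G * L\<^sup>2)"
      using y0 by (simp add: L_def scaleR_conv_of_real power2_eq_square field_simps)
    finally show "dir_deriv (L * \<i>) (dir_deriv (L * \<i>) (log_ratio c)) (snd c p) = Re (g * (L - G * L\<^sup>2))"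
      using Q[OF pS] by simp
    show "\<exists>n. ratio (\<Phi> P (z n)) \<le> 0" if "Re (g * L) > 0"
    proof -
      have "Re (g * \<Lambda>) > 0" using ReL[of 1] that y0 by (simp add: zero_less_mult_iff)
      then obtain \<delta> where \<delta>: "\<delta> > 0" "\<And>z. z \<in> ?T \<Longrightarrow> dist z \<zeta>0 < \<delta> \<Longrightarrow> J z \<le> 0"
        using boundary_normal_limit(2)[OF \<kappa> J2 bd n1] by blast
      have "min \<delta> \<kappa> > 0" using \<delta>(1) \<kappa> by simp
      from tendstoD[OF \<zeta>(1) this] obtain n where n: "dist (\<zeta> n) \<zeta>0 < min \<delta> \<kappa>"
        using eventually_happens by force
      then have "\<zeta> n \<in> ?T" using \<zeta>(2,3) by (auto simp: half_disc_def dist_commute)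
      then have "ratio (\<Phi> P (z (k n))) \<le> 0" using \<delta>(2)[of "\<zeta> n"] n Jr[of "\<zeta> n"] by (simp add: ez)
      then show ?thesis by blast
    qed
    fix e s assume e: "e > 0" and s: "0 < s" "s < R P"
      and le: "\<And>z. s < cmod z \<Longrightarrow> cmod z < R P \<Longrightarrow> ratio (\<Phi> P z) \<le> e * (ln (cmod z) - ln (R P))"
    define \<kappa>' where "\<kappa>' = min \<kappa> (ln (R P) - ln s)"
    have \<kappa>': "\<kappa>' > 0" "\<kappa>' \<le> \<kappa>" "\<kappa>' \<le> ln (R P) - ln s" using \<kappa> s by (auto simp: \<kappa>'_def)
    have sub': "half_disc \<zeta>0 \<kappa>' \<subseteq> ?T" using \<kappa>'(2) by (auto simp: half_disc_def)
    have "e \<le> Re (g * \<Lambda>)"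
    proof (rule boundary_normal_limit(1)[OF \<kappa>'(1) C_k_on_subset[OF J2 sub'] _ tendsto_within_subset[OF n1 sub']])
      show "(J \<longlongrightarrow> 0) (at w within half_disc \<zeta>0 \<kappa>')" if "w \<in> ball \<zeta>0 \<kappa>'" "Re w = Re \<zeta>0" for w
        by (rule tendsto_within_subset[OF bd sub']) (use that \<kappa>'(2) in auto)
      fix z assume zT: "z \<in> half_disc \<zeta>0 \<kappa>'"
      then have "\<bar>Re (\<zeta>0 - z)\<bar> < \<kappa>'"
        using abs_Re_le_cmod[of "\<zeta>0 - z"] by (simp add: half_disc_def dist_norm)
      then have "ln s < Re z" using \<kappa>'(3) \<zeta>(2) by simp
      then have "exp (ln s) < exp (Re z)" by simp
      then have "s < cmod (exp z)" using s by simp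
      then have "ratio (\<Phi> P (exp z)) \<le> e * (ln (cmod (exp z)) - ln (R P))"
        using le[of "exp z"] TR[of z] zT sub' by auto
      then show "J z \<le> e * (Re z - Re \<zeta>0)" using Jr[of z] zT sub' \<zeta>(2) by auto
    qed
    then show "Re (g * L) > 0" using ReL[of 1] e y0 by simp
  qed
qed

text \<open>If the horocycle is not longer than \<open>2 \<pi>\<close>, then the density of the cusp metric with respect to
  \<open>|dz|\<close> is a nonincreasing function of \<open>|z|\<close>, while that of \<open>\<sigma>\<close> has strictly subharmonic logarithm, so
  approaches the boundary, where both agree, from below and with positive slope, by Hopf's lemma.\<close>

lemma ratio_decay:
  assumes P: "P \<in> cusps X Y \<iota>" and R: "R P \<le> exp (- 1)"
  obtains e s where "e > 0" "0 < s" "s < R P"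
    "\<And>z. s < cmod z \<Longrightarrow> cmod z < R P \<Longrightarrow> ratio (\<Phi> P z) \<le> e * (ln (cmod z) - ln (R P))"
proof -
  note cc = coord[OF P]
  note D = cusp_coordinateD[OF cc]
  let ?ext = "extend_cusp P (\<Phi> P)" and ?pc = "plane_chart (ball 0 (R P))"
  interpret qb: local_metrics "top_of_set (ball 0 (R P))" "{?pc}" Y ?ext B "\<lambda>d. d" \<sigma>
    by (rule local_metrics_conformal[OF atlas_plane_chart[OF open_ball] atlas_Y extend_cusp_continuous[OF cc] _
        extend_cusp_holomorphic[OF cc] \<sigma>(1)]) (use extend_cusp_inj[OF cc] in simp)
  define W where "W = (\<lambda>z. ln (qb.pullback ?pc z))"
  have qpos: "qb.pullback ?pc z > 0" if "z \<in> ball 0 (R P)" for z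
    using qb.conformal that by (simp add: conformal_metric_def)
  have CW: "C_infinity_on (ball 0 (R P)) W"
    unfolding W_def using qb.conformal by (intro C_infinity_on_ln qpos) (auto simp: conformal_metric_def)
  have lap: "laplacian W z > 0" if z: "z \<in> ball 0 (R P)" for z
  proof -
    have "?ext z \<in> topspace Y" using extend_cusp_continuous[OF cc] z by (auto simp: continuous_map_def)
    then obtain d where d: "d \<in> B" "?ext z \<in> fst d" using atlas_chart_at[OF atlas_Y] by blast
    have "gauss_curvature qb.pullback ?pc z = gauss_curvature \<sigma> d (snd d (?ext z))"
      using qb.curvature[of ?pc d z] z d by (simp add: gauss_curvature_def)
    also have "\<dots> < 0" using \<sigma>(2) d by (auto simp: negatively_curved_def)
    finally have "laplacian W z / (qb.pullback ?pc z)\<^sup>2 > 0" by (simp add: gauss_curvature_def W_def)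
    then show ?thesis using qpos[OF z] by (simp add: zero_less_divide_iff)
  qed
  have W: "W z = ratio (\<Phi> P z) + ln (cusp_density z)" if z: "z \<in> cusp_disc (R P)" for z
  proof -
    have zb: "z \<in> ball 0 (R P)" and z0: "z \<noteq> 0" using z by (auto simp: cusp_disc_def)
    let ?x = "\<Phi> P z"
    have x: "?x \<in> topspace X" using D(8)[OF z] .
    obtain c where c: "c \<in> A" "?x \<in> fst c" "is_chart X c" using atlas_chart_at[OF atlas_X x] by blast
    obtain d where d: "d \<in> B" "\<iota> ?x \<in> fst d" "is_chart Y d" using atlas_chart_at[OF atlas_Y \<iota>_in_Y[OF x]] by blast
    have ez: "?ext z = \<iota> ?x" using z0 by (simp add: extend_cusp_def)
    have dd: "deriv (in_coords ?ext ?pc d) z = deriv (in_coords \<iota> c d) (snd c ?x) * deriv (snd c \<circ> \<Phi> P) z"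
      using deriv_in_coords_plane_chart[OF open_ball zb] deriv_extend_cusp[OF cc z c(1,2) d(1,2)] by metis
    have "qb.pullback ?pc z = \<sigma> d (snd d (\<iota> ?x)) * cmod (deriv (in_coords ?ext ?pc d) z)"
      using qb.pullback_eq[of ?pc d z] d zb ez by simp
    also have "\<dots> = pb.pullback c (snd c ?x) * cmod (deriv (snd c \<circ> \<Phi> P) z)"
      using pb.pullback_eq[OF c(1) d(1) c(2) d(2)] by (simp add: dd norm_mult)
    finally have q: "qb.pullback ?pc z = pb.pullback c (snd c ?x) * cmod (deriv (snd c \<circ> \<Phi> P) z)" .
    have iso: "\<rho> c (snd c ?x) * cmod (deriv (snd c \<circ> \<Phi> P) z) = cusp_density z" by (rule D(10)[OF c(1) z c(2)])
    have p: "pb.pullback c (snd c ?x) > 0" "\<rho> c (snd c ?x) > 0" using pb_pos \<rho>_pos c by auto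
    have "cusp_density z > 0" using cusp_disc_mono[OF D(3)] z by (intro cusp_density_pos) auto
    then have m: "cmod (deriv (snd c \<circ> \<Phi> P) z) > 0" using iso p(2) by (metis zero_less_mult_pos)
    have "ln (cusp_density z) = ln (\<rho> c (snd c ?x)) + ln (cmod (deriv (snd c \<circ> \<Phi> P) z))"
      unfolding iso[symmetric] using p(2) m by (rule ln_mult_pos)
    moreover have "W z = ln (pb.pullback c (snd c ?x)) + ln (cmod (deriv (snd c \<circ> \<Phi> P) z))"
      unfolding W_def q using p(1) m by (rule ln_mult_pos)
    ultimately show ?thesis using ratio_eq[OF c(1,2)] by (simp add: log_ratio_def)
  qed
  define f where "f = (\<lambda>t::real. - t - ln (- t))"
  have lc: "ln (cusp_density z) = f (ln (cmod z))" if "z \<in> cusp_disc (R P)" for z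
    using cusp_disc_mono[OF D(3)] that ln_cusp_density[of z] by (auto simp: f_def)
  have t0: "ln (R P) \<le> - 1"
    using R D(2) by (metis exp_gt_zero ln_exp ln_le_cancel_iff)
  have bd: "\<exists>s<R P. \<forall>z. s < cmod z \<and> cmod z < R P \<longrightarrow> \<bar>W z - f (ln (R P))\<bar> < e" if e: "e > 0" for e
  proof -
    obtain s1 where s1: "0 < s1" "s1 < R P" "\<And>z. s1 < cmod z \<Longrightarrow> cmod z < R P \<Longrightarrow> \<bar>ratio (\<Phi> P z)\<bar> < e / 2"
      using ratio_boundary[OF P, of "e / 2"] e by auto
    have "isCont (\<lambda>x. f (ln x)) (R P)"
      unfolding f_def using D(2) t0 by (intro continuous_intros) auto
    then have "\<forall>\<epsilon>>0. \<exists>d>0. \<forall>x. dist x (R P) < d \<longrightarrow> dist (f (ln x)) (f (ln (R P))) < \<epsilon>"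
      unfolding continuous_at_eps_delta by (simp add: dist_real_def)
    then obtain d where d: "d > 0" "\<And>x. dist x (R P) < d \<Longrightarrow> dist (f (ln x)) (f (ln (R P))) < e / 2"
      using e half_gt_zero by blast
    show ?thesis
    proof (intro exI[of _ "max s1 (R P - d)"] conjI allI impI)
      show "max s1 (R P - d) < R P" using s1 d by simp
      fix z assume z: "max s1 (R P - d) < cmod z \<and> cmod z < R P"
      then have zc: "z \<in> cusp_disc (R P)" using s1(1) by (auto simp: cusp_disc_def)
      have "\<bar>ratio (\<Phi> P z)\<bar> < e / 2" using z by (intro s1(3)) auto
      moreover have "dist (f (ln (cmod z))) (f (ln (R P))) < e / 2" using z by (intro d(2)) (auto simp: dist_real_def)
      ultimately show "\<bar>W z - f (ln (R P))\<bar> < e" unfolding W[OF zc] lc[OF zc] dist_real_def by linarith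
    qed
  qed
  obtain e where e: "e > 0" "\<And>z. R P / 2 \<le> cmod z \<Longrightarrow> cmod z < R P \<Longrightarrow> W z \<le> f (ln (R P)) + e * ln (cmod z / R P)"
    using subharmonic_boundary_point[OF D(2) C_infinity_on_C_2[OF CW] lap bd] by metis
  show ?thesis
  proof (rule that[of e "R P / 2"])
    fix z assume z: "R P / 2 < cmod z" "cmod z < R P"
    then have zc: "z \<in> cusp_disc (R P)" and zp: "cmod z > 0" using D(2) by (auto simp: cusp_disc_def)
    have t: "ln (cmod z) \<le> ln (R P)" using z(2) zp D(2) by simp
    define u t0 where "u = ln (cmod z)" and "t0 = ln (R P)"
    have u: "u \<le> t0" "t0 \<le> - 1" using t \<open>ln (R P) \<le> - 1\<close> by (auto simp: u_def t0_def)
    have "ln (u / t0) \<le> u / t0 - 1" using u by (intro ln_le_minus_one) (auto simp: divide_neg_neg)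
    also have "\<dots> = (t0 - u) / (- t0)" using u by (simp add: field_simps)
    also have "\<dots> \<le> (t0 - u) / 1" using u by (intro divide_left_mono) auto
    finally have "ln (- u) - ln (- t0) \<le> t0 - u"
      using u ln_div[of "- u" "- t0"] by simp
    then have "f t0 \<le> f u" by (simp add: f_def)
    moreover have "W z \<le> f t0 + e * (u - t0)"
      using e(2)[of z] z zp D(2) by (simp add: t0_def u_def ln_div)
    ultimately show "ratio (\<Phi> P z) \<le> e * (ln (cmod z) - ln (R P))"
      using W[OF zc] lc[OF zc] by (simp add: u_def t0_def)
  qed (use e(1) D(2) in auto)
qed

text \<open>If the horocycle around \<open>P\<close> were too short, the ratio would be positive just outside it, where points
  would have to belong to a horocyclic neighbourhood, of \<open>Q\<close> say. Its boundary passes through the same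
  point \<open>p\<close>, and the outer normals \<open>L\<close> and \<open>M\<close> are opposite, because the ratio is
  not positive on the inner side of a boundary with positive outer normal derivative. But a curve is
  not curved to both sides. The case \<open>Q = P\<close> is possible here.\<close>

lemma radius_greater:
  assumes P: "P \<in> cusps X Y \<iota>"
  shows "R P > exp (- 1)"
proof (rule ccontr)
  assume "\<not> ?thesis"
  then have RP: "R P \<le> exp (- 1)" by simp
  note D = cusp_coordinateD[OF coord]
  obtain e s where es: "e > 0" "0 < s" "s < R P"
    "\<And>z. s < cmod z \<Longrightarrow> cmod z < R P \<Longrightarrow> ratio (\<Phi> P z) \<le> e * (ln (cmod z) - ln (R P))"
    using ratio_decay[OF P RP] by metis
  define z where "z n = (of_real (R P * (1 - 1 / real (n + 2))) :: complex)" for n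
  have zn: "cmod (z n) = R P * (1 - 1 / real (n + 2))" for n
    using D(2)[OF P] by (simp add: z_def abs_mult del: of_real_mult)
  have zc: "z n \<in> cusp_disc (R P)" for n
  proof -
    have "0 < R P * (1 - 1 / real (n + 2))"
      using D(2)[OF P] by (intro mult_pos_pos) (auto simp: field_simps)
    moreover have "R P * (1 - 1 / real (n + 2)) < R P * 1"
      using D(2)[OF P] by (intro mult_strict_left_mono) auto
    ultimately show ?thesis unfolding cusp_disc_def mem_Collect_eq zn by simp
  qed
  have limz: "(\<lambda>n. cmod (z n)) \<longlonglongrightarrow> R P"
  proof -
    have "(\<lambda>n. R P * (1 - 1 / real (n + 2))) \<longlonglongrightarrow> R P * (1 - 0)"
      using LIMSEQ_ignore_initial_segment[OF lim_1_over_n, of 2] by (intro tendsto_intros) auto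
    then show ?thesis unfolding zn by simp
  qed
  obtain q k where q: "strict_mono k" "limitin Y ((\<lambda>n. \<iota> (\<Phi> P (z n))) \<circ> k) q sequentially"
    using surface_compact_imp_convergent_subsequence[OF atlas_Y compact_Y, of "\<lambda>n. \<iota> (\<Phi> P (z n))"]
      \<iota>_in_Y[OF D(8)[OF P zc]] by blast
  have limk: "(\<lambda>n. cmod (z (k n))) \<longlonglongrightarrow> R P"
    using LIMSEQ_subseq_LIMSEQ[OF limz q(1)] by (simp add: comp_def)
  obtain p where p: "p \<in> thick" "limitin X (\<lambda>n. \<Phi> P (z (k n))) p sequentially"
    using boundary_limit_thick[OF P zc limk q(2)[unfolded comp_def]] by blast
  have "p \<in> topspace X" using p(1) by (simp add: thick_def)
  then obtain c where c: "c \<in> A" "p \<in> fst c" "is_chart X c" using atlas_chart_at[OF atlas_X] by blast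
  define g G where "g = dz (log_ratio c) (snd c p)" and "G = dz (\<lambda>z. ln (\<rho> c z)) (snd c p)"
  obtain L where L: "\<rho> c (snd c p) * cmod L = 1" "Re (g * (L * \<i>)) = 0"
    "dir_deriv (L * \<i>) (dir_deriv (L * \<i>) (log_ratio c)) (snd c p) = Re (g * (L - G * L\<^sup>2))"
    "Re (g * L) > 0"
    using horocycle_contact[OF P zc p(2,1) c(1,2)] es unfolding g_def G_def by metis
  \<comment> \<open>Points \<open>x n\<close> approaching \<open>p\<close> along the outer normal have positive ratio.\<close>
  let ?S = "snd c ` fst c"
  have C2: "C_k_on 2 ?S (log_ratio c)" by (rule C_infinity_on_C_2[OF log_ratio_smooth[OF c(1)]])
  have pS: "snd c p \<in> ?S" using c(2) by simp
  have dif: "log_ratio c differentiable (at (snd c p))" by (rule C_2_differentiable(1)[OF C2 pS])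
  have "((\<lambda>s. log_ratio c (snd c p + of_real s * L)) has_real_derivative Re (g * L)) (at 0)"
    using DERIV_along_line[of "log_ratio c" "snd c p" 0 L] dif dir_deriv_dz[OF dif, of L] by (simp add: g_def)
  from DERIV_pos_inc_right[OF this L(4)] obtain \<delta> where \<delta>: "\<delta> > 0"
      "\<And>h. h > 0 \<Longrightarrow> h < \<delta> \<Longrightarrow> log_ratio c (snd c p) < log_ratio c (snd c p + of_real h * L)"
    by auto
  obtain \<epsilon> where \<epsilon>: "\<epsilon> > 0" "ball (snd c p) \<epsilon> \<subseteq> ?S" using is_chartD(2)[OF c(3)] pS openE by blast
  define m where "m = min \<delta> (\<epsilon> / (cmod L + 1))"
  have "\<epsilon> / (cmod L + 1) > 0" using \<epsilon>(1) by (intro divide_pos_pos add_nonneg_pos) auto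
  then have m: "0 < m" "m \<le> \<delta>" "m \<le> \<epsilon> / (cmod L + 1)" using \<delta>(1) by (auto simp: m_def)
  define h0 where "h0 = m / 2"
  have "h0 > 0" "h0 < m" using m(1) by (auto simp: h0_def)
  then have h0: "h0 > 0" "h0 < \<delta>" "h0 < \<epsilon> / (cmod L + 1)" using m(2,3) by linarith+
  define h where "h n = h0 / real (Suc n)" for n
  have h: "0 < h n" "h n \<le> h0" for n using h0(1) by (auto simp: h_def field_simps)
  define x where "x n = inv_into (fst c) (snd c) (snd c p + of_real (h n) * L)" for n
  have inS: "snd c p + of_real (h n) * L \<in> ?S" for n
  proof -
    have "cmod (of_real (h n) * L) = h n * cmod L" using h(1)[of n] by (simp add: norm_mult)
    also have "\<dots> \<le> h0 * (cmod L + 1)" using h[of n] by (intro mult_mono) auto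
    also have "\<dots> < \<epsilon>"
    proof -
      have "cmod L + 1 > 0" by (intro add_nonneg_pos) auto
      from pos_less_divide_eq[OF this] h0(3) show ?thesis by blast
    qed
    finally show ?thesis using \<epsilon>(2) by (auto simp: subset_iff dist_norm)
  qed
  have x: "x n \<in> fst c" "snd c (x n) = snd c p + of_real (h n) * L" for n
    using inv_into_into[OF inS[of n]] f_inv_into_f[OF inS[of n]] by (auto simp: x_def)
  have xpos: "ratio (x n) > 0" for n
  proof -
    have "log_ratio c (snd c p) = 0" using ratio_eq[OF c(1,2)] ratio_thick[OF p(1)] by simp
    then show ?thesis using \<delta>(2)[of "h n"] h[of n] h0(2) ratio_eq[OF c(1) x(1)] by (simp add: x(2))
  qed
  have limx: "limitin X x p sequentially"
  proof (subst limitin_chart[OF c(3,2)], intro conjI)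
    have "(\<lambda>n. snd c p + of_real (h0 / real (Suc n)) * L) \<longlonglongrightarrow> snd c p + of_real 0 * L"
      by (intro tendsto_intros LIMSEQ_Suc[OF lim_const_over_n])
    then show "(\<lambda>n. snd c (x n)) \<longlonglongrightarrow> snd c p" by (simp add: x(2) h_def)
  qed (use x in simp)
  have "\<exists>Q\<in>cusps X Y \<iota>. x n \<in> \<Phi> Q ` cusp_disc (R Q)" for n
  proof -
    have "x n \<notin> thick" using xpos[of n] ratio_thick by fastforce
    then show ?thesis using x(1)[of n] is_chartD(4)[OF c(3)] by (auto simp: thick_def)
  qed
  then obtain Qs where Qs: "\<And>n. Qs n \<in> cusps X Y \<iota>" "\<And>n. x n \<in> \<Phi> (Qs n) ` cusp_disc (R (Qs n))" by metis
  \<comment> \<open>Infinitely many of the points lie in the neighbourhood of a single cusp \<open>Q\<close>.\<close>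
  have "finite (range Qs)" using Qs(1) finite_cusps by (meson finite_subset image_subsetI)
  then obtain n0 where inf: "infinite {n. Qs n = Qs n0}"
    using pigeonhole_infinite[of UNIV Qs] by auto
  then obtain j where j: "strict_mono (j::nat\<Rightarrow>nat)" "\<And>n. Qs (j n) = Qs n0"
    using infinite_enumerate[OF inf] by auto
  define Q where "Q = Qs n0"
  have Q: "Q \<in> cusps X Y \<iota>" using Qs(1) by (simp add: Q_def)
  have "\<exists>w\<in>cusp_disc (R Q). x (j n) = \<Phi> Q w" for n using Qs(2)[of "j n"] j(2) by (auto simp: Q_def)
  then obtain w where w: "\<And>n. w n \<in> cusp_disc (R Q)" "\<And>n. x (j n) = \<Phi> Q (w n)" by metis
  have limw: "limitin X (\<lambda>n. \<Phi> Q (w n)) p sequentially"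
    using limitin_subsequence[OF limx j(1)] by (simp add: comp_def w(2))
  obtain M where M: "\<rho> c (snd c p) * cmod M = 1" "Re (g * (M * \<i>)) = 0"
    "dir_deriv (M * \<i>) (dir_deriv (M * \<i>) (log_ratio c)) (snd c p) = Re (g * (M - G * M\<^sup>2))"
    "Re (g * M) > 0 \<Longrightarrow> \<exists>n. ratio (\<Phi> Q (w n)) \<le> 0"
    using horocycle_contact[OF Q w(1) limw p(1) c(1,2)] unfolding g_def G_def by metis
  have "\<not> Re (g * M) > 0" using M(4) xpos w(2) by (metis not_less)
  moreover have "cmod M = cmod L"
    using L(1) M(1) \<rho>_pos[OF c(1,2)] by (metis less_irrefl mult_left_cancel)
  \<comment> \<open>Both normals are real multiples of the inverse of \<open>g\<close> and have the same length.\<close>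
  moreover have "Im (g * L) = 0" "Im (g * M) = 0" using L(2) M(2) by simp_all
  ultimately have "g * M = - (g * L)"
  proof -
    assume a: "\<not> Re (g * M) > 0" "cmod M = cmod L" "Im (g * L) = 0" "Im (g * M) = 0"
    have "cmod (g * M) = cmod (g * L)" using a(2) by (simp add: norm_mult)
    then have "\<bar>Re (g * M)\<bar> = \<bar>Re (g * L)\<bar>" using a(3,4) by (simp only: cmod_eq_Re)
    then have "Re (g * M) = - Re (g * L)" using a(1) L(4) by linarith
    then show ?thesis using a(3,4) by (simp only: complex_eq_iff uminus_complex.sel minus_zero simp_thms)
  qed
  moreover have "g \<noteq> 0" using L(4) by auto
  ultimately have M_eq: "M = - L" by (metis mult_cancel_left mult_minus_right)
  have Mi: "dir_deriv (M * \<i>) (dir_deriv (M * \<i>) (log_ratio c)) (snd c p)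
      = dir_deriv (L * \<i>) (dir_deriv (L * \<i>) (log_ratio c)) (snd c p)"
    unfolding dir_deriv_dir_deriv(2)[OF is_chartD(2)[OF c(3)] C2 pS, of "M * \<i>"]
      dir_deriv_dir_deriv(2)[OF is_chartD(2)[OF c(3)] C2 pS, of "L * \<i>"] by (simp add: M_eq)
  have "Re (g * (- L - G * L\<^sup>2)) = Re (g * (L - G * L\<^sup>2))"
    using Mi L(3) M(3) by (simp only: M_eq power2_minus)
  moreover have "g * (- L - G * L\<^sup>2) = g * (L - G * L\<^sup>2) - 2 *\<^sub>R (g * L)"
    by (simp add: scaleR_conv_of_real algebra_simps)
  ultimately have "Re (g * L) = 0" by (simp only: minus_complex.sel scaleR_complex.sel)
  then show False using L(4) by simp
qed

end

context cusp_surface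
begin

text \<open>The horocycles of radius \<open>1/e\<close> have length \<open>2 \<pi>\<close> and fit into the given neighbourhoods.\<close>

lemma negatively_curved_cap_imp_cusp_lengths_ge:
  assumes N: "\<And>P. P \<in> cusps X Y \<iota> \<Longrightarrow> horocyclic_nhd X A \<rho> Y \<iota> P (N P)"
    "disjoint_family_on N (cusps X Y \<iota>)"
    and \<sigma>: "conformal_metric Y B \<sigma>" "negatively_curved B \<sigma>"
    and out: "\<And>p. p \<in> topspace X - (\<Union>P\<in>cusps X Y \<iota>. N P) \<Longrightarrow> pullback_eq_at A \<rho> B \<sigma> \<iota> p"
  shows "cusp_lengths_ge X A \<rho> Y \<iota> (2 * pi)"
proof -
  have "\<exists>r \<phi>. r < 1 \<and> cusp_coordinate P r \<phi> \<and> N P = \<phi> ` cusp_disc r" if "P \<in> cusps X Y \<iota>" for P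
    using horocyclic_nhdD[OF that N(1)[OF that]] by metis
  then obtain R \<Phi> where R: "\<And>P. P \<in> cusps X Y \<iota> \<Longrightarrow> R P < 1"
    "\<And>P. P \<in> cusps X Y \<iota> \<Longrightarrow> cusp_coordinate P (R P) (\<Phi> P)"
    "\<And>P. P \<in> cusps X Y \<iota> \<Longrightarrow> N P = \<Phi> P ` cusp_disc (R P)" by metis
  have U: "(\<Union>P\<in>cusps X Y \<iota>. N P) = (\<Union>P\<in>cusps X Y \<iota>. \<Phi> P ` cusp_disc (R P))" using R(3) by auto
  interpret capped_surface X A \<rho> Y B \<iota> R \<Phi> \<sigma>
  proof
    show "disjoint_family_on (\<lambda>P. \<Phi> P ` cusp_disc (R P)) (cusps X Y \<iota>)"
      using N(2) R(3) by (simp add: disjoint_family_on_def)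
  qed (use R \<sigma> out U in auto)
  show ?thesis
    unfolding cusp_lengths_ge_def
  proof (rule exI, intro conjI ballI)
    fix P assume P: "P \<in> cusps X Y \<iota>"
    have "closed_horocycle X A \<rho> Y \<iota> P (\<Phi> P ` sphere 0 (exp (- 1))) (- 2 * pi / ln (exp (- 1)))"
      by (rule cusp_coordinate_imp_closed_horocycle[OF R(2)[OF P] exp_gt_zero radius_greater[OF P]])
    then show "\<exists>l'\<ge>2 * pi. closed_horocycle X A \<rho> Y \<iota> P (\<Phi> P ` sphere 0 (exp (- 1))) l'"
      by (intro exI[of _ "2 * pi"]) simp
  next
    show "disjoint_family_on (\<lambda>P. \<Phi> P ` sphere 0 (exp (- 1))) (cusps X Y \<iota>)"
      unfolding disjoint_family_on_def
    proof (intro ballI impI)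
      fix P Q assume PQ: "P \<in> cusps X Y \<iota>" "Q \<in> cusps X Y \<iota>" "P \<noteq> Q"
      have "sphere 0 (exp (- 1)) \<subseteq> cusp_disc (R P)" "sphere 0 (exp (- 1)) \<subseteq> cusp_disc (R Q)"
        using radius_greater[OF PQ(1)] radius_greater[OF PQ(2)] by (auto simp: cusp_disc_def)
      moreover have "\<Phi> P ` cusp_disc (R P) \<inter> \<Phi> Q ` cusp_disc (R Q) = {}"
        using disjoint PQ by (auto simp: disjoint_family_on_def)
      ultimately show "\<Phi> P ` sphere 0 (exp (- 1)) \<inter> \<Phi> Q ` sphere 0 (exp (- 1)) = {}" by blast
    qed
  qed
qed

end

section \<open>Parametrised charts\<close>

text \<open>An injective holomorphic map from the plane is turned around into a chart. Charts obtained in this way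
  need not belong to the given atlas; metrics are built in them and then expressed in the atlas.\<close>

definition param_chart :: "complex set \<Rightarrow> (complex \<Rightarrow> 'b) \<Rightarrow> 'b chart" where
  "param_chart V e = (e ` V, inv_into V e)"

locale parametrization =
  fixes Y :: "'b topology" and B :: "'b chart set" and V :: "complex set" and e :: "complex \<Rightarrow> 'b"
  assumes atlas: "atlas Y B" and V: "open V" and cont: "continuous_map (top_of_set V) Y e"
    and inj: "inj_on e V" and hol: "holomorphic_map {plane_chart V} B e"
begin

lemma inv_e: "z \<in> V \<Longrightarrow> inv_into V e (e z) = z"
  using inj by simp

lemma image_simps: "fst (param_chart V e) = e ` V" "snd (param_chart V e) ` fst (param_chart V e) = V"
  by (auto simp: param_chart_def inv_e image_image)

lemma is_chart: "is_chart Y (param_chart V e)"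
proof -
  have o: "openin Y (e ` U)" if "open U" "U \<subseteq> V" for U
    by (rule open_map_into_surface[OF atlas V cont inj that])
  have sub: "e ` V \<subseteq> topspace Y" using cont by (auto simp: continuous_map_def)
  have "homeomorphic_maps (subtopology Y (e ` V)) (top_of_set V) (inv_into V e) e"
    unfolding homeomorphic_maps_def
  proof (intro conjI)
    show "continuous_map (subtopology Y (e ` V)) (top_of_set V) (inv_into V e)"
      unfolding continuous_map_def
    proof (intro conjI allI impI)
      show "inv_into V e \<in> topspace (subtopology Y (e ` V)) \<rightarrow> topspace (top_of_set V)"
        using inv_e by auto
      fix U assume U: "openin (top_of_set V) U"
      then have U': "open U" "U \<subseteq> V" using V by (auto simp: openin_open_eq)
      have "{y \<in> topspace (subtopology Y (e ` V)). inv_into V e y \<in> U} = e ` U"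
        using U'(2) inv_e sub by (auto simp: image_iff)
      moreover have "openin (subtopology Y (e ` V)) (e ` U)"
        using o[OF U'] U'(2) by (auto simp: openin_subtopology)
      ultimately show "openin (subtopology Y (e ` V)) {y \<in> topspace (subtopology Y (e ` V)). inv_into V e y \<in> U}"
        by simp
    qed
    show "continuous_map (top_of_set V) (subtopology Y (e ` V)) e"
      using cont by (auto simp: continuous_map_in_subtopology)
  qed (auto simp: inv_e)
  then have "homeomorphic_map (subtopology Y (e ` V)) (top_of_set V) (inv_into V e)"
    by (rule homeomorphic_maps_map[THEN iffD1, THEN conjunct1])
  then show ?thesis
    using o[OF V order_refl] V image_simps(2) by (simp add: is_chart_def image_simps(1)) (simp add: param_chart_def)
qed

lemma
  assumes d: "d \<in> B"
  shows in_coords_holomorphic: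
      "in_coords id d (param_chart V e) holomorphic_on snd d ` (fst d \<inter> id -` fst (param_chart V e))"
    and deriv_in_coords: "z \<in> V \<Longrightarrow> e z \<in> fst d \<Longrightarrow>
      deriv (snd d \<circ> e) z \<noteq> 0 \<and>
      deriv (in_coords id d (param_chart V e)) (snd d (e z)) = 1 / deriv (snd d \<circ> e) z"
proof -
  note cd = atlasD[OF atlas d]
  let ?W = "V \<inter> e -` fst d" and ?f = "snd d \<circ> e"
  have oW: "open ?W" by (rule open_plane_preimage[OF V cont is_chartD(1)[OF cd]])
  have fh: "?f holomorphic_on ?W" using hol d by (auto simp: holomorphic_map_plane_chart)
  have fi: "inj_on ?f ?W"
    using inj_on_subset[OF inj, of ?W] inj_on_subset[OF is_chartD(3)[OF cd], of "e ` ?W"]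
    by (intro comp_inj_on) auto
  obtain g where g: "g holomorphic_on ?f ` ?W" "\<And>z. z \<in> ?W \<Longrightarrow> deriv ?f z * deriv g (?f z) = 1"
      "\<And>z. z \<in> ?W \<Longrightarrow> g (?f z) = z"
    using holomorphic_has_inverse[OF fh oW fi] by metis
  have im: "snd d ` (fst d \<inter> id -` fst (param_chart V e)) = ?f ` ?W"
    by (force simp: image_simps)
  have eq: "g w = in_coords id d (param_chart V e) w" if w: "w \<in> ?f ` ?W" for w
  proof -
    obtain z where z: "z \<in> V" "e z \<in> fst d" "w = snd d (e z)" using w by auto
    then show ?thesis
      using g(3)[of z] in_coords_apply[OF cd z(2), of id "param_chart V e"] inv_e[OF z(1)]
      by (simp add: param_chart_def)
  qed
  show "in_coords id d (param_chart V e) holomorphic_on snd d ` (fst d \<inter> id -` fst (param_chart V e))"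
    unfolding im by (rule holomorphic_transform[OF g(1) eq])
  assume z: "z \<in> V" "e z \<in> fst d"
  have oI: "open (?f ` ?W)"
    by (rule invariance_of_domain[OF holomorphic_on_imp_continuous_on[OF fh] oW fi])
  have "deriv g (?f z) = deriv (in_coords id d (param_chart V e)) (?f z)"
    by (rule deriv_cong_ev) (use oI z eq in \<open>auto simp: eventually_nhds intro!: exI[of _ "?f ` ?W"]\<close>)
  then show "deriv (snd d \<circ> e) z \<noteq> 0 \<and>
      deriv (in_coords id d (param_chart V e)) (snd d (e z)) = 1 / deriv (snd d \<circ> e) z"
    using g(2)[of z] z by (auto simp: eq_divide_eq mult.commute)
qed

end

context cusp_surface
begin

section \<open>Disjoint horocycles bound disjoint discs\<close>

text \<open>Where two cusp neighbourhoods overlap, the transition function is a holomorphic isometry between open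
  subsets of the model cusp.\<close>

lemma cusp_transition:
  assumes P: "cusp_coordinate P s \<phi>" and Q: "cusp_coordinate Q s' \<psi>"
  defines "V \<equiv> cusp_disc s \<inter> \<phi> -` (\<psi> ` cusp_disc s')" and "h \<equiv> \<lambda>z. inv_into (cusp_disc s') \<psi> (\<phi> z)"
  shows "open V" "h holomorphic_on V" "inj_on h V" "h ` V \<subseteq> cusp_disc s'" "z \<in> V \<Longrightarrow> \<psi> (h z) = \<phi> z"
    "z \<in> V \<Longrightarrow> cusp_density (h z) * cmod (deriv h z) = cusp_density z"
proof -
  note DP = cusp_coordinateD[OF P] and DQ = cusp_coordinateD[OF Q]
  have "openin X (\<psi> ` cusp_disc s')"
    by (rule open_map_into_surface[OF atlas_X open_cusp_disc DQ(4,5) open_cusp_disc order_refl])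
  then show oV: "open V" unfolding V_def by (rule open_plane_preimage[OF open_cusp_disc DP(4)])
  have h: "h z \<in> cusp_disc s'" "\<psi> (h z) = \<phi> z" if "z \<in> V" for z
    using that by (auto simp: V_def h_def inv_into_into f_inv_into_f)
  then show "h ` V \<subseteq> cusp_disc s'" "z \<in> V \<Longrightarrow> \<psi> (h z) = \<phi> z" by auto
  show "inj_on h V"
  proof (rule inj_onI)
    fix u v assume uv: "u \<in> V" "v \<in> V" "h u = h v"
    then have "\<phi> u = \<phi> v" using h(2) by metis
    then show "u = v" using uv DP(5) by (auto simp: V_def dest: inj_onD)
  qed
  have main: "h field_differentiable (at z) \<and> cusp_density (h z) * cmod (deriv h z) = cusp_density z"
    if z: "z \<in> V" for z
  proof -
    have zs: "z \<in> cusp_disc s" using z by (simp add: V_def)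
    obtain c where c: "c \<in> A" "\<phi> z \<in> fst c" "is_chart X c" using atlas_chart_at[OF atlas_X DP(8)[OF zs]] by blast
    let ?W = "cusp_disc s' \<inter> \<psi> -` fst c" and ?f = "snd c \<circ> \<psi>"
    have oW: "open ?W" by (rule open_plane_preimage[OF open_cusp_disc DQ(4) is_chartD(1)[OF c(3)]])
    have fh: "?f holomorphic_on ?W" using DQ(6) c(1) by (auto simp: holomorphic_map_plane_chart)
    have fi: "inj_on ?f ?W"
      using inj_on_subset[OF DQ(5), of ?W] inj_on_subset[OF is_chartD(3)[OF c(3)], of "\<psi> ` ?W"]
      by (intro comp_inj_on) auto
    obtain g where g: "g holomorphic_on ?f ` ?W" "\<And>z. z \<in> ?W \<Longrightarrow> deriv ?f z * deriv g (?f z) = 1"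
        "\<And>z. z \<in> ?W \<Longrightarrow> g (?f z) = z"
      using holomorphic_has_inverse[OF fh oW fi] by metis
    have oI: "open (?f ` ?W)"
      by (rule invariance_of_domain[OF holomorphic_on_imp_continuous_on[OF fh] oW fi])
    have hW: "h z \<in> ?W" using h[OF z] c(2) by simp
    have fz: "?f (h z) = (snd c \<circ> \<phi>) z" using h(2)[OF z] by simp
    have 1: "(snd c \<circ> \<phi> has_field_derivative deriv (snd c \<circ> \<phi>) z) (at z)"
      using DP(9)[OF c(1) zs c(2)] by (rule field_differentiable_derivI)
    have "?f (h z) \<in> ?f ` ?W" using hW by blast
    from holomorphic_derivI[OF g(1) oI this]
    have 2: "(g has_field_derivative deriv g (?f (h z))) (at ((snd c \<circ> \<phi>) z))" unfolding fz .
    have "(h has_field_derivative deriv g (?f (h z)) * deriv (snd c \<circ> \<phi>) z) (at z)"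
    proof (rule has_field_derivative_transform_within_open[OF DERIV_chain[OF 2 1]])
      have "open (cusp_disc s \<inter> \<phi> -` fst c)"
        by (rule open_plane_preimage[OF open_cusp_disc DP(4) is_chartD(1)[OF c(3)]])
      then show "open (V \<inter> (cusp_disc s \<inter> \<phi> -` fst c))" using oV by blast
      show "z \<in> V \<inter> (cusp_disc s \<inter> \<phi> -` fst c)" using z zs c(2) by simp
      fix w assume w: "w \<in> V \<inter> (cusp_disc s \<inter> \<phi> -` fst c)"
      then have "h w \<in> ?W" using h[of w] by simp
      from g(3)[OF this] show "(g \<circ> (snd c \<circ> \<phi>)) w = h w" using h(2)[of w] w by simp
    qed
    note Dh = this
    have 3: "\<rho> c (snd c (\<phi> z)) * cmod (deriv (snd c \<circ> \<phi>) z) = cusp_density z" by (rule DP(10)[OF c(1) zs c(2)])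
    have 4: "\<rho> c (snd c (\<phi> z)) * cmod (deriv ?f (h z)) = cusp_density (h z)"
      using DQ(10)[OF c(1) h(1)[OF z]] h(2)[OF z] c(2) by simp
    have "cusp_density (h z) * cmod (deriv h z)
        = \<rho> c (snd c (\<phi> z)) * cmod (deriv (snd c \<circ> \<phi>) z) * cmod (deriv ?f (h z) * deriv g (?f (h z)))"
      unfolding DERIV_imp_deriv[OF Dh] 4[symmetric] norm_mult by (simp only: mult_ac)
    also have "\<dots> = cusp_density z" unfolding 3 g(2)[OF hW] by simp
    finally show ?thesis using Dh by (auto simp: field_differentiable_def)
  qed
  show "h holomorphic_on V"
    unfolding holomorphic_on_def by (rule ballI, rule field_differentiable_at_within, rule main[THEN conjunct1])
  show "z \<in> V \<Longrightarrow> cusp_density (h z) * cmod (deriv h z) = cusp_density z" by (rule main[THEN conjunct2])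
qed

text \<open>The transition function maps an annulus around the circle of radius \<open>r\<close> into the other cusp, and there it
  preserves absolute values.\<close>

lemma horocycle_inside_imp_radius_less:
  assumes P: "cusp_coordinate P s \<phi>" and Q: "cusp_coordinate Q s' \<psi>" and r: "0 < r" "r < s"
    and sub: "\<phi> ` sphere 0 r \<subseteq> \<psi> ` cusp_disc s'"
  shows "r < s'"
proof -
  note T = cusp_transition[OF P Q]
  note DP = cusp_coordinateD[OF P] and DQ = cusp_coordinateD[OF Q]
  let ?V = "cusp_disc s \<inter> \<phi> -` (\<psi> ` cusp_disc s')" and ?h = "\<lambda>z. inv_into (cusp_disc s') \<psi> (\<phi> z)"
  have "sphere 0 r \<subseteq> ?V" using sub r by (auto simp: cusp_disc_def)
  then obtain e where e: "e > 0" "\<And>z. r - e < cmod z \<Longrightarrow> cmod z < r + e \<Longrightarrow> z \<in> ?V"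
    using sphere_neighbourhood[OF r(1) T(1)] by metis
  define a b where "a = max 0 (r - e)" and "b = min s (r + e)"
  have ab: "0 \<le> a" "a < r" "r < b" "b \<le> 1" using r e(1) DP(3) by (auto simp: a_def b_def)
  have S: "{z. a < cmod z \<and> cmod z < b} \<subseteq> ?V" using e(2) by (auto simp: a_def b_def)
  have rS: "of_real r \<in> {z. a < cmod z \<and> cmod z < b}" using ab r(1) by simp
  have "cmod (?h (of_real r)) = cmod (of_real r)"
  proof (rule annulus_isometry_preserves_norm[OF ab(1) _ ab(4) refl _ _ _ _ rS])
    show "a < b" using ab by simp
    show "?h holomorphic_on {z. a < cmod z \<and> cmod z < b}" using T(2) S by (rule holomorphic_on_subset)
    show "inj_on ?h {z. a < cmod z \<and> cmod z < b}" using T(3) S by (rule inj_on_subset)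
    show "?h ` {z. a < cmod z \<and> cmod z < b} \<subseteq> cusp_disc 1"
      by (rule order_trans[OF image_mono[OF S] order_trans[OF T(4) cusp_disc_mono[OF DQ(3)]]])
  qed (rule T(6)[OF subsetD[OF S]])
  moreover have "?h (of_real r) \<in> cusp_disc s'"
    by (rule subsetD[OF T(4) imageI[OF subsetD[OF S rS]]])
  ultimately show ?thesis using r(1) by (simp add: cusp_disc_def)
qed

lemma extend_cusp_nonzero: "z \<noteq> 0 \<Longrightarrow> extend_cusp P \<phi> z = \<iota> (\<phi> z)"
  by (simp add: extend_cusp_def)

lemma extend_cusp_compact:
  assumes "cusp_coordinate P s \<phi>" "r < s" "compact K" "K \<subseteq> cball 0 r"
  shows "compactin Y (extend_cusp P \<phi> ` K)" "closedin Y (extend_cusp P \<phi> ` K)"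
proof -
  have "compactin (top_of_set (ball 0 s)) K" using assms(2-4) by (auto simp: compactin_subtopology)
  then show "compactin Y (extend_cusp P \<phi> ` K)"
    using extend_cusp_continuous[OF assms(1)] by (rule image_compactin)
  then show "closedin Y (extend_cusp P \<phi> ` K)" by (rule compactin_imp_closedin[OF Hausdorff(2)])
qed

lemma extend_cusp_connected:
  assumes "cusp_coordinate P s \<phi>" "r < s" "connected K" "K \<subseteq> cball 0 r"
  shows "connectedin Y (extend_cusp P \<phi> ` K)"
proof (rule connectedin_continuous_map_image[OF extend_cusp_continuous[OF assms(1)]])
  show "connectedin (top_of_set (ball 0 s)) K" using assms(2-4) by (auto simp: connectedin_subtopology)
qed

text \<open>The closed disc around \<open>P\<close> is connected and meets the one around \<open>Q\<close>, but its centre does not lie in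
  it. So it meets the horocycle \<open>K'\<close> around \<open>Q\<close>, which is connected and disjoint from the horocycle
  around \<open>P\<close>, hence lies in the open disc around \<open>P\<close>. Exchanging the cusps leads to a contradiction.\<close>

lemma overlapping_discs_imp_radius_less:
  assumes P: "cusp_coordinate P s \<phi>" and Q: "cusp_coordinate Q s' \<psi>" and PQ: "P \<noteq> Q"
    and r: "0 < r" "r < s" "0 < r'" "r' < s'"
    and H: "\<phi> ` sphere 0 r \<inter> \<psi> ` sphere 0 r' = {}"
    and meet: "extend_cusp P \<phi> ` cball 0 r \<inter> extend_cusp Q \<psi> ` cball 0 r' \<noteq> {}"
  shows "r' < r"
proof -
  note DP = cusp_coordinateD[OF P] and DQ = cusp_coordinateD[OF Q]
  define D U K where "D = extend_cusp P \<phi> ` cball 0 r" and "U = extend_cusp P \<phi> ` ball 0 r"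
    and "K = extend_cusp P \<phi> ` sphere 0 r"
  define D' U' K' where "D' = extend_cusp Q \<psi> ` cball 0 r'" and "U' = extend_cusp Q \<psi> ` ball 0 r'"
    and "K' = extend_cusp Q \<psi> ` sphere 0 r'"
  note defs = D_def U_def K_def D'_def U'_def K'_def
  have c: "cball 0 r = ball 0 r \<union> sphere (0::complex) r" for r by auto
  have DU: "D = U \<union> K" "D' = U' \<union> K'" unfolding defs c image_Un by simp_all
  have oU: "openin Y U" "openin Y U'"
    unfolding defs using r extend_cusp_open[OF P open_ball, of 0 r] extend_cusp_open[OF Q open_ball, of 0 r'] by force+
  have cD: "closedin Y D" "closedin Y D'"
    unfolding defs by (rule extend_cusp_compact(2)[OF P r(2) compact_cball order_refl],
        rule extend_cusp_compact(2)[OF Q r(4) compact_cball order_refl])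
  have HH: "K \<inter> K' = {}"
  proof -
    have "\<iota> (\<phi> u) \<noteq> \<iota> (\<psi> v)" if "cmod u = r" "cmod v = r'" for u v
    proof
      assume "\<iota> (\<phi> u) = \<iota> (\<psi> v)"
      moreover have "u \<in> cusp_disc s" "v \<in> cusp_disc s'" using that r by (auto simp: cusp_disc_def)
      ultimately have "\<phi> u = \<psi> v" using DP(8) DQ(8) \<iota>(2) by (auto dest: inj_onD)
      moreover have "\<phi> u \<in> \<phi> ` sphere 0 r" "\<psi> v \<in> \<psi> ` sphere 0 r'" using that by auto
      ultimately show False using H by (metis IntI empty_iff)
    qed
    moreover have "u \<noteq> 0" if "cmod u = r" for u using that r(1) by auto
    moreover have "v \<noteq> 0" if "cmod v = r'" for v using that r(3) by auto
    ultimately show ?thesis by (auto simp: defs extend_cusp_nonzero)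
  qed
  have PD: "P \<in> D" unfolding defs by (rule image_eqI[of _ _ 0]) (use r in \<open>auto simp: extend_cusp_def\<close>)
  have PD': "P \<notin> D'"
  proof
    assume "P \<in> D'"
    then obtain z where z: "cmod z \<le> r'" "P = extend_cusp Q \<psi> z" by (auto simp: defs)
    then have "z \<noteq> 0" using PQ by (auto simp: extend_cusp_def)
    then have "z \<in> cusp_disc s'" using z(1) r by (auto simp: cusp_disc_def)
    then show False using DQ(8) DP(1) z(2) \<open>z \<noteq> 0\<close> by (auto simp: cusps_iff extend_cusp_nonzero)
  qed
  have P_top: "P \<in> topspace Y" using DP(1) by (simp add: cusps_iff)
  have "D \<inter> K' \<noteq> {}"
  proof
    assume e: "D \<inter> K' = {}"
    have "connectedin Y D" unfolding defs by (rule extend_cusp_connected[OF P r(2)]) auto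
    moreover have "openin Y (topspace Y - D')" using cD(2) by (rule openin_diff[OF openin_topspace])
    moreover have "D \<subseteq> U' \<union> (topspace Y - D')" using e DU closedin_subset[OF cD(1)] by blast
    moreover have "U' \<inter> (topspace Y - D') \<inter> D = {}" using DU by blast
    moreover have "U' \<inter> D \<noteq> {}" using meet[folded defs] e DU by blast
    moreover have "(topspace Y - D') \<inter> D \<noteq> {}" using PD PD' P_top by blast
    ultimately show False using connectedinD[OF _ oU(2)] by metis
  qed
  then have UH: "U \<inter> K' \<noteq> {}" using HH DU by blast
  have "K' \<subseteq> U"
  proof (rule ccontr)
    assume n: "\<not> K' \<subseteq> U"
    have "connectedin Y K'" unfolding defs by (rule extend_cusp_connected[OF Q r(4) connected_sphere]) auto
    moreover have "openin Y (topspace Y - D)" using cD(1) by (rule openin_diff[OF openin_topspace])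
    moreover have "K' \<subseteq> U \<union> (topspace Y - D)" using HH DU closedin_subset[OF cD(2)] by blast
    moreover have "U \<inter> (topspace Y - D) \<inter> K' = {}" using DU by blast
    moreover have "(topspace Y - D) \<inter> K' \<noteq> {}" using n HH DU closedin_subset[OF cD(2)] by blast
    ultimately show False using connectedinD[OF _ oU(1)] UH by metis
  qed
  have "\<psi> ` sphere 0 r' \<subseteq> \<phi> ` cusp_disc r"
  proof
    fix x assume "x \<in> \<psi> ` sphere 0 r'"
    then obtain v where v: "cmod v = r'" "x = \<psi> v" by auto
    then have v0: "v \<noteq> 0" "v \<in> cusp_disc s'" using r by (auto simp: cusp_disc_def)
    have "extend_cusp Q \<psi> v \<in> U" using \<open>K' \<subseteq> U\<close> v(1) by (auto simp: defs)
    then obtain u where u: "cmod u < r" "extend_cusp P \<phi> u = \<iota> x" using v v0 by (auto simp: defs extend_cusp_nonzero)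
    have xX: "x \<in> topspace X" using DQ(8)[OF v0(2)] v(2) by simp
    then have "u \<noteq> 0" using u(2) DP(1) by (auto simp: extend_cusp_def cusps_iff)
    then have "u \<in> cusp_disc r" "u \<in> cusp_disc s" using u(1) r by (auto simp: cusp_disc_def)
    then show "x \<in> \<phi> ` cusp_disc r"
      using u(2) xX DP(8) \<iota>(2) \<open>u \<noteq> 0\<close> by (auto simp: extend_cusp_nonzero dest: inj_onD)
  qed
  then show ?thesis
    by (rule horocycle_inside_imp_radius_less[OF Q cusp_coordinate_smaller[OF P r(1) less_imp_le[OF r(2)]] r(3,4)])
qed

lemma disjoint_horocycles_bound_disjoint_discs:
  assumes "cusp_coordinate P s \<phi>" "cusp_coordinate Q s' \<psi>" "P \<noteq> Q" "0 < r" "r < s" "0 < r'" "r' < s'"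
    "\<phi> ` sphere 0 r \<inter> \<psi> ` sphere 0 r' = {}"
  shows "extend_cusp P \<phi> ` cball 0 r \<inter> extend_cusp Q \<psi> ` cball 0 r' = {}"
  using overlapping_discs_imp_radius_less[OF assms(1,2,3,4-7,8)]
    overlapping_discs_imp_radius_less[OF assms(2,1) assms(3)[symmetric] assms(6,7,4,5)] assms(8)
  by (metis inf_commute less_asym)

end

section \<open>Capping off the cusps\<close>

context cusp_surface
begin

text \<open>By compactness: the closed discs are compact and disjoint, so that they have disjoint neighbourhoods,
  and there are finitely many of them.\<close>

lemma enlarge_disjoint_discs:
  assumes cc: "\<And>P. P \<in> cusps X Y \<iota> \<Longrightarrow> cusp_coordinate P (s P) (\<phi> P)"
    and r: "\<And>P. P \<in> cusps X Y \<iota> \<Longrightarrow> 0 < r P" "\<And>P. P \<in> cusps X Y \<iota> \<Longrightarrow> r P < s P"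
    and disj: "disjoint_family_on (\<lambda>P. \<phi> P ` sphere 0 (r P)) (cusps X Y \<iota>)"
  obtains t where "\<And>P. P \<in> cusps X Y \<iota> \<Longrightarrow> r P < t P" "\<And>P. P \<in> cusps X Y \<iota> \<Longrightarrow> t P < s P"
    "disjoint_family_on (\<lambda>P. \<phi> P ` cusp_disc (t P)) (cusps X Y \<iota>)"
proof -
  let ?C = "cusps X Y \<iota>"
  define D where "D P = extend_cusp P (\<phi> P) ` cball 0 (r P)" for P
  have "\<exists>U V. openin Y U \<and> openin Y V \<and> D P \<subseteq> U \<and> D Q \<subseteq> V \<and> disjnt U V"
    if PQ: "P \<in> ?C" "Q \<in> ?C" "P \<noteq> Q" for P Q
  proof (rule Hausdorff_space_compact_separation[OF Hausdorff(2)])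
    show "compactin Y (D P)" "compactin Y (D Q)"
      unfolding D_def using PQ extend_cusp_compact(1)[OF cc r(2) compact_cball order_refl] by auto
    have "\<phi> P ` sphere 0 (r P) \<inter> \<phi> Q ` sphere 0 (r Q) = {}"
      using disj PQ by (simp add: disjoint_family_on_def)
    then show "disjnt (D P) (D Q)"
      using disjoint_horocycles_bound_disjoint_discs[OF cc[OF PQ(1)] cc[OF PQ(2)] PQ(3) r[OF PQ(1)] r[OF PQ(2)]]
      by (simp add: disjnt_def D_def)
  qed metis
  then obtain U V where UV: "\<And>P Q. P \<in> ?C \<Longrightarrow> Q \<in> ?C \<Longrightarrow> P \<noteq> Q \<Longrightarrow>
      openin Y (U P Q) \<and> openin Y (V P Q) \<and> D P \<subseteq> U P Q \<and> D Q \<subseteq> V P Q \<and> disjnt (U P Q) (V P Q)"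
    by metis
  define W where "W P = (\<Inter>Q\<in>?C - {P}. U P Q \<inter> V Q P) \<inter> topspace Y" for P
  have W: "openin Y (W P)" "D P \<subseteq> W P" if P: "P \<in> ?C" for P
  proof -
    have "openin Y (U P Q \<inter> V Q P)" if "Q \<in> ?C - {P}" for Q
      using UV[of P Q] UV[of Q P] P that by auto
    then show "openin Y (W P)" unfolding W_def using finite_cusps by (intro openin_INT) auto
    have "D P \<subseteq> topspace Y"
      unfolding D_def by (rule compactin_subset_topspace[OF extend_cusp_compact(1)[OF cc[OF P] r(2)[OF P] compact_cball order_refl]])
    then show "D P \<subseteq> W P" unfolding W_def using UV P by fastforce
  qed
  have Wdisj: "W P \<inter> W Q = {}" if PQ: "P \<in> ?C" "Q \<in> ?C" "P \<noteq> Q" for P Q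
  proof -
    have "W P \<subseteq> U P Q" "W Q \<subseteq> V P Q" using PQ by (auto simp: W_def)
    then show ?thesis using UV[OF PQ] by (auto simp: disjnt_def)
  qed
  have "\<exists>t. r P < t \<and> t < s P \<and> (\<forall>z\<in>cusp_disc t. \<iota> (\<phi> P z) \<in> W P)" if P: "P \<in> ?C" for P
  proof -
    let ?V = "ball 0 (s P) \<inter> extend_cusp P (\<phi> P) -` W P"
    have oV: "open ?V" by (rule open_plane_preimage[OF open_ball extend_cusp_continuous[OF cc[OF P]] W(1)[OF P]])
    have cV: "cball 0 (r P) \<subseteq> ?V" using W(2)[OF P] r[OF P] by (auto simp: D_def)
    have "sphere 0 (r P) \<subseteq> ?V" using cV by auto
    then obtain e where e: "e > 0" "\<And>z. r P - e < cmod z \<Longrightarrow> cmod z < r P + e \<Longrightarrow> z \<in> ?V"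
      using sphere_neighbourhood[OF r(1)[OF P] oV] by metis
    define t where "t = min ((r P + s P) / 2) (r P + e)"
    have t: "r P < t" "t < s P" "t \<le> r P + e" using r[OF P] e(1) by (auto simp: t_def min_less_iff_disj)
    have "\<iota> (\<phi> P z) \<in> W P" if z: "z \<in> cusp_disc t" for z
    proof -
      have "z \<in> ?V"
      proof (cases "cmod z \<le> r P")
        case True
        then show ?thesis using cV by auto
      next
        case False
        then show ?thesis using z t(3) e(1) by (intro e(2)) (auto simp: cusp_disc_def)
      qed
      moreover have "z \<noteq> 0" using z by (auto simp: cusp_disc_def)
      ultimately show ?thesis by (simp add: extend_cusp_nonzero)
    qed
    then show ?thesis using t by blast
  qed
  then obtain t where t: "\<And>P. P \<in> ?C \<Longrightarrow> r P < t P \<and> t P < s P \<and> (\<forall>z\<in>cusp_disc (t P). \<iota> (\<phi> P z) \<in> W P)"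
    by metis
  have "disjoint_family_on (\<lambda>P. \<phi> P ` cusp_disc (t P)) ?C"
    unfolding disjoint_family_on_def
  proof (intro ballI impI)
    fix P Q assume PQ: "P \<in> ?C" "Q \<in> ?C" "P \<noteq> Q"
    show "\<phi> P ` cusp_disc (t P) \<inter> \<phi> Q ` cusp_disc (t Q) = {}"
    proof (rule ccontr)
      assume "\<phi> P ` cusp_disc (t P) \<inter> \<phi> Q ` cusp_disc (t Q) \<noteq> {}"
      then obtain x where "x \<in> \<phi> P ` cusp_disc (t P)" "x \<in> \<phi> Q ` cusp_disc (t Q)" by blast
      then have "\<iota> x \<in> W P \<inter> W Q" using t PQ by auto
      then show False using Wdisj[OF PQ] by blast
    qed
  qed
  then show ?thesis using that t by blast
qed

text \<open>Both sides, divided by the two derivatives, are the density of the hyperbolic metric in the chart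
  \<open>d\<close> of the compactification, computed through \<open>c\<close> and through \<open>e\<close>.\<close>

lemma density_in_compactification_independent:
  assumes c: "c \<in> A" "x \<in> fst c" and e: "e \<in> A" "x \<in> fst e" and d: "d \<in> B" "\<iota> x \<in> fst d"
  shows "\<rho> c (snd c x) * cmod (deriv (in_coords \<iota> e d) (snd e x))
    = \<rho> e (snd e x) * cmod (deriv (in_coords \<iota> c d) (snd c x))"
proof -
  note cc = atlasD[OF atlas_X c(1)] and ce = atlasD[OF atlas_X e(1)] and cd = atlasD[OF atlas_Y d(1)]
  have id: "continuous_map X X id" by (simp add: id_def)
  have x: "x \<in> topspace X" using is_chartD(4)[OF cc] c(2) by auto
  have idx: "id x \<in> fst e" using e(2) by simp
  have hA: "holomorphic_map A A id" using atlas_X unfolding atlas_def by blast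
  have 1: "in_coords id c e field_differentiable (at (snd c x))"
    by (rule holomorphic_map_in_coords_differentiable[OF hA c(1) e(1) cc id ce c(2) idx])
  have 2: "in_coords \<iota> e d field_differentiable (at (snd e (id x)))"
    unfolding id_apply by (rule holomorphic_map_in_coords_differentiable[OF \<iota>(3) e(1) d(1) ce \<iota>(1) cd e(2) d(2)])
  have "deriv (in_coords \<iota> c d) (snd c x)
      = deriv (in_coords \<iota> e d) (snd e (id x)) * deriv (in_coords id c e) (snd c x)"
    using in_coords_chain(2)[OF cc ce id c(2) idx 1 2] unfolding comp_id .
  moreover have "pullback_eq_at A \<rho> A \<rho> id x" using conformal_\<rho> x by (simp only: conformal_metric_def)
  then have "\<rho> c (snd c x) = \<rho> e (snd e x) * cmod (deriv (in_coords id c e) (snd c x))"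
    unfolding pullback_eq_at_def using c e by (metis id_apply)
  ultimately show ?thesis by (simp add: norm_mult)
qed

text \<open>The metric is glued from the hyperbolic metric on the complement of closed horocyclic discs and
  from the radial metrics on slightly larger open discs. They agree on the overlaps, which lie in annuli
  where the radial metrics are those of the cusp. The index set consists of the charts of the surface (\<open>Inl\<close>) and the cusps (\<open>Inr\<close>).\<close>

lemma glue_caps:
  assumes cc: "\<And>P. P \<in> cusps X Y \<iota> \<Longrightarrow> cusp_coordinate P (t P) (\<phi> P)"
    and t: "\<And>P. P \<in> cusps X Y \<iota> \<Longrightarrow> exp (- 1) < t P" "\<And>P. P \<in> cusps X Y \<iota> \<Longrightarrow> t P < 1"
    and disj: "disjoint_family_on (\<lambda>P. \<phi> P ` cusp_disc (t P)) (cusps X Y \<iota>)"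
  obtains \<sigma> where "conformal_metric Y B \<sigma>" "negatively_curved B \<sigma>"
    "\<And>p. p \<in> topspace X - (\<Union>P\<in>cusps X Y \<iota>. \<phi> P ` cusp_disc (t P)) \<Longrightarrow> pullback_eq_at A \<rho> B \<sigma> \<iota> p"
proof -
  let ?C = "cusps X Y \<iota>"
  have "\<exists>u a. 0 < a \<and> a < t P \<and> C_infinity_on (ball 0 (t P)) u \<and> (\<forall>z\<in>ball 0 (t P). laplacian u z > 0) \<and>
      (\<forall>z. a \<le> cmod z \<and> cmod z < t P \<longrightarrow> u z = ln (cusp_density z))" if P: "P \<in> ?C" for P
    by (rule cusp_cap[OF t(1)[OF P] t(2)[OF P]]) blast
  then obtain u a where "\<And>P. P \<in> ?C \<Longrightarrow> 0 < a P \<and> a P < t P \<and> C_infinity_on (ball 0 (t P)) (u P) \<and>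
      (\<forall>z\<in>ball 0 (t P). laplacian (u P) z > 0) \<and>
      (\<forall>z. a P \<le> cmod z \<and> cmod z < t P \<longrightarrow> u P z = ln (cusp_density z))"
    by metis
  then have ua: "\<And>P. P \<in> ?C \<Longrightarrow> 0 < a P" "\<And>P. P \<in> ?C \<Longrightarrow> a P < t P"
    "\<And>P. P \<in> ?C \<Longrightarrow> C_infinity_on (ball 0 (t P)) (u P)"
    "\<And>P z. P \<in> ?C \<Longrightarrow> z \<in> ball 0 (t P) \<Longrightarrow> laplacian (u P) z > 0"
    "\<And>P z. P \<in> ?C \<Longrightarrow> a P \<le> cmod z \<Longrightarrow> cmod z < t P \<Longrightarrow> u P z = ln (cusp_density z)"
    by simp_all
  define X0 where "X0 = {x \<in> topspace X. \<forall>P\<in>?C. \<iota> x \<notin> extend_cusp P (\<phi> P) ` cball 0 (a P)}"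
  have oX0: "openin X X0"
  proof -
    have "closedin Y (\<Union>P\<in>?C. extend_cusp P (\<phi> P) ` cball 0 (a P))"
      using extend_cusp_compact(2)[OF cc ua(2) compact_cball order_refl] finite_cusps by (intro closedin_Union) auto
    then have "openin Y (topspace Y - (\<Union>P\<in>?C. extend_cusp P (\<phi> P) ` cball 0 (a P)))"
      by (rule openin_diff[OF openin_topspace])
    from openin_continuous_map_preimage[OF \<iota>(1) this] show ?thesis
      by (rule back_subst[of "openin X"]) (use \<iota>_in_Y in \<open>auto simp: X0_def\<close>)
  qed
  define V where "V = case_sum (\<lambda>c::'a chart. snd c ` (fst c \<inter> X0)) (\<lambda>P. ball 0 (t P))"
  define E where "E = case_sum (\<lambda>c::'a chart. \<iota> \<circ> inv_into (fst c) (snd c)) (\<lambda>P. extend_cusp P (\<phi> P))"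
  define s where "s = case_sum \<rho> (\<lambda>P z. exp (u P z))"
  define I where "I = Inl ` A \<union> Inr ` ?C"
  have simps: "V (Inl c) = snd c ` (fst c \<inter> X0)" "V (Inr P) = ball 0 (t P)"
    "E (Inl c) = \<iota> \<circ> inv_into (fst c) (snd c)" "E (Inr P) = extend_cusp P (\<phi> P)"
    "s (Inl c) = \<rho> c" "s (Inr P) = (\<lambda>z. exp (u P z))" for c :: "'a chart" and P
    by (simp_all add: V_def E_def s_def)
  have coords_E: "snd d \<circ> E (Inl c) = in_coords \<iota> c d" for c and d :: "'b chart"
    by (simp add: simps in_coords_def comp_assoc)
  have E_Inl: "E (Inl c) (snd c x) = \<iota> x" if "c \<in> A" "x \<in> fst c" for c x
    using is_chartD(8)[OF atlasD[OF atlas_X that(1)] that(2)] by (simp add: simps)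
  have par: "parametrization Y B (V i) (E i)" if i: "i \<in> I" for i
  proof (cases i)
    case (Inl c)
    then have c: "c \<in> A" using i by (auto simp: I_def)
    note ch = atlasD[OF atlas_X c]
    show ?thesis
      unfolding Inl
    proof
      show "open (V (Inl c))"
        unfolding simps using oX0 is_chartD(1)[OF ch] by (intro is_chartD(6)[OF ch]) auto
      have "continuous_map (top_of_set (snd c ` fst c)) Y (\<iota> \<circ> inv_into (fst c) (snd c))"
        using chart_inverse_continuous[OF ch] \<iota>(1) by (rule continuous_map_compose)
      then show "continuous_map (top_of_set (V (Inl c))) Y (E (Inl c))"
        unfolding simps by (rule continuous_map_from_subtopology_mono) auto
      show "inj_on (E (Inl c)) (V (Inl c))"
      proof (rule inj_onI)
        fix v w assume "v \<in> V (Inl c)" "w \<in> V (Inl c)" and eq: "E (Inl c) v = E (Inl c) w"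
        then obtain x y where xy: "x \<in> fst c" "v = snd c x" "y \<in> fst c" "w = snd c y" by (auto simp: simps)
        then have "\<iota> x = \<iota> y" using eq E_Inl[OF c] by simp
        then have "x = y" using \<iota>(2) is_chartD(4)[OF ch] xy by (auto dest: inj_onD)
        then show "v = w" using xy by simp
      qed
      show "holomorphic_map {plane_chart (V (Inl c))} B (E (Inl c))"
        unfolding holomorphic_map_plane_chart coords_E
      proof
        fix d assume "d \<in> B"
        then have "in_coords \<iota> c d holomorphic_on snd c ` (fst c \<inter> \<iota> -` fst d)"
          using \<iota>(3) c by (auto simp: holomorphic_map_def)
        moreover have "V (Inl c) \<inter> E (Inl c) -` fst d \<subseteq> snd c ` (fst c \<inter> \<iota> -` fst d)"
        proof
          fix z assume z: "z \<in> V (Inl c) \<inter> E (Inl c) -` fst d"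
          then obtain x where "x \<in> fst c" "z = snd c x" by (auto simp: simps)
          then show "z \<in> snd c ` (fst c \<inter> \<iota> -` fst d)" using E_Inl[OF c, of x] z by auto
        qed
        ultimately show "in_coords \<iota> c d holomorphic_on V (Inl c) \<inter> E (Inl c) -` fst d"
          by (rule holomorphic_on_subset)
      qed
    qed (rule atlas_Y)
  next
    case (Inr P)
    then have P: "P \<in> ?C" using i by (auto simp: I_def)
    show ?thesis
      unfolding Inr simps using extend_cusp_continuous[OF cc[OF P]] extend_cusp_inj[OF cc[OF P]]
        extend_cusp_holomorphic[OF cc[OF P]] atlas_Y by unfold_locales auto
  qed
  define D where "D i = param_chart (V i) (E i)" for i
  have D: "fst (D i) = E i ` V i" "snd (D i) ` fst (D i) = V i" if "i \<in> I" for i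
    using parametrization.image_simps[OF par[OF that]] by (auto simp: D_def)
  have Dinv: "snd (D i) (E i z) = z" if "i \<in> I" "z \<in> V i" for i z
    using parametrization.inv_e[OF par[OF that(1)] that(2)] by (simp add: D_def param_chart_def)
  have Dderiv: "deriv (snd d \<circ> E i) z \<noteq> 0"
      "deriv (in_coords id d (D i)) (snd d (E i z)) = 1 / deriv (snd d \<circ> E i) z"
    if "i \<in> I" "z \<in> V i" "d \<in> B" "E i z \<in> fst d" for i z d
    using parametrization.deriv_in_coords[OF par[OF that(1)] that(3,2,4)] by (auto simp: D_def)
  have s_pos: "s i z > 0" if "i \<in> I" "z \<in> V i" for i z
    using that \<rho>_pos by (cases i) (auto simp: simps I_def)
  have X0_cap: "a P < cmod z" "z \<in> cusp_disc (t P)" "\<phi> P z = x"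
    if P: "P \<in> ?C" and x: "x \<in> X0" and z: "z \<in> ball 0 (t P)" "extend_cusp P (\<phi> P) z = \<iota> x" for P z x
  proof -
    have "\<iota> x \<notin> extend_cusp P (\<phi> P) ` cball 0 (a P)" using x P by (simp add: X0_def)
    then have "z \<notin> cball 0 (a P)" unfolding z(2)[symmetric] by blast
    then show "a P < cmod z" by simp
    then have "z \<noteq> 0" using ua(1)[OF P] by auto
    then show "z \<in> cusp_disc (t P)" using z by (simp add: cusp_disc_def)
    then have "\<phi> P z \<in> topspace X" using cusp_coordinateD(8)[OF cc[OF P]] by blast
    then show "\<phi> P z = x"
      using z(2) x \<open>z \<noteq> 0\<close> inj_onD[OF \<iota>(2)] by (auto simp: extend_cusp_nonzero X0_def)
  qed
  \<comment> \<open>Over the points of the surface outside the small discs, all local metrics represent the hyperbolic one.\<close>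
  have transfer: "s i z * cmod (deriv (in_coords \<iota> c d) (snd c x)) = \<rho> c (snd c x) * cmod (deriv (snd d \<circ> E i) z)"
    if i: "i \<in> I" "z \<in> V i" "E i z = \<iota> x" and x: "x \<in> X0" and c: "c \<in> A" "x \<in> fst c"
      and d: "d \<in> B" "\<iota> x \<in> fst d" for i z x c d
  proof (cases i)
    case (Inl e)
    then have e: "e \<in> A" using i by (auto simp: I_def)
    obtain y where y: "y \<in> fst e" "z = snd e y" using i(2) by (auto simp: Inl simps)
    then have "\<iota> y = \<iota> x" using i(3) E_Inl[OF e] by (simp add: Inl)
    then have "y = x" using inj_onD[OF \<iota>(2)] x y is_chartD(4)[OF atlasD[OF atlas_X e]] by (auto simp: X0_def)
    then show ?thesis
      using density_in_compactification_independent[OF e _ c d] y unfolding Inl coords_E by (simp add: simps)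
  next
    case (Inr P)
    then have P: "P \<in> ?C" using i by (auto simp: I_def)
    have zb: "z \<in> ball 0 (t P)" and ez: "extend_cusp P (\<phi> P) z = \<iota> x" using i by (auto simp: Inr simps)
    note z = X0_cap[OF P x zb ez]
    note CD = cusp_coordinateD[OF cc[OF P]]
    have "cusp_density z > 0" using z(2) cusp_disc_mono[OF CD(3)] by (intro cusp_density_pos) auto
    then have "s i z = cusp_density z" using ua(5)[OF P, of z] z(1) zb by (simp add: Inr simps)
    also have "\<dots> = \<rho> c (snd c x) * cmod (deriv (snd c \<circ> \<phi> P) z)"
      using CD(10)[OF c(1) z(2)] c(2) by (simp add: z(3))
    finally show ?thesis
      using deriv_extend_cusp[OF cc[OF P] z(2) c(1) _ d(1)] c(2) d(2) z(3) by (simp add: Inr simps norm_mult)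
  qed
  interpret G: local_metrics Y B Y id I D s
  proof
    show "atlas Y B" by (rule atlas_Y)
    show "continuous_map Y Y id" by (simp add: id_def)
    show "is_chart Y (D i)" if "i \<in> I" for i unfolding D_def by (rule parametrization.is_chart[OF par[OF that]])
    show "id ` topspace Y \<subseteq> (\<Union>i\<in>I. fst (D i))"
    proof
      fix y assume "y \<in> id ` topspace Y"
      then have y: "y \<in> topspace Y" by simp
      show "y \<in> (\<Union>i\<in>I. fst (D i))"
      proof (cases "y \<in> \<iota> ` X0")
        case True
        then obtain x where x: "x \<in> X0" "y = \<iota> x" by auto
        then have "x \<in> topspace X" by (simp add: X0_def)
        then obtain c where c: "c \<in> A" "x \<in> fst c" using atlas_chart_at[OF atlas_X] by blast
        then have "y \<in> E (Inl c) ` V (Inl c)"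
          using x E_Inl[OF c] by (intro image_eqI[of _ _ "snd c x"]) (auto simp: simps)
        then show ?thesis using D(1)[of "Inl c"] c by (intro UN_I[of "Inl c"]) (auto simp: I_def)
      next
        case False
        have "\<exists>P\<in>?C. y \<in> extend_cusp P (\<phi> P) ` ball 0 (t P)"
        proof (cases "y \<in> ?C")
          case True
          have "y = extend_cusp y (\<phi> y) 0" by (simp add: extend_cusp_def)
          then show ?thesis using True cusp_coordinateD(2)[OF cc[OF True]] by (intro bexI[of _ y] image_eqI[of _ _ 0]) auto
        next
          case n: False
          then obtain x where x: "x \<in> topspace X" "y = \<iota> x" using y by (auto simp: cusps_iff)
          then have "x \<notin> X0" using False by blast
          then obtain P where P: "P \<in> ?C" "y \<in> extend_cusp P (\<phi> P) ` cball 0 (a P)" using x unfolding X0_def by blast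
          moreover have "cball 0 (a P) \<subseteq> ball (0::complex) (t P)" using ua(2)[OF P(1)] by auto
          ultimately show ?thesis by blast
        qed
        then obtain P where "P \<in> ?C" "y \<in> E (Inr P) ` V (Inr P)" by (auto simp: simps)
        then show ?thesis using D(1)[of "Inr P"] by (intro UN_I[of "Inr P"]) (auto simp: I_def)
      qed
    qed
    show "in_coords id d (D i) holomorphic_on snd d ` (fst d \<inter> id -` fst (D i))" if "d \<in> B" "i \<in> I" for d i
      unfolding D_def by (rule parametrization.in_coords_holomorphic[OF par[OF that(2)] that(1)])
    show "C_infinity_on (snd (D i) ` fst (D i)) (s i)" if i: "i \<in> I" for i
      unfolding D(2)[OF i]
    proof (cases i)
      case (Inl c)
      then have "C_infinity_on (snd c ` fst c) (\<rho> c)"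
        using i conformal_\<rho> by (auto simp: I_def conformal_metric_def)
      then show "C_infinity_on (V i) (s i)" unfolding Inl simps by (rule C_infinity_on_subset) auto
    next
      case (Inr P)
      then show "C_infinity_on (V i) (s i)"
        using i ua(3) unfolding Inr simps by (intro C_infinity_on_exp) (auto simp: I_def)
    qed
    show "s i z > 0" if "i \<in> I" "z \<in> snd (D i) ` fst (D i)" for i z
      using that s_pos D(2) by simp
    fix d i j y assume d: "d \<in> B" "y \<in> fst d" and i: "i \<in> I" "id y \<in> fst (D i)" and j: "j \<in> I" "id y \<in> fst (D j)"
    obtain z where z: "z \<in> V i" "y = E i z" using i D(1)[OF i(1)] by auto
    obtain w where w: "w \<in> V j" "y = E j w" using j D(1)[OF j(1)] by auto
    note Di = Dderiv[OF i(1) z(1) d(1) d(2)[unfolded z(2)]]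
    note Dj = Dderiv[OF j(1) w(1) d(1) d(2)[unfolded w(2)]]
    have "s i z / cmod (deriv (snd d \<circ> E i) z) = s j w / cmod (deriv (snd d \<circ> E j) w)"
    proof (cases "y \<in> \<iota> ` X0")
      case True
      then obtain x where x: "x \<in> X0" "y = \<iota> x" by auto
      then have "x \<in> topspace X" by (simp add: X0_def)
      then obtain c where c: "c \<in> A" "x \<in> fst c" using atlas_chart_at[OF atlas_X] by blast
      have ti: "s i z * cmod (deriv (in_coords \<iota> c d) (snd c x)) = \<rho> c (snd c x) * cmod (deriv (snd d \<circ> E i) z)"
        using transfer[OF i(1) z(1) _ x(1) c d(1)] x(2) z(2) d(2) by simp
      have tj: "s j w * cmod (deriv (in_coords \<iota> c d) (snd c x)) = \<rho> c (snd c x) * cmod (deriv (snd d \<circ> E j) w)"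
        using transfer[OF j(1) w(1) _ x(1) c d(1)] x(2) w(2) d(2) by simp
      have "\<rho> c (snd c x) * cmod (deriv (snd d \<circ> E i) z) > 0" using \<rho>_pos[OF c] Di(1) by simp
      then have "cmod (deriv (in_coords \<iota> c d) (snd c x)) \<noteq> 0" using ti by auto
      then have "s i z / cmod (deriv (snd d \<circ> E i) z) = \<rho> c (snd c x) / cmod (deriv (in_coords \<iota> c d) (snd c x))"
        "s j w / cmod (deriv (snd d \<circ> E j) w) = \<rho> c (snd c x) / cmod (deriv (in_coords \<iota> c d) (snd c x))"
        using ti tj Di(1) Dj(1) by (simp_all add: frac_eq_eq)
      then show ?thesis by simp
    next
      case False
      have "\<exists>P\<in>?C. k = Inr P" if k: "k \<in> I" "v \<in> V k" "y = E k v" for k v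
      proof (cases k)
        case (Inl c)
        then have c: "c \<in> A" using k by (auto simp: I_def)
        obtain x where "x \<in> fst c" "x \<in> X0" "v = snd c x" using k(2) by (auto simp: Inl simps)
        then have "y = \<iota> x" using k(3) E_Inl[OF c] by (simp add: Inl)
        then show ?thesis using False \<open>x \<in> X0\<close> by auto
      qed (use k in \<open>auto simp: I_def\<close>)
      then obtain P Q where PQ: "P \<in> ?C" "i = Inr P" "Q \<in> ?C" "j = Inr Q" using i j z w by metis
      have "y \<in> insert P (\<iota> ` \<phi> P ` cusp_disc (t P))" "y \<in> insert Q (\<iota> ` \<phi> Q ` cusp_disc (t Q))"
        using z w PQ extend_cusp_image[OF cusp_coordinateD(2)[OF cc]] by (metis simps(2,4) image_eqI)+
      moreover have "P \<notin> \<iota> ` \<phi> Q ` cusp_disc (t Q)" "Q \<notin> \<iota> ` \<phi> P ` cusp_disc (t P)"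
        using PQ cusp_coordinateD(8)[OF cc] by (auto simp: cusps_iff)
      moreover have "\<iota> ` \<phi> P ` cusp_disc (t P) \<inter> \<iota> ` \<phi> Q ` cusp_disc (t Q) = {}" if "P \<noteq> Q"
      proof -
        have "\<phi> P ` cusp_disc (t P) \<inter> \<phi> Q ` cusp_disc (t Q) = {}"
          using disj PQ that by (simp add: disjoint_family_on_def)
        moreover have "\<phi> P ` cusp_disc (t P) \<subseteq> topspace X" "\<phi> Q ` cusp_disc (t Q) \<subseteq> topspace X"
          using PQ cusp_coordinateD(8)[OF cc] by auto
        ultimately show ?thesis using inj_on_image_Int[OF \<iota>(2)] by (metis image_empty)
      qed
      ultimately have "P = Q" by blast
      then have "i = j" using PQ by simp
      moreover have "z = w"
        using Dinv[OF i(1) z(1)] Dinv[OF j(1) w(1)] z(2) w(2) \<open>i = j\<close> by simp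
      ultimately show ?thesis by simp
    qed
    then show "s i (snd (D i) (id y)) * cmod (deriv (in_coords id d (D i)) (snd d y))
        = s j (snd (D j) (id y)) * cmod (deriv (in_coords id d (D j)) (snd d y))"
      using Di(2) Dj(2) Dinv[OF i(1) z(1)] Dinv[OF j(1) w(1)] z(2) w(2) by (simp add: norm_divide)
  qed simp
  show ?thesis
  proof (rule that[OF G.conformal])
    show "negatively_curved B G.pullback"
      unfolding negatively_curved_def
    proof (intro ballI)
      fix d z assume d: "d \<in> B" "z \<in> snd d ` fst d"
      then obtain y where y: "y \<in> fst d" "z = snd d y" by auto
      obtain i where i: "i \<in> I" "id y \<in> fst (D i)" using G.index_at[OF d(1) y(1)] by metis
      obtain w where w: "w \<in> V i" "y = E i w" using i D(1)[OF i(1)] by auto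
      have "gauss_curvature G.pullback d z = - laplacian (\<lambda>w. ln (s i w)) w / (s i w)\<^sup>2"
        using G.curvature[OF d(1) i(1) y(1) i(2)] y(2) w(2) Dinv[OF i(1) w(1)] by simp
      also have "\<dots> < 0"
      proof (cases i)
        case (Inl c)
        then have "c \<in> A" "w \<in> snd c ` fst c" using i w by (auto simp: I_def simps)
        then have "gauss_curvature \<rho> c w = - 1" using hyperbolic unfolding hyperbolic_metric_def by blast
        then show ?thesis unfolding Inl simps gauss_curvature_def by linarith
      next
        case (Inr P)
        then have "laplacian (u P) w > 0" using i w by (intro ua(4)) (auto simp: I_def simps)
        moreover have "s i w > 0" using s_pos i(1) w(1) by simp
        ultimately show ?thesis by (simp add: Inr simps divide_less_0_iff)
      qed
      finally show "gauss_curvature G.pullback d z < 0" .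
    qed
    fix p assume p: "p \<in> topspace X - (\<Union>P\<in>?C. \<phi> P ` cusp_disc (t P))"
    have pX0: "p \<in> X0"
      unfolding X0_def
    proof (intro CollectI conjI ballI notI)
      fix P assume P: "P \<in> ?C" and "\<iota> p \<in> extend_cusp P (\<phi> P) ` cball 0 (a P)"
      then have "\<iota> p \<in> extend_cusp P (\<phi> P) ` ball 0 (t P)" using ua(2)[OF P] by auto
      then have "\<iota> p \<in> insert P (\<iota> ` \<phi> P ` cusp_disc (t P))"
        unfolding extend_cusp_image[OF cusp_coordinateD(2)[OF cc[OF P]]] .
      then obtain z where "z \<in> cusp_disc (t P)" "\<iota> p = \<iota> (\<phi> P z)" using P p by (auto simp: cusps_iff)
      then show False using p P inj_onD[OF \<iota>(2), of p "\<phi> P z"] cusp_coordinateD(8)[OF cc[OF P]] by auto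
    qed (use p in simp)
    show "pullback_eq_at A \<rho> B G.pullback \<iota> p"
      unfolding pullback_eq_at_def
    proof (intro ballI impI, elim conjE)
      fix c d assume c: "c \<in> A" "p \<in> fst c" and d: "d \<in> B" "\<iota> p \<in> fst d"
      have i: "Inl c \<in> I" "snd c p \<in> V (Inl c)" using c pX0 by (auto simp: I_def simps)
      have e: "E (Inl c) (snd c p) = \<iota> p" by (rule E_Inl[OF c])
      have ip: "id (\<iota> p) \<in> fst (D (Inl c))" using D(1)[OF i(1)] i(2) e by force
      note D1 = Dderiv[OF i d(1) d(2)[folded e]]
      have "G.pullback d (snd d (\<iota> p)) = \<rho> c (snd c p) / cmod (deriv (in_coords \<iota> c d) (snd c p))"
        using G.pullback_eq[OF d(1) i(1) d(2) ip] D1(2) Dinv[OF i] unfolding coords_E e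
        by (simp add: simps norm_divide)
      then show "\<rho> c (snd c p) = G.pullback d (snd d (\<iota> p)) * cmod (deriv (in_coords \<iota> c d) (snd c p))"
        using D1(1) unfolding coords_E by simp
    qed
  qed
qed

lemma cusp_lengths_ge_imp_negatively_curved_cap:
  assumes "cusp_lengths_ge X A \<rho> Y \<iota> (2 * pi)"
  shows "\<exists>N \<sigma>. (\<forall>P \<in> cusps X Y \<iota>. horocyclic_nhd X A \<rho> Y \<iota> P (N P)) \<and>
    disjoint_family_on N (cusps X Y \<iota>) \<and> conformal_metric Y B \<sigma> \<and> negatively_curved B \<sigma> \<and>
    (\<forall>p \<in> topspace X - (\<Union>P \<in> cusps X Y \<iota>. N P). pullback_eq_at A \<rho> B \<sigma> \<iota> p)"
proof -
  let ?C = "cusps X Y \<iota>"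
  obtain H where H: "\<And>P. P \<in> ?C \<Longrightarrow> \<exists>l'\<ge>2 * pi. closed_horocycle X A \<rho> Y \<iota> P (H P) l'" "disjoint_family_on H ?C"
    using assms unfolding cusp_lengths_ge_def by blast
  have "\<exists>r s \<phi>. exp (- 1) \<le> r \<and> r < s \<and> cusp_coordinate P s \<phi> \<and> H P = \<phi> ` sphere 0 r" if P: "P \<in> ?C" for P
  proof -
    obtain l where l: "l \<ge> 2 * pi" "closed_horocycle X A \<rho> Y \<iota> P (H P) l" using H(1)[OF P] by blast
    obtain r s \<phi> where r: "0 < r" "r < s" "cusp_coordinate P s \<phi>" "H P = \<phi> ` sphere 0 r" "l = - 2 * pi / ln r"
      using closed_horocycleD[OF P l(2)] by metis
    have "ln r < 0" using r(1,2) cusp_coordinateD(3)[OF r(3)] by simp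
    then have "2 * pi * (- ln r) \<le> 2 * pi * 1" using l(1) unfolding r(5) by (simp add: field_simps)
    then have "- ln r \<le> 1" using mult_le_cancel_left_pos[of "2 * pi"] pi_gt_zero by (metis mult_pos_pos zero_less_numeral)
    then have "- 1 \<le> ln r" by simp
    then have "exp (- 1) \<le> r" using r(1) by (simp add: ln_ge_iff)
    then show ?thesis using r by blast
  qed
  then obtain r s \<phi> where r: "\<And>P. P \<in> ?C \<Longrightarrow> exp (- 1) \<le> r P" "\<And>P. P \<in> ?C \<Longrightarrow> r P < s P"
    "\<And>P. P \<in> ?C \<Longrightarrow> cusp_coordinate P (s P) (\<phi> P)" "\<And>P. P \<in> ?C \<Longrightarrow> H P = \<phi> P ` sphere 0 (r P)"
    by metis
  have r0: "0 < r P" if "P \<in> ?C" for P using r(1)[OF that] exp_gt_zero[of "- 1::real"] by linarith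
  have "disjoint_family_on (\<lambda>P. \<phi> P ` sphere 0 (r P)) ?C"
    using H(2) r(4) by (simp add: disjoint_family_on_def)
  then obtain t where t: "\<And>P. P \<in> ?C \<Longrightarrow> r P < t P" "\<And>P. P \<in> ?C \<Longrightarrow> t P < s P"
    "disjoint_family_on (\<lambda>P. \<phi> P ` cusp_disc (t P)) ?C"
    using enlarge_disjoint_discs[OF r(3) r0 r(2)] by metis
  have ct: "cusp_coordinate P (t P) (\<phi> P)" and t1: "exp (- 1) < t P" "t P < 1" if P: "P \<in> ?C" for P
  proof -
    show "cusp_coordinate P (t P) (\<phi> P)"
      using r0[OF P] t(1,2)[OF P] by (intro cusp_coordinate_smaller[OF r(3)[OF P]]) auto
    show "exp (- 1) < t P" "t P < 1"
      using r(1)[OF P] t(1,2)[OF P] cusp_coordinateD(3)[OF r(3)[OF P]] by linarith+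
  qed
  obtain \<sigma> where "conformal_metric Y B \<sigma>" "negatively_curved B \<sigma>"
    "\<And>p. p \<in> topspace X - (\<Union>P\<in>?C. \<phi> P ` cusp_disc (t P)) \<Longrightarrow> pullback_eq_at A \<rho> B \<sigma> \<iota> p"
    using glue_caps[OF ct t1 t(3)] by metis
  then show ?thesis
    using t(3) cusp_coordinate_imp_horocyclic_nhd[OF ct t1(2)]
    by (intro exI[of _ "\<lambda>P. \<phi> P ` cusp_disc (t P)"] exI[of _ \<sigma>]) blast
qed

end

theorem theorem15:
  fixes X :: "'a topology" and A :: "'a chart set" and \<rho> :: "'a density"
    and Y :: "'b topology" and B :: "'b chart set" and \<iota> :: "'a \<Rightarrow> 'b"
  assumes "riemann_surface X A"
    and "hyperbolic_metric X A \<rho>"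
    and "complete_metric X A \<rho>"
    and "surface_area A \<rho> < \<infinity>"
    and "conformal_compactification X A \<rho> Y B \<iota>"
  shows "(\<exists>N \<sigma>. (\<forall>P \<in> cusps X Y \<iota>. horocyclic_nhd X A \<rho> Y \<iota> P (N P)) \<and>
            disjoint_family_on N (cusps X Y \<iota>) \<and>
            conformal_metric Y B \<sigma> \<and> negatively_curved B \<sigma> \<and>
            (\<forall>p \<in> topspace X - (\<Union>P \<in> cusps X Y \<iota>. N P). pullback_eq_at A \<rho> B \<sigma> \<iota> p))
         \<longleftrightarrow> cusp_lengths_ge X A \<rho> Y \<iota> (2 * pi)"
proof -
  interpret cusp_surface X A \<rho> Y B \<iota>
    by unfold_locales (fact assms)+
  show ?thesis
  proof
    assume "\<exists>N \<sigma>. (\<forall>P \<in> cusps X Y \<iota>. horocyclic_nhd X A \<rho> Y \<iota> P (N P)) \<and>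
      disjoint_family_on N (cusps X Y \<iota>) \<and> conformal_metric Y B \<sigma> \<and> negatively_curved B \<sigma> \<and>
      (\<forall>p \<in> topspace X - (\<Union>P \<in> cusps X Y \<iota>. N P). pullback_eq_at A \<rho> B \<sigma> \<iota> p)"
    then obtain N \<sigma> where "\<And>P. P \<in> cusps X Y \<iota> \<Longrightarrow> horocyclic_nhd X A \<rho> Y \<iota> P (N P)"
      "disjoint_family_on N (cusps X Y \<iota>)" "conformal_metric Y B \<sigma>" "negatively_curved B \<sigma>"
      "\<And>p. p \<in> topspace X - (\<Union>P \<in> cusps X Y \<iota>. N P) \<Longrightarrow> pullback_eq_at A \<rho> B \<sigma> \<iota> p"
      by blast
    then show "cusp_lengths_ge X A \<rho> Y \<iota> (2 * pi)"
      by (rule negatively_curved_cap_imp_cusp_lengths_ge)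
  qed (rule cusp_lengths_ge_imp_negatively_curved_cap)
qed

end
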